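(* Let $\mathcal{M}$ be a smooth manifold and suppose that $f\in \mathcal{C}^{\infty}(\mathcal{M})$ is g-convex with respect to some geodesically complete connection on $\mathcal{M}$. Let $C_f$ be the set of critical points of $f$. If $C_f$ is discrete, then $|C_f| \le 1$.
   Context: A connection means a smooth torsion-free affine connection $\nabla$ ($\nabla_XY-\nabla_YX=[X,Y]$). A geodesic is a smooth curve $\gamma$ with $\nabla_{\dot\gamma}\dot\gamma=0$; $\nabla$ is geodesically complete if every geodesic extends infinitely (to all of $\mathbb{R}$). The function $f$ is g-convex with respect to $\nabla$ if $f\circ\gamma:[0,1]\to\mathbb{R}$ is convex for every geodesic $\gamma:[0,1]\to\mathcal{M}$; equivalently, $\mathrm{Hess}_\nabla f(X,Y)=X(Y(f))-(\nabla_XY)(f)$ is positive semidefinite at every point.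
   Formalization: The manifold is additionally assumed to be connected; without this the claim fails, e.g. for two disjoint copies of the real line with the flat connection and f = x² on each, where f is g-convex and has two isolated critical points. *)

theory Defs
  imports "HOL-Analysis.Analysis"
begin

section \<open>Smooth maps between normed spaces\<close>

text \<open>
  Derivatives are taken within \<^term>\<open>S\<close>. Below, \<^term>\<open>S\<close> is an open set of a Euclidean space,
  a relatively open subset of a real interval with nonempty interior (one-sided derivatives at the
  endpoints), or a subset of \<^term>\<open>{0}\<close>, on which every function is smooth. In the first two cases the
  derivative within \<^term>\<open>S\<close> is unique.
\<close>

primrec times_differentiable_on ::
    "nat \<Rightarrow> 'a::real_normed_vector set \<Rightarrow> ('a \<Rightarrow> 'b::real_normed_vector) \<Rightarrow> bool" where
  "times_differentiable_on 0 S f \<longleftrightarrow> continuous_on S f"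
| "times_differentiable_on (Suc k) S f \<longleftrightarrow>
     f differentiable_on S \<and>
     (\<forall>v. times_differentiable_on k S (\<lambda>x. frechet_derivative f (at x within S) v))"

definition smooth_on :: "'a::real_normed_vector set \<Rightarrow> ('a \<Rightarrow> 'b::real_normed_vector) \<Rightarrow> bool" where
  "smooth_on S f \<longleftrightarrow> (\<forall>k. times_differentiable_on k S f)"


section \<open>Smooth manifolds\<close>

text \<open>
  The manifold is a whole type \<^typ>\<open>'m\<close>; the Hausdorff and second-countability axioms are imposed as
  type classes on it.
\<close>

type_synonym ('m, 'e) chart = "'m set \<times> ('m \<Rightarrow> 'e)"

text \<open>
  The model space \<^term>\<open>E\<close> is the Euclidean space \<^typ>\<open>'e\<close>, or \<^term>\<open>{0}\<close>: since Euclidean-space types have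
  positive dimension, the latter is what admits manifolds of dimension zero.
\<close>

definition smooth_atlas ::
    "('m::{t2_space, second_countable_topology}, 'e::euclidean_space) chart set \<Rightarrow> bool" where
  "smooth_atlas A \<longleftrightarrow>
     (\<exists>E\<in>{UNIV, {0}}. \<forall>(U, \<phi>)\<in>A.
        open U \<and> openin (top_of_set E) (\<phi> ` U) \<and> homeomorphism U (\<phi> ` U) \<phi> (inv_into U \<phi>)) \<and>
     (\<Union>(U, \<phi>)\<in>A. U) = UNIV \<and>
     (\<forall>(U, \<phi>)\<in>A. \<forall>(V, \<psi>)\<in>A. smooth_on (\<phi> ` (U \<inter> V)) (\<psi> \<circ> inv_into U \<phi>))"

definition smooth_functions :: "('m, 'e::euclidean_space) chart set \<Rightarrow> ('m \<Rightarrow> real) set" where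
  "smooth_functions A = {f. \<forall>(U, \<phi>)\<in>A. smooth_on (\<phi> ` U) (f \<circ> inv_into U \<phi>)}"

definition critical_points :: "('m, 'e::euclidean_space) chart set \<Rightarrow> ('m \<Rightarrow> real) \<Rightarrow> 'm set" where
  "critical_points A f =
     {p. \<forall>(U, \<phi>)\<in>A. p \<in> U \<longrightarrow>
           ((f \<circ> inv_into U \<phi>) has_derivative (\<lambda>_. 0)) (at (\<phi> p) within \<phi> ` U)}"


section \<open>Vector fields and torsion-free affine connections\<close>

text \<open>
  Smooth vector fields are the derivations of the algebra of smooth functions. As operators they are
  \<^const>\<open>undefined\<close> outside that algebra, so that fields acting equally on it are equal.
\<close>

definition vector_fields ::
    "('m, 'e::euclidean_space) chart set \<Rightarrow> (('m \<Rightarrow> real) \<Rightarrow> 'm \<Rightarrow> real) set" where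
  "vector_fields A =
     {X \<in> smooth_functions A \<rightarrow>\<^sub>E smooth_functions A.
        (\<forall>g\<in>smooth_functions A. \<forall>h\<in>smooth_functions A.
           X (\<lambda>p. g p + h p) = (\<lambda>p. X g p + X h p)) \<and>
        (\<forall>c. \<forall>h\<in>smooth_functions A. X (\<lambda>p. c * h p) = (\<lambda>p. c * X h p)) \<and>
        (\<forall>g\<in>smooth_functions A. \<forall>h\<in>smooth_functions A.
           X (\<lambda>p. g p * h p) = (\<lambda>p. g p * X h p + h p * X g p))}"

definition vf_add ::
    "('m, 'e::euclidean_space) chart set \<Rightarrow> (('m \<Rightarrow> real) \<Rightarrow> 'm \<Rightarrow> real) \<Rightarrow>
     (('m \<Rightarrow> real) \<Rightarrow> 'm \<Rightarrow> real) \<Rightarrow> ('m \<Rightarrow> real) \<Rightarrow> 'm \<Rightarrow> real" where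
  "vf_add A X Y = (\<lambda>h\<in>smooth_functions A. \<lambda>p. X h p + Y h p)"

definition vf_scale ::
    "('m, 'e::euclidean_space) chart set \<Rightarrow> ('m \<Rightarrow> real) \<Rightarrow>
     (('m \<Rightarrow> real) \<Rightarrow> 'm \<Rightarrow> real) \<Rightarrow> ('m \<Rightarrow> real) \<Rightarrow> 'm \<Rightarrow> real" where
  "vf_scale A g X = (\<lambda>h\<in>smooth_functions A. \<lambda>p. g p * X h p)"

definition lie_bracket ::
    "('m, 'e::euclidean_space) chart set \<Rightarrow> (('m \<Rightarrow> real) \<Rightarrow> 'm \<Rightarrow> real) \<Rightarrow>
     (('m \<Rightarrow> real) \<Rightarrow> 'm \<Rightarrow> real) \<Rightarrow> ('m \<Rightarrow> real) \<Rightarrow> 'm \<Rightarrow> real" where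
  "lie_bracket A X Y = (\<lambda>h\<in>smooth_functions A. \<lambda>p. X (Y h) p - Y (X h) p)"

type_synonym 'm connection =
  "(('m \<Rightarrow> real) \<Rightarrow> 'm \<Rightarrow> real) \<Rightarrow> (('m \<Rightarrow> real) \<Rightarrow> 'm \<Rightarrow> real) \<Rightarrow> ('m \<Rightarrow> real) \<Rightarrow> 'm \<Rightarrow> real"

text \<open>
  \<^term>\<open>D X Y\<close> is the covariant derivative of \<^term>\<open>Y\<close> in direction \<^term>\<open>X\<close>. Real linearity in
  \<^term>\<open>Y\<close> is the Leibniz rule for constant functions.
\<close>

definition affine_connection ::
    "('m, 'e::euclidean_space) chart set \<Rightarrow> 'm connection \<Rightarrow> bool" where
  "affine_connection A D \<longleftrightarrow>
     (\<forall>X\<in>vector_fields A. \<forall>Y\<in>vector_fields A. D X Y \<in> vector_fields A) \<and>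
     (\<forall>X\<in>vector_fields A. \<forall>Y\<in>vector_fields A. \<forall>Z\<in>vector_fields A.
        D (vf_add A X Y) Z = vf_add A (D X Z) (D Y Z) \<and>
        D X (vf_add A Y Z) = vf_add A (D X Y) (D X Z)) \<and>
     (\<forall>h\<in>smooth_functions A. \<forall>X\<in>vector_fields A. \<forall>Y\<in>vector_fields A.
        D (vf_scale A h X) Y = vf_scale A h (D X Y) \<and>
        D X (vf_scale A h Y) = vf_add A (vf_scale A (X h) Y) (vf_scale A h (D X Y)))"

definition torsion_free ::
    "('m, 'e::euclidean_space) chart set \<Rightarrow> 'm connection \<Rightarrow> bool" where
  "torsion_free A D \<longleftrightarrow>
     (\<forall>X\<in>vector_fields A. \<forall>Y\<in>vector_fields A. \<forall>h\<in>smooth_functions A. \<forall>p.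
        D X Y h p - D Y X h p = lie_bracket A X Y h p)"


section \<open>Geodesics\<close>

definition smooth_curve_on ::
    "('m::topological_space, 'e::euclidean_space) chart set \<Rightarrow> real set \<Rightarrow> (real \<Rightarrow> 'm) \<Rightarrow> bool" where
  "smooth_curve_on A I \<gamma> \<longleftrightarrow>
     continuous_on I \<gamma> \<and> (\<forall>(U, \<phi>)\<in>A. smooth_on {t\<in>I. \<gamma> t \<in> U} (\<phi> \<circ> \<gamma>))"

text \<open>The velocity at time \<^term>\<open>t\<close>, as a derivation at the point \<^term>\<open>\<gamma> t\<close>.\<close>

definition velocity :: "real set \<Rightarrow> (real \<Rightarrow> 'm) \<Rightarrow> real \<Rightarrow> ('m \<Rightarrow> real) \<Rightarrow> real" where
  "velocity I \<gamma> t h = vector_derivative (h \<circ> \<gamma>) (at t within I)"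

text \<open>
  \<^term>\<open>W\<close> is the covariant derivative at time \<^term>\<open>t\<close> of a vector field \<^term>\<open>V\<close> along \<^term>\<open>\<gamma>\<close>. The
  covariant derivative along a curve is determined by linearity, the product rule and, for the
  restriction to \<^term>\<open>\<gamma>\<close> of a vector field \<^term>\<open>Y\<close> of the manifold, the value \<^term>\<open>D X Y\<close> at
  \<^term>\<open>\<gamma> t\<close> for any \<^term>\<open>X\<close> extending the velocity at \<^term>\<open>t\<close>. Since every field along \<^term>\<open>\<gamma>\<close> is,
  near \<^term>\<open>t\<close>, a combination of restrictions \<^term>\<open>Y j\<close> with smooth coefficients \<^term>\<open>a j\<close> (extend a
  coordinate frame), this gives the formula below, whose value does not depend on the choices.
\<close>

definition has_covariant_derivative_along ::
    "('m, 'e::euclidean_space) chart set \<Rightarrow> 'm connection \<Rightarrow> real set \<Rightarrow> (real \<Rightarrow> 'm) \<Rightarrow>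
     (real \<Rightarrow> ('m \<Rightarrow> real) \<Rightarrow> real) \<Rightarrow> real \<Rightarrow> (('m \<Rightarrow> real) \<Rightarrow> real) \<Rightarrow> bool" where
  "has_covariant_derivative_along A D I \<gamma> V t W \<longleftrightarrow>
     (\<exists>X\<in>vector_fields A. \<exists>T (n::nat) a Y.
        (\<forall>h\<in>smooth_functions A. X h (\<gamma> t) = velocity I \<gamma> t h) \<and>
        openin (top_of_set I) T \<and> t \<in> T \<and>
        (\<forall>j<n. smooth_on T (a j) \<and> Y j \<in> vector_fields A) \<and>
        (\<forall>s\<in>T. \<forall>h\<in>smooth_functions A. V s h = (\<Sum>j<n. a j s * Y j h (\<gamma> s))) \<and>
        (\<forall>h\<in>smooth_functions A.
           W h = (\<Sum>j<n. vector_derivative (a j) (at t within I) * Y j h (\<gamma> t)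
                          + a j t * D X (Y j) h (\<gamma> t))))"

definition geodesic_on ::
    "('m::topological_space, 'e::euclidean_space) chart set \<Rightarrow> 'm connection \<Rightarrow>
     real set \<Rightarrow> (real \<Rightarrow> 'm) \<Rightarrow> bool" where
  "geodesic_on A D I \<gamma> \<longleftrightarrow>
     smooth_curve_on A I \<gamma> \<and>
     (\<forall>t\<in>I. has_covariant_derivative_along A D I \<gamma> (velocity I \<gamma>) t (\<lambda>_. 0))"

definition geodesically_complete ::
    "('m::topological_space, 'e::euclidean_space) chart set \<Rightarrow> 'm connection \<Rightarrow> bool" where
  "geodesically_complete A D \<longleftrightarrow>
     (\<forall>I \<gamma>. is_interval I \<and> interior I \<noteq> {} \<and> geodesic_on A D I \<gamma> \<longrightarrow>
        (\<exists>\<gamma>'. geodesic_on A D UNIV \<gamma>' \<and> (\<forall>t\<in>I. \<gamma>' t = \<gamma> t)))"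

definition g_convex ::
    "('m::topological_space, 'e::euclidean_space) chart set \<Rightarrow> 'm connection \<Rightarrow>
     ('m \<Rightarrow> real) \<Rightarrow> bool" where
  "g_convex A D f \<longleftrightarrow> (\<forall>\<gamma>. geodesic_on A D {0..1} \<gamma> \<longrightarrow> convex_on {0..1} (f \<circ> \<gamma>))"

end

theory Submission
  imports Defs "HOL-Computational_Algebra.Polynomial"
begin

text \<open>
  Let \<open>p\<close> be a critical point and let \<open>exp\<close> map \<open>v\<close> to the point at time 1 of the geodesic leaving
  \<open>p\<close> with velocity \<open>v\<close>. Since \<open>f\<close> is convex along geodesics and critical at \<open>p\<close>, it is at
  least \<open>f p\<close> on the image of \<open>exp\<close>, which is a neighbourhood of \<open>p\<close>. As \<open>p\<close> is an isolated
  critical point, the inequality is strict away from \<open>v = 0\<close>, and by convexity \<open>f (exp v)\<close> then grows at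
  least linearly in the norm of \<open>v\<close>. Hence \<open>exp\<close> is proper and attains \<open>p\<close> only at \<open>0\<close>, where
  its derivative is the identity. A degree argument shows that such a map to a connected manifold is
  surjective, although a complete affine connection need not join every two points by a geodesic. So another
  critical point \<open>q\<close> is \<open>exp v\<close> for some nonzero \<open>v\<close>; following the geodesic backwards
  from \<open>q\<close> gives \<open>f q \<le> f p\<close>, a contradiction.

  Vector fields are derivations of the algebra of smooth functions, so Hadamard's lemma is needed to
  express them, and with them the geodesic equation, in coordinates. Continuity of \<open>exp\<close> follows
  from Gronwall's inequality, propagated along a geodesic from chart to chart; smooth functions on the
  manifold serve to compare positions and velocities across charts.
\<close>

subsection \<open>Calculus of smooth maps\<close>

text \<open>The exponential map is only shown to be continuous, never smooth. Two substitutes stand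
  in for the inverse function theorem and for a differential degree. Near 0 the bound
  |\<open>exp v\<close> - \<open>v\<close>| \<le> |\<open>v\<close>| / 2, read in a chart centred at
  \<open>p\<close>, is enough: with Brouwer's theorem it puts a neighbourhood of \<open>p\<close>
  into the image, it keeps \<open>exp v\<close> away from \<open>p\<close> for small nonzero
  \<open>v\<close>, and it gives \<open>exp v\<close> a nonnegative inner product with
  \<open>v\<close>, so that the induced map of spheres is nowhere antipodal to the identity. The
  constant 1/2 stands for any constant below 1. Globally, vanishing degree is replaced by the
  property that a map can be deformed, without change near infinity, to one that misses a given
  point. This property spreads over the connected manifold, and at \<open>p\<close> it collides with
  the fact that a sphere is not contractible. Connectedness always enters in the same way: a
  statement whose truth is locally constant in its parameter is either always or never true. The
  parameter is a point of the manifold or the time along a geodesic.\<close>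

lemma has_derivative_within_cong:
  assumes "\<And>y. y \<in> S \<Longrightarrow> f y = g y" "x \<in> S"
  shows "(f has_derivative D) (at x within S) \<longleftrightarrow> (g has_derivative D) (at x within S)"
  using assms has_derivative_transform[of x S f g D] has_derivative_transform[of x S g f D] by auto

lemma times_differentiable_on_cong:
  assumes "\<And>x. x \<in> S \<Longrightarrow> f x = g x"
  shows "times_differentiable_on k S f \<longleftrightarrow> times_differentiable_on k S g"
  using assms
proof (induction k arbitrary: f g)
  case 0
  then show ?case by (simp cong: continuous_on_cong)
next
  case (Suc k)
  have fd: "frechet_derivative f (at x within S) = frechet_derivative g (at x within S)"
    and df: "f differentiable (at x within S) \<longleftrightarrow> g differentiable (at x within S)" if "x \<in> S" for x
    using has_derivative_within_cong[OF Suc.prems that]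
    by (simp_all add: frechet_derivative_def differentiable_def)
  have "times_differentiable_on k S (\<lambda>x. frechet_derivative f (at x within S) v) \<longleftrightarrow>
        times_differentiable_on k S (\<lambda>x. frechet_derivative g (at x within S) v)" for v
    by (rule Suc.IH) (simp add: fd)
  then show ?case using df by (simp add: differentiable_on_def)
qed

lemma times_differentiable_on_pred:
  "times_differentiable_on (Suc k) S f \<Longrightarrow> times_differentiable_on k S f"
proof (induction k arbitrary: f)
  case 0
  then show ?case by (simp add: differentiable_imp_continuous_on)
next
  case (Suc k)
  have "times_differentiable_on (Suc k) S (\<lambda>x. frechet_derivative f (at x within S) v)" for v
    using Suc.prems by simp
  then have "times_differentiable_on k S (\<lambda>x. frechet_derivative f (at x within S) v)" for v
    by (rule Suc.IH)
  then show ?case using Suc.prems by simp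
qed

text \<open>On an open set the derivative is unique, so any explicit family \<open>D\<close> may
  replace the chosen \<open>frechet_derivative\<close>. The closure properties below all follow from
  this by induction on \<open>k\<close>.\<close>

lemma times_differentiable_on_SucI:
  assumes "open S" "\<And>x. x \<in> S \<Longrightarrow> (f has_derivative D x) (at x)"
    and "\<And>v. times_differentiable_on k S (\<lambda>x. D x v)"
  shows "times_differentiable_on (Suc k) S f"
proof -
  have "frechet_derivative f (at x within S) = D x" if "x \<in> S" for x
    using assms(1,2) that by (metis at_within_open frechet_derivative_at)
  then have "times_differentiable_on k S (\<lambda>x. frechet_derivative f (at x within S) v)" for v
    using assms(3)[of v] by (subst times_differentiable_on_cong[where g = "\<lambda>x. D x v"]) auto
  then show ?thesis
    using assms(1,2) by (auto simp: differentiable_on_def differentiable_def intro: has_derivative_at_withinI)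
qed

lemma times_differentiable_on_SucD:
  assumes "open S" "times_differentiable_on (Suc k) S f"
  shows "\<And>x. x \<in> S \<Longrightarrow> (f has_derivative frechet_derivative f (at x)) (at x)"
    and "times_differentiable_on k S (\<lambda>x. frechet_derivative f (at x) v)"
proof -
  have w: "at x within S = at x" if "x \<in> S" for x
    by (rule at_within_open[OF that assms(1)])
  have *: "f differentiable_on S"
    "\<And>v. times_differentiable_on k S (\<lambda>x. frechet_derivative f (at x within S) v)"
    using assms(2) unfolding times_differentiable_on.simps by blast+
  show "(f has_derivative frechet_derivative f (at x)) (at x)" if "x \<in> S" for x
    using *(1) that w[OF that] unfolding differentiable_on_def
    by (metis frechet_derivative_works)
  have "times_differentiable_on k S (\<lambda>x. frechet_derivative f (at x within S) v) \<longleftrightarrow>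
      times_differentiable_on k S (\<lambda>x. frechet_derivative f (at x) v)"
    by (rule times_differentiable_on_cong) (simp only: w)
  then show "times_differentiable_on k S (\<lambda>x. frechet_derivative f (at x) v)"
    using *(2) by blast
qed

lemma times_differentiable_on_imp_continuous_on:
  "times_differentiable_on k S f \<Longrightarrow> continuous_on S f"
  by (cases k) (auto simp: differentiable_imp_continuous_on)

lemma times_differentiable_on_subset:
  assumes "open S" "open T" "T \<subseteq> S" "times_differentiable_on k S f"
  shows "times_differentiable_on k T f"
  using assms(4)
proof (induction k arbitrary: f)
  case 0
  then show ?case using assms by (auto intro: continuous_on_subset)
next
  case (Suc k)
  note D = times_differentiable_on_SucD[OF assms(1) Suc.prems]
  show ?case
    by (rule times_differentiable_on_SucI[where D = "\<lambda>x. frechet_derivative f (at x)"])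
      (use assms D Suc.IH in auto)
qed

lemma times_differentiable_on_const: "open S \<Longrightarrow> times_differentiable_on k S (\<lambda>x. c)"
proof (induction k arbitrary: c)
  case 0
  then show ?case by simp
next
  case (Suc k)
  then show ?case
    by (intro times_differentiable_on_SucI[where D = "\<lambda>x v. 0"]) auto
qed

lemma times_differentiable_on_bounded_linear:
  assumes "open S" "bounded_linear L"
  shows "times_differentiable_on k S L"
proof (cases k)
  case 0
  then show ?thesis using assms by (simp add: linear_continuous_on)
next
  case (Suc k)
  then show ?thesis
    using assms times_differentiable_on_const
    by (auto intro!: times_differentiable_on_SucI[where D = "\<lambda>x. L"] bounded_linear_imp_has_derivative
        simp del: times_differentiable_on.simps)
qed

lemma times_differentiable_on_add:
  assumes "open S" "times_differentiable_on k S f" "times_differentiable_on k S g"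
  shows "times_differentiable_on k S (\<lambda>x. f x + g x)"
  using assms(2,3)
proof (induction k arbitrary: f g)
  case 0
  then show ?case by (auto intro: continuous_on_add)
next
  case (Suc k)
  note F = times_differentiable_on_SucD[OF assms(1) Suc.prems(1)]
  note G = times_differentiable_on_SucD[OF assms(1) Suc.prems(2)]
  show ?case
    by (rule times_differentiable_on_SucI[where D = "\<lambda>x v. frechet_derivative f (at x) v + frechet_derivative g (at x) v"])
      (use assms(1) F G Suc.IH has_derivative_add in auto)
qed

lemma times_differentiable_on_linear_compose:
  assumes "open S" "bounded_linear L" "times_differentiable_on k S f"
  shows "times_differentiable_on k S (\<lambda>x. L (f x))"
  using assms(3)
proof (induction k arbitrary: f)
  case 0
  then show ?case
    using assms(2) by (auto intro: linear_continuous_on continuous_on_compose2[of UNIV L])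
next
  case (Suc k)
  note F = times_differentiable_on_SucD[OF assms(1) Suc.prems(1)]
  show ?case
    by (rule times_differentiable_on_SucI[where D = "\<lambda>x v. L (frechet_derivative f (at x) v)"])
      (rule assms(1), rule bounded_linear.has_derivative[OF assms(2)], erule F, rule Suc.IH, rule F)
qed

lemma times_differentiable_on_bilinear:
  assumes "open S" "bounded_bilinear B" "times_differentiable_on k S f" "times_differentiable_on k S g"
  shows "times_differentiable_on k S (\<lambda>x. B (f x) (g x))"
  using assms(3,4)
proof (induction k arbitrary: f g)
  case 0
  then show ?case using bounded_bilinear.continuous_on[OF assms(2)] by auto
next
  case (Suc k)
  note F = times_differentiable_on_SucD[OF assms(1) Suc.prems(1)]
  note G = times_differentiable_on_SucD[OF assms(1) Suc.prems(2)]
  \<comment> \<open>The product rule pairs a derivative with an undifferentiated factor, so the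
    factors themselves are needed at order \<open>k\<close>.\<close>
  have *: "times_differentiable_on k S f" "times_differentiable_on k S g"
    using Suc.prems times_differentiable_on_pred by blast+
  show ?case
  proof (rule times_differentiable_on_SucI[where
          D = "\<lambda>x v. B (f x) (frechet_derivative g (at x) v) + B (frechet_derivative f (at x) v) (g x)"])
    show "((\<lambda>x. B (f x) (g x)) has_derivative
        (\<lambda>v. B (f x) (frechet_derivative g (at x) v) + B (frechet_derivative f (at x) v) (g x))) (at x)"
      if "x \<in> S" for x
      using bounded_bilinear.FDERIV[OF assms(2) F(1)[OF that] G(1)[OF that]] .
    show "times_differentiable_on k S
        (\<lambda>x. B (f x) (frechet_derivative g (at x) v) + B (frechet_derivative f (at x) v) (g x))" for v
      by (intro times_differentiable_on_add Suc.IH * F G assms(1))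
  qed (rule assms(1))
qed

lemma times_differentiable_on_sum:
  assumes "open S" "\<And>i. i \<in> I \<Longrightarrow> times_differentiable_on k S (f i)"
  shows "times_differentiable_on k S (\<lambda>x. \<Sum>i\<in>I. f i x)"
  using assms(2)
  by (induction I rule: infinite_finite_induct)
    (auto simp: times_differentiable_on_const times_differentiable_on_add assms(1))

lemma frechet_derivative_components:
  fixes f :: "'a::euclidean_space \<Rightarrow> 'b::real_normed_vector"
  assumes "f differentiable (at x)"
  shows "frechet_derivative f (at x) w = (\<Sum>b\<in>Basis. (w \<bullet> b) *\<^sub>R frechet_derivative f (at x) b)"
proof -
  interpret linear "frechet_derivative f (at x)"
    using assms by (rule linear_frechet_derivative)
  have "frechet_derivative f (at x) w = frechet_derivative f (at x) (\<Sum>b\<in>Basis. (w \<bullet> b) *\<^sub>R b)"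
    by (simp add: euclidean_representation)
  then show ?thesis by (simp add: sum scale)
qed

text \<open>In the chain rule the direction fed into the derivative of \<open>g\<close> varies with
  \<open>x\<close>. Expanding it in the basis of the Euclidean space in the middle leaves partial
  derivatives of \<open>g\<close> in fixed directions composed with \<open>f\<close>, to which the
  induction hypothesis applies.\<close>

lemma times_differentiable_on_compose:
  fixes f :: "'a::real_normed_vector \<Rightarrow> 'b::euclidean_space"
    and g :: "'b \<Rightarrow> 'c::real_normed_vector"
  assumes "open S" "open T" "f ` S \<subseteq> T"
    and "times_differentiable_on k S f" "times_differentiable_on k T g"
  shows "times_differentiable_on k S (\<lambda>x. g (f x))"
  using assms(4,5)
proof (induction k arbitrary: g)
  case 0
  then show ?case using assms(3) by (auto intro: continuous_on_compose2)
next
  case (Suc k)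
  note F = times_differentiable_on_SucD[OF assms(1) Suc.prems(1)]
  note G = times_differentiable_on_SucD[OF assms(2) Suc.prems(2)]
  have *: "times_differentiable_on k S f"
    using Suc.prems times_differentiable_on_pred by blast
  let ?D = "\<lambda>x v. \<Sum>b\<in>Basis. (frechet_derivative f (at x) v \<bullet> b) *\<^sub>R frechet_derivative g (at (f x)) b"
  show ?case
  proof (rule times_differentiable_on_SucI[where D = ?D])
    fix x assume x: "x \<in> S"
    then have fx: "f x \<in> T" using assms(3) by auto
    have "((\<lambda>x. g (f x)) has_derivative (\<lambda>v. frechet_derivative g (at (f x)) (frechet_derivative f (at x) v))) (at x)"
      using has_derivative_compose[OF F(1)[OF x] G(1)[OF fx]] .
    then show "((\<lambda>x. g (f x)) has_derivative ?D x) (at x)"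
      by (subst (asm) frechet_derivative_components[OF differentiableI[OF G(1)[OF fx]]])
  next
    fix v
    show "times_differentiable_on k S (\<lambda>x. ?D x v)"
      by (rule times_differentiable_on_sum[OF assms(1)],
          rule times_differentiable_on_bilinear[OF assms(1) bounded_bilinear_scaleR],
          rule times_differentiable_on_linear_compose[OF assms(1) bounded_linear_inner_left F(2)],
          rule Suc.IH[OF * G(2)])
  qed (rule assms(1))
qed

lemma times_differentiable_on_local:
  assumes "open S" "\<And>x. x \<in> S \<Longrightarrow> \<exists>N. open N \<and> x \<in> N \<and> N \<subseteq> S \<and> times_differentiable_on k N f"
  shows "times_differentiable_on k S f"
  using assms(2)
proof (induction k arbitrary: f)
  case 0
  have "\<exists>N. open N \<and> x \<in> N \<and> continuous_on N f" if "x \<in> S" for x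
    using 0[OF that] by auto
  then show ?case
    using assms(1) continuous_on_eq_continuous_at by (simp add: continuous_on_eq_continuous_at) blast
next
  case (Suc k)
  show ?case
  proof (rule times_differentiable_on_SucI[where D = "\<lambda>x. frechet_derivative f (at x)"])
    show "(f has_derivative frechet_derivative f (at x)) (at x)" if "x \<in> S" for x
    proof -
      from Suc.prems[OF that] obtain N where N: "open N" "x \<in> N" "times_differentiable_on (Suc k) N f"
        by (elim exE conjE)
      from times_differentiable_on_SucD(1)[OF N(1,3,2)] show ?thesis .
    qed
    show "times_differentiable_on k S (\<lambda>x. frechet_derivative f (at x) v)" for v
    proof (rule Suc.IH)
      fix x assume "x \<in> S"
      from Suc.prems[OF this] obtain N where N: "open N" "x \<in> N" "N \<subseteq> S" "times_differentiable_on (Suc k) N f"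
        by (elim exE conjE)
      from times_differentiable_on_SucD(2)[OF N(1,4)] N
      show "\<exists>N. open N \<and> x \<in> N \<and> N \<subseteq> S \<and> times_differentiable_on k N (\<lambda>x. frechet_derivative f (at x) v)"
        by (intro exI conjI)
    qed
  qed (rule assms(1))
qed

section \<open>Closure properties of smooth maps\<close>

lemma smooth_onI: "(\<And>k. times_differentiable_on k S f) \<Longrightarrow> smooth_on S f"
  by (simp add: smooth_on_def)

lemma smooth_onD: "smooth_on S f \<Longrightarrow> times_differentiable_on k S f"
  by (simp add: smooth_on_def)

lemma smooth_on_cong: "(\<And>x. x \<in> S \<Longrightarrow> f x = g x) \<Longrightarrow> smooth_on S f \<longleftrightarrow> smooth_on S g"
  unfolding smooth_on_def using times_differentiable_on_cong by blast

lemma smooth_on_imp_continuous_on: "smooth_on S f \<Longrightarrow> continuous_on S f"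
  unfolding smooth_on_def using times_differentiable_on_imp_continuous_on by blast

lemma smooth_on_subset: "smooth_on S f \<Longrightarrow> open S \<Longrightarrow> open T \<Longrightarrow> T \<subseteq> S \<Longrightarrow> smooth_on T f"
  by (rule smooth_onI, rule times_differentiable_on_subset) (assumption | rule smooth_onD | blast)+

lemma smooth_on_const: "open S \<Longrightarrow> smooth_on S (\<lambda>x. c)"
  by (rule smooth_onI, rule times_differentiable_on_const) (assumption | rule smooth_onD | blast)+

lemma smooth_on_bounded_linear: "open S \<Longrightarrow> bounded_linear L \<Longrightarrow> smooth_on S L"
  by (rule smooth_onI, rule times_differentiable_on_bounded_linear) (assumption | rule smooth_onD | blast)+

lemma smooth_on_id: "open S \<Longrightarrow> smooth_on S (\<lambda>x. x)"
  by (rule smooth_on_bounded_linear) (simp_all add: bounded_linear_ident)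

lemma smooth_on_add: "open S \<Longrightarrow> smooth_on S f \<Longrightarrow> smooth_on S g \<Longrightarrow> smooth_on S (\<lambda>x. f x + g x)"
  by (rule smooth_onI, rule times_differentiable_on_add) (assumption | rule smooth_onD | blast)+

lemma smooth_on_linear_compose:
  "open S \<Longrightarrow> bounded_linear L \<Longrightarrow> smooth_on S f \<Longrightarrow> smooth_on S (\<lambda>x. L (f x))"
  by (rule smooth_onI, rule times_differentiable_on_linear_compose) (assumption | rule smooth_onD | blast)+

lemma smooth_on_uminus: "open S \<Longrightarrow> smooth_on S f \<Longrightarrow> smooth_on S (\<lambda>x. - f x)"
  by (rule smooth_on_linear_compose[OF _ bounded_linear_minus[OF bounded_linear_ident]])

lemma smooth_on_diff: "open S \<Longrightarrow> smooth_on S f \<Longrightarrow> smooth_on S g \<Longrightarrow> smooth_on S (\<lambda>x. f x - g x)"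
  using smooth_on_add[of S f "\<lambda>x. - g x"] smooth_on_uminus[of S g] by simp

lemma smooth_on_bilinear:
  "open S \<Longrightarrow> bounded_bilinear B \<Longrightarrow> smooth_on S f \<Longrightarrow> smooth_on S g \<Longrightarrow> smooth_on S (\<lambda>x. B (f x) (g x))"
  by (rule smooth_onI, rule times_differentiable_on_bilinear) (assumption | rule smooth_onD | blast)+

lemma smooth_on_mult:
  fixes f g :: "'a::real_normed_vector \<Rightarrow> real"
  shows "open S \<Longrightarrow> smooth_on S f \<Longrightarrow> smooth_on S g \<Longrightarrow> smooth_on S (\<lambda>x. f x * g x)"
  by (rule smooth_on_bilinear[OF _ bounded_bilinear_mult])

lemma smooth_on_scaleR:
  "open S \<Longrightarrow> smooth_on S f \<Longrightarrow> smooth_on S g \<Longrightarrow> smooth_on S (\<lambda>x. f x *\<^sub>R g x)"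
  by (rule smooth_on_bilinear[OF _ bounded_bilinear_scaleR])

lemma smooth_on_inner:
  "open S \<Longrightarrow> smooth_on S f \<Longrightarrow> smooth_on S g \<Longrightarrow> smooth_on S (\<lambda>x. f x \<bullet> g x)"
  by (rule smooth_on_bilinear[OF _ bounded_bilinear_inner])

lemma smooth_on_sum:
  "open S \<Longrightarrow> (\<And>i. i \<in> I \<Longrightarrow> smooth_on S (f i)) \<Longrightarrow> smooth_on S (\<lambda>x. \<Sum>i\<in>I. f i x)"
  by (rule smooth_onI, rule times_differentiable_on_sum) (assumption | rule smooth_onD | blast)+

lemma smooth_on_compose:
  fixes f :: "'a::real_normed_vector \<Rightarrow> 'b::euclidean_space"
    and g :: "'b \<Rightarrow> 'c::real_normed_vector"
  shows "open S \<Longrightarrow> open T \<Longrightarrow> f ` S \<subseteq> T \<Longrightarrow> smooth_on S f \<Longrightarrow> smooth_on T g \<Longrightarrow> smooth_on S (\<lambda>x. g (f x))"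
  by (rule smooth_onI, rule times_differentiable_on_compose) (assumption | rule smooth_onD | blast)+

lemma smooth_on_Pair:
  assumes "open S" "smooth_on S f" "smooth_on S g"
  shows "smooth_on S (\<lambda>x. (f x, g x))"
proof -
  have "smooth_on S (\<lambda>x. (f x, 0) + (0, g x))"
    by (rule smooth_on_add[OF assms(1)
        smooth_on_linear_compose[OF assms(1) bounded_linear_Pair[OF bounded_linear_ident bounded_linear_zero] assms(2)]
        smooth_on_linear_compose[OF assms(1) bounded_linear_Pair[OF bounded_linear_zero bounded_linear_ident] assms(3)]])
  then show ?thesis by simp
qed

lemma smooth_on_local:
  assumes "open S" "\<And>x. x \<in> S \<Longrightarrow> \<exists>N. open N \<and> x \<in> N \<and> N \<subseteq> S \<and> smooth_on N f"
  shows "smooth_on S f"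
  unfolding smooth_on_def
proof
  show "times_differentiable_on k S f" for k
  proof (rule times_differentiable_on_local[OF assms(1)])
    fix x assume "x \<in> S"
    from assms(2)[OF this] obtain N where "open N" "x \<in> N" "N \<subseteq> S" "smooth_on N f"
      by (elim exE conjE)
    then show "\<exists>N. open N \<and> x \<in> N \<and> N \<subseteq> S \<and> times_differentiable_on k N f"
      by (intro exI[of _ N] conjI smooth_onD)
  qed
qed

lemma smooth_on_has_derivative:
  "smooth_on S f \<Longrightarrow> open S \<Longrightarrow> x \<in> S \<Longrightarrow> (f has_derivative frechet_derivative f (at x)) (at x)"
  by (rule times_differentiable_on_SucD(1)[OF _ smooth_onD])

lemma smooth_on_differentiable:
  "smooth_on S f \<Longrightarrow> open S \<Longrightarrow> x \<in> S \<Longrightarrow> f differentiable (at x)"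
  by (rule differentiableI[OF smooth_on_has_derivative])

lemma smooth_on_frechet_derivative:
  "smooth_on S f \<Longrightarrow> open S \<Longrightarrow> smooth_on S (\<lambda>x. frechet_derivative f (at x) v)"
  by (rule smooth_onI, rule times_differentiable_on_SucD(2)) (assumption | rule smooth_onD)+

lemma smooth_on_vector_derivative:
  fixes f :: "real \<Rightarrow> 'b::real_normed_vector"
  assumes "smooth_on S f" "open S"
  shows "smooth_on S (\<lambda>x. vector_derivative f (at x))"
    and "\<And>x. x \<in> S \<Longrightarrow> (f has_vector_derivative vector_derivative f (at x)) (at x)"
proof -
  show *: "(f has_vector_derivative vector_derivative f (at x)) (at x)" if "x \<in> S" for x
    using smooth_on_differentiable[OF assms that] vector_derivative_works by blast
  have "frechet_derivative f (at x) 1 = vector_derivative f (at x)" if "x \<in> S" for x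
    using *[OF that] frechet_derivative_at[of f "\<lambda>h. h *\<^sub>R vector_derivative f (at x)" x]
    by (metis has_vector_derivative_def scaleR_one)
  then show "smooth_on S (\<lambda>x. vector_derivative f (at x))"
    using smooth_on_frechet_derivative[OF assms, of 1]
    by (subst smooth_on_cong[where g = "\<lambda>x. frechet_derivative f (at x) 1"]) auto
qed

text \<open>Serves geodesics on \<open>{0..1}\<close>, whose derivatives at the end points are
  one-sided. A linear map on the reals is determined by its value at 1, and the limit-point
  condition makes the vector derivative within \<open>T\<close> unique, so the derivative within
  \<open>T\<close> is the ordinary one.\<close>

lemma smooth_on_subset_real:
  fixes f :: "real \<Rightarrow> 'b::real_normed_vector"
  assumes "open S" "smooth_on S f" "T \<subseteq> S" "\<And>x. x \<in> T \<Longrightarrow> at x within T \<noteq> bot"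
  shows "smooth_on T f"
  unfolding smooth_on_def
proof
  fix k
  have "times_differentiable_on k S f" using assms(2) by (simp add: smooth_on_def)
  then show "times_differentiable_on k T f"
  proof (induction k arbitrary: f)
    case 0
    then show ?case using assms(3) by (auto intro: continuous_on_subset)
  next
    case (Suc k)
    note D = times_differentiable_on_SucD[OF assms(1) Suc.prems]
    have d: "(f has_derivative frechet_derivative f (at x)) (at x within T)" if "x \<in> T" for x
      using D(1) that assms(3) has_derivative_at_withinI by blast
    have "frechet_derivative f (at x within T) = frechet_derivative f (at x)" if x: "x \<in> T" for x
    proof
      fix v
      have dd: "(f has_derivative frechet_derivative f (at x within T)) (at x within T)"
        using differentiableI[OF d[OF x]] frechet_derivative_works by metis
      have lin: "g u = u *\<^sub>R g 1" if "(f has_derivative g) (at x within T)" for g u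
        using linear_scale[OF has_derivative_linear[OF that], of u 1] by simp
      have "(f has_vector_derivative g 1) (at x within T)" if "(f has_derivative g) (at x within T)" for g
      proof -
        have "g = (\<lambda>h. h *\<^sub>R g 1)"
          by (rule ext, rule lin[OF that])
        with that show ?thesis
          unfolding has_vector_derivative_def
          using back_subst[of "\<lambda>D. (f has_derivative D) (at x within T)" g] by blast
      qed
      from vector_derivative_unique_within[OF assms(4)[OF x] this[OF dd] this[OF d[OF x]]]
      show "frechet_derivative f (at x within T) v = frechet_derivative f (at x) v"
        using lin[OF dd, of v] lin[OF d[OF x], of v] by metis
    qed
    then have "times_differentiable_on k T (\<lambda>x. frechet_derivative f (at x within T) v)" for v
      using Suc.IH[OF D(2)] by (subst times_differentiable_on_cong[where g = "\<lambda>x. frechet_derivative f (at x) v"]) auto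
    then show ?case using d by (auto simp: differentiable_on_def differentiable_def)
  qed
qed

subsection \<open>Bump functions\<close>

text \<open>The polynomial parameter makes the family closed under differentiation, so that a single
  induction gives smoothness. The classical flat function is \<open>flat 1\<close>.\<close>

definition flat :: "real poly \<Rightarrow> real \<Rightarrow> real" where
  "flat p x = (if x > 0 then poly p (1 / x) * exp (- 1 / x) else 0)"

lemma poly_times_exp_minus_tendsto_0: "((\<lambda>y. poly p y * exp (- y)) \<longlongrightarrow> (0::real)) at_top"
proof -
  have "((\<lambda>y. \<Sum>i\<le>degree p. coeff p i * (y ^ i / exp y)) \<longlongrightarrow> (\<Sum>i\<le>degree p. coeff p i * 0)) at_top"
    by (intro tendsto_intros tendsto_power_div_exp_0)
  then show ?thesis
    by (simp add: poly_altdef exp_minus sum_distrib_right divide_inverse mult.assoc)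
qed

text \<open>The polynomial \<open>[:0, 0, 1:]\<close> is the square of the variable and accounts for
  the factor 1/x^2 produced by differentiating 1/x. At 0 the right-hand difference quotient is again
  polynomial times exponential in 1/h, hence tends to 0.\<close>

lemma has_real_derivative_flat:
  "(flat p has_real_derivative flat ([:0, 0, 1:] * (p - pderiv p)) x) (at x)"
proof (cases x "0::real" rule: linorder_cases)
  case greater
  have e: "\<forall>\<^sub>F y in nhds x. flat p y = poly p (1 / y) * exp (- 1 / y)"
    using order_tendstoD(1)[OF tendsto_ident_at greater] greater
    by (auto intro!: eventually_mono[OF eventually_nhds_in_open[of "{0<..}" x]] simp: flat_def)
  have "((\<lambda>y. poly p (1 / y) * exp (- 1 / y)) has_real_derivative
      flat ([:0, 0, 1:] * (p - pderiv p)) x) (at x)"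
    using greater
    by (auto intro!: derivative_eq_intros simp: flat_def field_simps power2_eq_square)
  then show ?thesis
    using DERIV_cong_ev[OF refl e refl] by blast
next
  case less
  have e: "\<forall>\<^sub>F y in nhds x. flat p y = 0"
    using less by (auto intro!: eventually_mono[OF eventually_nhds_in_open[of "{..<0}" x]] simp: flat_def)
  have "((\<lambda>y. 0) has_real_derivative flat ([:0, 0, 1:] * (p - pderiv p)) x) (at x)"
    using less by (simp add: flat_def)
  then show ?thesis
    using DERIV_cong_ev[OF refl e refl] by blast
next
  case equal
  have "((\<lambda>h. flat p h / h) \<longlongrightarrow> 0) (at_right 0)"
  proof (rule Lim_transform_eventually)
    show "((\<lambda>h. poly (pCons 0 p) (inverse h) * exp (- inverse h)) \<longlongrightarrow> 0) (at_right (0::real))"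
      by (rule filterlim_compose[OF poly_times_exp_minus_tendsto_0 filterlim_inverse_at_top_right])
    show "\<forall>\<^sub>F h in at_right 0. poly (pCons 0 p) (inverse h) * exp (- inverse h) = flat p h / h"
      by (auto simp: eventually_at_filter flat_def field_simps)
  qed
  moreover have "((\<lambda>h. flat p h / h) \<longlongrightarrow> 0) (at_left 0)"
    by (rule tendsto_eventually) (auto simp: eventually_at_filter flat_def)
  ultimately have "((\<lambda>h. flat p h / h) \<longlongrightarrow> 0) (at 0)"
    by (simp add: filterlim_split_at_real)
  then show ?thesis
    unfolding equal by (simp add: DERIV_def flat_def)
qed

lemma smooth_on_flat: "smooth_on UNIV (flat p)"
proof (rule smooth_onI)
  fix k show "times_differentiable_on k UNIV (flat p)"
  proof (induction k arbitrary: p)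
    case 0
    then show ?case
      using DERIV_isCont[OF has_real_derivative_flat] by (simp add: continuous_on_eq_continuous_at)
  next
    case (Suc k)
    show ?case
    proof (rule times_differentiable_on_SucI)
      show "(flat p has_derivative (\<lambda>v. flat ([:0, 0, 1:] * (p - pderiv p)) x * v)) (at x)" for x
        using has_real_derivative_flat by (simp add: has_field_derivative_def)
      show "times_differentiable_on k UNIV (\<lambda>x. flat ([:0, 0, 1:] * (p - pderiv p)) x * v)" for v
        by (rule times_differentiable_on_linear_compose[OF open_UNIV bounded_linear_mult_left Suc.IH])
    qed simp
  qed
qed

text \<open>The derivative is written with \<open>inverse\<close> itself, so that the induction
  hypothesis covers both factors.\<close>

lemma smooth_on_inverse: "smooth_on {0<..} (inverse :: real \<Rightarrow> real)"
proof (rule smooth_onI)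
  fix k show "times_differentiable_on k {0<..} (inverse :: real \<Rightarrow> real)"
  proof (induction k)
    case 0
    show ?case by (auto intro!: continuous_on_inverse continuous_on_id)
  next
    case (Suc k)
    show ?case
    proof (rule times_differentiable_on_SucI)
      show "(inverse has_derivative (\<lambda>v. (inverse x * inverse x) * - v)) (at x)" if "x \<in> {0<..}" for x :: real
        using that by (auto intro!: derivative_eq_intros simp: mult_ac)
      show "times_differentiable_on k {0<..} (\<lambda>x. (inverse x * inverse x) * - v)" for v :: real
        by (rule times_differentiable_on_linear_compose[OF _ bounded_linear_mult_left],
          simp, rule times_differentiable_on_bilinear[OF _ bounded_bilinear_mult Suc Suc], simp)
    qed simp
  qed
qed

text \<open>The quotient g(x) / (g(x) + g(1 - x)) for the flat function g. Its denominator never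
  vanishes because x and 1 - x are not both nonpositive.\<close>

lemma smooth_step_exists:
  obtains s :: "real \<Rightarrow> real"
  where "smooth_on UNIV s" "\<And>x. x \<le> 0 \<Longrightarrow> s x = 0" "\<And>x. x \<ge> 1 \<Longrightarrow> s x = 1"
proof
  let ?g = "flat 1"
  let ?s = "\<lambda>x. ?g x * inverse (?g x + ?g (1 - x))"
  have g: "?g x \<ge> 0" "x > 0 \<Longrightarrow> ?g x > 0" "x \<le> 0 \<Longrightarrow> ?g x = 0" for x :: real
    by (auto simp: flat_def)
  have pos: "?g x + ?g (1 - x) > 0" for x :: real
    using g(1)[of x] g(1)[of "1 - x"] g(2)[of x] g(2)[of "1 - x"] by (cases "x > 0") auto
  have g1: "smooth_on UNIV (\<lambda>x. ?g (1 - x))"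
    by (rule smooth_on_compose[OF open_UNIV open_UNIV _ _ smooth_on_flat])
      (auto intro!: smooth_on_diff smooth_on_const smooth_on_id)
  show "smooth_on UNIV ?s"
    by (rule smooth_on_mult[OF open_UNIV smooth_on_flat],
        rule smooth_on_compose[OF open_UNIV open_greaterThan _ _ smooth_on_inverse],
        use pos in force, rule smooth_on_add[OF open_UNIV smooth_on_flat g1])
  show "?s x = 0" if "x \<le> 0" for x :: real using g(3)[OF that] by simp
  show "?s x = 1" if "x \<ge> 1" for x :: real using g(3)[of "1 - x"] g(2)[of x] that by simp
qed

lemma bump_exists:
  fixes c :: "'e::euclidean_space"
  assumes "r > 0"
  obtains \<beta> :: "'e \<Rightarrow> real"
  where "smooth_on UNIV \<beta>" "\<And>x. x \<in> cball c r \<Longrightarrow> \<beta> x = 1" "\<And>x. x \<notin> ball c (2 * r) \<Longrightarrow> \<beta> x = 0"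
proof -
  obtain s :: "real \<Rightarrow> real" where s: "smooth_on UNIV s" "\<And>x. x \<le> 0 \<Longrightarrow> s x = 0" "\<And>x. x \<ge> 1 \<Longrightarrow> s x = 1"
    by (rule smooth_step_exists) blast
  \<comment> \<open>This takes the value 1 at distance \<open>r\<close> from \<open>c\<close> and 0
    at distance \<open>2 * r\<close>. The squared distance keeps it smooth at
    \<open>c\<close>.\<close>
  let ?a = "\<lambda>x. (4 * r\<^sup>2 - (x - c) \<bullet> (x - c)) * inverse (3 * r\<^sup>2)"
  have sq: "(x - c) \<bullet> (x - c) = (dist c x)\<^sup>2" for x
    by (metis dist_commute dist_norm power2_norm_eq_inner)
  show ?thesis
  proof
    have "smooth_on UNIV ?a"
      by (rule smooth_on_mult[OF open_UNIV smooth_on_diff[OF open_UNIV smooth_on_const[OF open_UNIV]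
            smooth_on_inner[OF open_UNIV]] smooth_on_const[OF open_UNIV]])
        (rule smooth_on_diff[OF open_UNIV smooth_on_id smooth_on_const], simp_all)+
    then show "smooth_on UNIV (\<lambda>x. s (?a x))"
      by (rule smooth_on_compose[OF open_UNIV open_UNIV _ _ s(1), rotated]) simp
    show "s (?a x) = 1" if "x \<in> cball c r" for x
    proof (rule s(3))
      have "(dist c x)\<^sup>2 \<le> r\<^sup>2" using that by (intro power_mono) auto
      then show "1 \<le> ?a x" using assms by (simp add: sq field_simps)
    qed
    show "s (?a x) = 0" if "x \<notin> ball c (2 * r)" for x
    proof (rule s(2))
      have "(2 * r)\<^sup>2 \<le> (dist c x)\<^sup>2" using that assms by (intro power_mono) auto
      then show "?a x \<le> 0" using assms by (simp add: sq field_simps mult_le_0_iff)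
    qed
  qed
qed

subsection \<open>Hadamard's lemma\<close>

text \<open>The weight \<open>u\<close> is there for the induction: differentiating under the
  integral sign brings out a factor t and a partial derivative of \<open>g\<close>, which is an
  integral of the same form with weight \<open>u t * t\<close>.\<close>

lemma times_differentiable_on_ray_average:
  fixes g :: "'e::euclidean_space \<Rightarrow> real" and u :: "real \<Rightarrow> real"
  assumes B: "open B" "convex B" "x0 \<in> B"
    and "smooth_on B g" "continuous_on {0..1} u"
  shows "times_differentiable_on k B (\<lambda>x. integral (cbox 0 1) (\<lambda>t. u t * g (x0 + t *\<^sub>R (x - x0))))"
  using assms(4,5)
proof (induction k arbitrary: g u)
  have ray: "x0 + t *\<^sub>R (x - x0) \<in> B" if "x \<in> B" "t \<in> {0..1}" for x t
    using convexD_alt[OF B(2,3) that(1), of t] that(2) by (simp add: algebra_simps)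
  have cont: "continuous_on (B \<times> cbox 0 1) (\<lambda>(x, t). u t * h (x0 + t *\<^sub>R (x - x0)))"
    if "smooth_on B h" "continuous_on {0..1} u" for h :: "'e \<Rightarrow> real" and u
    unfolding case_prod_beta
    by (rule continuous_on_mult, rule continuous_on_compose2[OF that(2)], rule continuous_on_snd[OF continuous_on_id],
        force, rule continuous_on_compose2[OF smooth_on_imp_continuous_on[OF that(1)]])
      (auto intro!: continuous_intros ray)
  case 0
  then show ?case
    using integral_continuous_on_param[OF cont] by simp
  case (Suc k)
  let ?w = "\<lambda>x t b. (u t * t) * frechet_derivative g (at (x0 + t *\<^sub>R (x - x0))) b"
  \<comment> \<open>\<open>leibniz_rule\<close> asks for the derivative of the integrand as a
    bounded linear map depending continuously on the point and on t. In coordinates it is a finite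
    sum of continuous functions times fixed functionals.\<close>
  let ?F = "\<lambda>x t. \<Sum>b\<in>Basis. ?w x t b *\<^sub>R blinfun_inner_left b"
  have u': "continuous_on {0..1} (\<lambda>t. u t * t)"
    by (intro continuous_intros Suc.prems)
  have dg: "smooth_on B (\<lambda>x. frechet_derivative g (at x) b)" for b
    by (rule smooth_on_frechet_derivative[OF Suc.prems(1) B(1)])
  have contw: "continuous_on (B \<times> cbox 0 1) (\<lambda>(x, t). ?w x t b)" for b
    by (rule cont[OF dg u'])
  have contF: "continuous_on (B \<times> cbox 0 1) (\<lambda>(x, t). ?F x t)"
    unfolding case_prod_beta
    by (rule continuous_on_sum, rule continuous_on_scaleR[OF contw[unfolded case_prod_beta] continuous_on_const])
  have Fapp: "blinfun_apply (?F x t) v = ?w x t v" if "x \<in> B" "t \<in> cbox 0 1" for x t v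
  proof -
    have "g differentiable (at (x0 + t *\<^sub>R (x - x0)))"
      by (rule smooth_on_differentiable[OF Suc.prems(1) B(1) ray]) (use that in auto)
    from frechet_derivative_components[OF this, of v] show ?thesis
      by (simp add: blinfun.sum_left blinfun.scaleR_left sum_distrib_left mult_ac inner_commute)
  qed
  have sec: "continuous_on (cbox 0 1) (\<lambda>t. G x t)" if "continuous_on (B \<times> cbox 0 1) (\<lambda>(x, t). G x t)" "x \<in> B"
    for G :: "'e \<Rightarrow> real \<Rightarrow> 'z::topological_space" and x
    using continuous_on_compose2[OF that(1) continuous_on_Pair[OF continuous_on_const continuous_on_id], of x "cbox 0 1"] that(2)
    by auto
  show ?case
  proof (rule times_differentiable_on_SucI[OF B(1)])
    fix x assume x: "x \<in> B"
    have "((\<lambda>x. integral (cbox 0 1) (\<lambda>t. u t * g (x0 + t *\<^sub>R (x - x0)))) has_derivative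
        integral (cbox 0 1) (?F x)) (at x within B)"
    proof (rule leibniz_rule[OF _ _ contF x B(2)])
      fix y t assume y: "y \<in> B" and t: "t \<in> cbox (0::real) 1"
      have gy: "(g has_derivative frechet_derivative g (at (x0 + t *\<^sub>R (y - x0)))) (at (x0 + t *\<^sub>R (y - x0)))"
        by (rule smooth_on_has_derivative[OF Suc.prems(1) B(1) ray[OF y]]) (use t in auto)
      have "((\<lambda>x. x0 + t *\<^sub>R (x - x0)) has_derivative (\<lambda>v. t *\<^sub>R v)) (at y within B)"
        by (auto intro!: derivative_eq_intros)
      from has_derivative_compose[OF this gy]
      have "((\<lambda>x. u t * g (x0 + t *\<^sub>R (x - x0))) has_derivative
          (\<lambda>v. u t * frechet_derivative g (at (x0 + t *\<^sub>R (y - x0))) (t *\<^sub>R v))) (at y within B)"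
        by (auto intro!: derivative_eq_intros)
      moreover have "(\<lambda>v. u t * frechet_derivative g (at (x0 + t *\<^sub>R (y - x0))) (t *\<^sub>R v)) = blinfun_apply (?F y t)"
        using linear_scale[OF has_derivative_linear[OF gy]] Fapp[OF y t] by (simp add: fun_eq_iff mult_ac)
      ultimately show "((\<lambda>x. u t * g (x0 + t *\<^sub>R (x - x0))) has_derivative blinfun_apply (?F y t)) (at y within B)"
        by simp
    next
      fix y assume y: "y \<in> B"
      show "(\<lambda>t. u t * g (x0 + t *\<^sub>R (y - x0))) integrable_on cbox 0 1"
        by (rule integrable_continuous[OF sec[OF cont[OF Suc.prems] y]])
    qed
    moreover have "blinfun_apply (integral (cbox 0 1) (?F x)) v = integral (cbox 0 1) (\<lambda>t. ?w x t v)" for v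
    proof -
      have "integral (cbox 0 1) ((\<lambda>T. blinfun_apply T v) \<circ> ?F x) = blinfun_apply (integral (cbox 0 1) (?F x)) v"
        by (rule integral_linear[OF integrable_continuous[OF sec[OF contF x]]])
          (rule blinfun.bounded_linear_left)
      moreover have "integral (cbox 0 1) ((\<lambda>T. blinfun_apply T v) \<circ> ?F x) = integral (cbox 0 1) (\<lambda>t. ?w x t v)"
        by (rule integral_cong, unfold o_def, rule Fapp[OF x])
      ultimately show ?thesis by simp
    qed
    then have "blinfun_apply (integral (cbox 0 1) (?F x)) = (\<lambda>v. integral (cbox 0 1) (\<lambda>t. ?w x t v))"
      by (rule ext)
    ultimately show "((\<lambda>x. integral (cbox 0 1) (\<lambda>t. u t * g (x0 + t *\<^sub>R (x - x0)))) has_derivative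
        (\<lambda>v. integral (cbox 0 1) (\<lambda>t. ?w x t v))) (at x)"
      using at_within_open[OF x B(1)] by metis
  next
    show "times_differentiable_on k B (\<lambda>x. integral (cbox 0 1) (\<lambda>t. ?w x t v))" for v
      by (rule Suc.IH[OF dg u'])
  qed
qed

text \<open>The fundamental theorem of calculus along the segment from \<open>x0\<close> to
  \<open>x\<close>. \<open>G b\<close> is the average over this segment of the partial derivative in
  direction \<open>b\<close>.\<close>

lemma hadamard:
  fixes g :: "'e::euclidean_space \<Rightarrow> real"
  assumes B: "open B" "convex B" "x0 \<in> B" and g: "smooth_on B g"
  obtains G where "\<And>b. smooth_on B (G b)" "\<And>b. G b x0 = frechet_derivative g (at x0) b"
    "\<And>x. x \<in> B \<Longrightarrow> g x = g x0 + (\<Sum>b\<in>Basis. ((x - x0) \<bullet> b) * G b x)"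
proof
  let ?G = "\<lambda>b x. integral (cbox 0 1) (\<lambda>t. 1 * frechet_derivative g (at (x0 + t *\<^sub>R (x - x0))) b)"
  have dg: "smooth_on B (\<lambda>x. frechet_derivative g (at x) b)" for b
    by (rule smooth_on_frechet_derivative[OF g B(1)])
  show "smooth_on B (?G b)" for b
    by (rule smooth_onI, rule times_differentiable_on_ray_average[OF B dg]) simp
  show "?G b x0 = frechet_derivative g (at x0) b" for b
    by simp
  fix x assume x: "x \<in> B"
  have ray: "x0 + t *\<^sub>R (x - x0) \<in> B" if "t \<in> {0..1}" for t
    using convexD_alt[OF B(2,3) x, of t] that by (simp add: algebra_simps)
  have d: "((\<lambda>t. g (x0 + t *\<^sub>R (x - x0))) has_vector_derivative
      frechet_derivative g (at (x0 + t *\<^sub>R (x - x0))) (x - x0)) (at t within {0..1})" if t: "t \<in> {0..1}" for t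
  proof -
    have gy: "(g has_derivative frechet_derivative g (at (x0 + t *\<^sub>R (x - x0)))) (at (x0 + t *\<^sub>R (x - x0)))"
      by (rule smooth_on_has_derivative[OF g B(1) ray[OF t]])
    have "((\<lambda>t. x0 + t *\<^sub>R (x - x0)) has_derivative (\<lambda>s. s *\<^sub>R (x - x0))) (at t within {0..1})"
      by (auto intro!: derivative_eq_intros)
    from has_derivative_compose[OF this gy] show ?thesis
      using linear_scale[OF has_derivative_linear[OF gy]] by (simp add: has_vector_derivative_def)
  qed
  have int: "(\<lambda>t. frechet_derivative g (at (x0 + t *\<^sub>R (x - x0))) b) integrable_on cbox 0 1" for b
    by (rule integrable_continuous, rule continuous_on_compose2[OF smooth_on_imp_continuous_on[OF dg]])
      (auto intro!: continuous_intros ray)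
  have "((\<lambda>t. frechet_derivative g (at (x0 + t *\<^sub>R (x - x0))) (x - x0)) has_integral (g x - g x0)) {0..1}"
    using fundamental_theorem_of_calculus[OF _ d] by simp
  then have "g x - g x0 = integral (cbox 0 1) (\<lambda>t. frechet_derivative g (at (x0 + t *\<^sub>R (x - x0))) (x - x0))"
    by (simp add: integral_unique)
  also have "\<dots> = integral (cbox 0 1) (\<lambda>t. \<Sum>b\<in>Basis. ((x - x0) \<bullet> b) * frechet_derivative g (at (x0 + t *\<^sub>R (x - x0))) b)"
    by (rule integral_cong, subst frechet_derivative_components)
      (use smooth_on_differentiable[OF g B(1) ray] in auto)
  also have "\<dots> = (\<Sum>b\<in>Basis. ((x - x0) \<bullet> b) * ?G b x)"
    using int by (subst integral_sum) (auto intro!: integrable_on_mult_right)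
  finally show "g x = g x0 + (\<Sum>b\<in>Basis. ((x - x0) \<bullet> b) * ?G b x)" by simp
qed

lemma frechet_derivative_cong_open:
  assumes "open N" "x \<in> N" "\<And>y. y \<in> N \<Longrightarrow> f y = g y"
  shows "frechet_derivative f (at x) = frechet_derivative g (at x)"
proof -
  have "(f has_derivative D) (at x) \<longleftrightarrow> (g has_derivative D) (at x)" for D
    using has_derivative_transform_within_open[of f D x UNIV N g] has_derivative_transform_within_open[of g D x UNIV N f] assms
    by auto
  then show ?thesis by (simp add: frechet_derivative_def)
qed

lemma vector_derivative_cong_open:
  assumes "open N" "x \<in> N" "\<And>y. y \<in> N \<Longrightarrow> f y = g y"
  shows "vector_derivative f (at x) = vector_derivative g (at x)"
proof -
  have "(f has_vector_derivative D) (at x) \<longleftrightarrow> (g has_vector_derivative D) (at x)" for D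
    using has_vector_derivative_transform_within_open[of f D x N g] has_vector_derivative_transform_within_open[of g D x N f] assms
    by auto
  then show ?thesis by (simp add: vector_derivative_def)
qed

subsection \<open>Smooth functions and vector fields in a chart\<close>

definition extend_by_zero :: "'m set \<Rightarrow> ('m \<Rightarrow> 'e) \<Rightarrow> ('e \<Rightarrow> real) \<Rightarrow> 'm \<Rightarrow> real" where
  "extend_by_zero U \<phi> g p = (if p \<in> U then g (\<phi> p) else 0)"

text \<open>The case of \<open>smooth_atlas\<close> in which the model space is the whole Euclidean
  space. Dimension zero is treated by \<open>zero_dimensional_singleton\<close>.\<close>

locale smooth_manifold =
  fixes A :: "('m::t2_space, 'e::euclidean_space) chart set"
  assumes chart_open: "\<And>U \<phi>. (U, \<phi>) \<in> A \<Longrightarrow> open U"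
    and chart_image_open: "\<And>U \<phi>. (U, \<phi>) \<in> A \<Longrightarrow> open (\<phi> ` U)"
    and chart_homeomorphism: "\<And>U \<phi>. (U, \<phi>) \<in> A \<Longrightarrow> homeomorphism U (\<phi> ` U) \<phi> (inv_into U \<phi>)"
    and chart_cover: "\<And>p. \<exists>U \<phi>. (U, \<phi>) \<in> A \<and> p \<in> U"
    and chart_transition: "\<And>U \<phi> V \<psi>. (U, \<phi>) \<in> A \<Longrightarrow> (V, \<psi>) \<in> A \<Longrightarrow>
      smooth_on (\<phi> ` (U \<inter> V)) (\<psi> \<circ> inv_into U \<phi>)"
begin

lemma chart_inv [simp]: "(U, \<phi>) \<in> A \<Longrightarrow> p \<in> U \<Longrightarrow> inv_into U \<phi> (\<phi> p) = p"
  using chart_homeomorphism homeomorphism_apply1 by metis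

lemma chart_right_inverse: "(U, \<phi>) \<in> A \<Longrightarrow> x \<in> \<phi> ` U \<Longrightarrow> \<phi> (inv_into U \<phi> x) = x"
  by (simp add: f_inv_into_f)

lemma chart_inv_in: "x \<in> \<phi> ` U \<Longrightarrow> inv_into U \<phi> x \<in> U"
  by (rule inv_into_into)

lemma chart_continuous: "(U, \<phi>) \<in> A \<Longrightarrow> continuous_on U \<phi>"
  using chart_homeomorphism homeomorphism_cont1 by blast

lemma chart_inv_continuous: "(U, \<phi>) \<in> A \<Longrightarrow> continuous_on (\<phi> ` U) (inv_into U \<phi>)"
  using chart_homeomorphism homeomorphism_cont2 by blast

lemma chart_image_open_subset:
  assumes "(U, \<phi>) \<in> A" "open W" "W \<subseteq> U"
  shows "open (\<phi> ` W)"
proof -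
  have "\<phi> ` W = \<phi> ` U \<inter> inv_into U \<phi> -` W"
    using assms(1,3) by force
  then show ?thesis
    using continuous_open_preimage[OF chart_inv_continuous[OF assms(1)] chart_image_open[OF assms(1)] assms(2)] by simp
qed

lemma chart_vimage_open:
  assumes "(U, \<phi>) \<in> A" "open W"
  shows "open {p \<in> U. \<phi> p \<in> W}"
  using continuous_open_preimage[OF chart_continuous[OF assms(1)] chart_open[OF assms(1)] assms(2)]
  by (simp add: Int_def vimage_def)

lemma smooth_in_chart:
  "h \<in> smooth_functions A \<Longrightarrow> (U, \<phi>) \<in> A \<Longrightarrow> smooth_on (\<phi> ` U) (\<lambda>x. h (inv_into U \<phi> x))"
  unfolding smooth_functions_def by (auto simp: o_def)

lemma smooth_functionsI:
  "(\<And>U \<phi>. (U, \<phi>) \<in> A \<Longrightarrow> smooth_on (\<phi> ` U) (\<lambda>x. h (inv_into U \<phi> x))) \<Longrightarrow> h \<in> smooth_functions A"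
  unfolding smooth_functions_def by (auto simp: o_def)

lemma smooth_functions_const [simp]: "(\<lambda>p. k) \<in> smooth_functions A"
  by (rule smooth_functionsI) (rule smooth_on_const[OF chart_image_open])

lemma smooth_functions_add [intro]:
  "g \<in> smooth_functions A \<Longrightarrow> h \<in> smooth_functions A \<Longrightarrow> (\<lambda>p. g p + h p) \<in> smooth_functions A"
  by (rule smooth_functionsI) (rule smooth_on_add[OF chart_image_open smooth_in_chart smooth_in_chart])

lemma smooth_functions_mult [intro]:
  "g \<in> smooth_functions A \<Longrightarrow> h \<in> smooth_functions A \<Longrightarrow> (\<lambda>p. g p * h p) \<in> smooth_functions A"
  by (rule smooth_functionsI) (rule smooth_on_mult[OF chart_image_open smooth_in_chart smooth_in_chart])

lemma smooth_functions_sum [intro]: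
  "(\<And>i. i \<in> I \<Longrightarrow> g i \<in> smooth_functions A) \<Longrightarrow> (\<lambda>p. \<Sum>i\<in>I. g i p) \<in> smooth_functions A"
  by (rule smooth_functionsI) (rule smooth_on_sum[OF chart_image_open smooth_in_chart])

text \<open>At a point of \<open>U\<close> the extension is smooth by the transition map. At a point
  outside \<open>U\<close> it vanishes nearby: the image of \<open>K\<close> in the manifold is
  compact, hence closed because the manifold is Hausdorff, and the extension is zero off it.\<close>

lemma extend_by_zero_smooth:
  assumes U: "(U, \<phi>) \<in> A" and g: "smooth_on (\<phi> ` U) g"
    and K: "compact K" "K \<subseteq> \<phi> ` U" "\<And>x. x \<in> \<phi> ` U - K \<Longrightarrow> g x = 0"
  shows "extend_by_zero U \<phi> g \<in> smooth_functions A"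
proof (rule smooth_functionsI)
  fix V \<psi> assume V: "(V, \<psi>) \<in> A"
  let ?h = "\<lambda>y. extend_by_zero U \<phi> g (inv_into V \<psi> y)"
  show "smooth_on (\<psi> ` V) ?h"
  proof (rule smooth_on_local[OF chart_image_open[OF V]])
    fix y assume "y \<in> \<psi> ` V"
    then obtain q where q: "q \<in> V" "y = \<psi> q" by auto
    show "\<exists>N. open N \<and> y \<in> N \<and> N \<subseteq> \<psi> ` V \<and> smooth_on N ?h"
    proof (cases "q \<in> U")
      case True
      let ?N = "\<psi> ` (V \<inter> U)"
      have N: "open ?N"
        by (rule chart_image_open_subset[OF V]) (use chart_open U V in auto)
      have *: "smooth_on ?N (\<lambda>y. g ((\<phi> \<circ> inv_into V \<psi>) y))"
        by (rule smooth_on_compose[OF N chart_image_open[OF U] _ chart_transition[OF V U] g]) (use V in auto)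
      have "?h y = g ((\<phi> \<circ> inv_into V \<psi>) y)" if "y \<in> ?N" for y
        using that V by (auto simp: extend_by_zero_def)
      then have "smooth_on ?N ?h \<longleftrightarrow> smooth_on ?N (\<lambda>y. g ((\<phi> \<circ> inv_into V \<psi>) y))"
        by (rule smooth_on_cong)
      with * have "smooth_on ?N ?h" by (rule iffD2[rotated])
      then show ?thesis using N q True by (intro exI[of _ ?N]) auto
    next
      case False
      let ?K = "inv_into U \<phi> ` K"
      have "compact ?K"
        by (rule compact_continuous_image[OF continuous_on_subset[OF chart_inv_continuous[OF U] K(2)] K(1)])
      then have W: "open (V - ?K)"
        by (rule open_Diff[OF chart_open[OF V] compact_imp_closed])
      let ?N = "\<psi> ` (V - ?K)"
      have N: "open ?N" by (rule chart_image_open_subset[OF V W]) auto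
      have "?K \<subseteq> U" using K(2) by (auto intro: inv_into_into)
      then have "q \<notin> ?K" using False by auto
      then have y: "y \<in> ?N" using q by auto
      have "extend_by_zero U \<phi> g p = 0" if "p \<notin> ?K" for p
      proof (cases "p \<in> U")
        case True
        then have "\<phi> p \<notin> K" using that U by (metis chart_inv imageI)
        then show ?thesis using K(3)[of "\<phi> p"] True by (simp add: extend_by_zero_def)
      qed (simp add: extend_by_zero_def)
      then have "?h y = 0" if "y \<in> ?N" for y
        using that V by auto
      then have "smooth_on ?N ?h \<longleftrightarrow> smooth_on ?N (\<lambda>y. 0 :: real)"
        by (rule smooth_on_cong)
      then have "smooth_on ?N ?h" using smooth_on_const[OF N, of "0 :: real"] by simp
      then show ?thesis using N y by (intro exI[of _ ?N]) auto
    qed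
  qed
qed

section \<open>Derivations and velocities\<close>

lemma vector_fieldsD:
  assumes "X \<in> vector_fields A"
  shows "h \<in> smooth_functions A \<Longrightarrow> X h \<in> smooth_functions A"
    and "h \<notin> smooth_functions A \<Longrightarrow> X h = undefined"
    and "g \<in> smooth_functions A \<Longrightarrow> h \<in> smooth_functions A \<Longrightarrow> X (\<lambda>p. g p + h p) q = X g q + X h q"
    and "h \<in> smooth_functions A \<Longrightarrow> X (\<lambda>p. k * h p) q = k * X h q"
    and "g \<in> smooth_functions A \<Longrightarrow> h \<in> smooth_functions A \<Longrightarrow> X (\<lambda>p. g p * h p) q = g q * X h q + h q * X g q"
  using assms unfolding vector_fields_def by (auto simp: PiE_def extensional_def Pi_def)

text \<open>The Leibniz rule for 1 * 1 forces \<open>X\<close> to vanish on 1; linearity does the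
  rest.\<close>

lemma vector_field_const: "X \<in> vector_fields A \<Longrightarrow> X (\<lambda>p. k) q = 0"
  using vector_fieldsD(5)[of X "\<lambda>p. 1" "\<lambda>p. 1" q] vector_fieldsD(4)[of X "\<lambda>p. 1" k q] by simp

lemma vector_field_sum:
  assumes "X \<in> vector_fields A" "\<And>i. i \<in> I \<Longrightarrow> g i \<in> smooth_functions A"
  shows "X (\<lambda>p. \<Sum>i\<in>I. g i p) q = (\<Sum>i\<in>I. X (g i) q)"
  using assms(2)
proof (induction I rule: infinite_finite_induct)
  case (insert i I)
  then have "X (\<lambda>p. g i p + (\<Sum>i\<in>I. g i p)) q = X (g i) q + X (\<lambda>p. \<Sum>i\<in>I. g i p) q"
    by (intro vector_fieldsD(3)[OF assms(1)]) auto
  with insert show ?case by simp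
qed (simp_all add: vector_field_const[OF assms(1)])

lemma velocity_in_chart:
  assumes \<gamma>: "smooth_curve_on A I \<gamma>" and I: "open I" and U: "(U, \<phi>) \<in> A"
    and t: "t \<in> I" "\<gamma> t \<in> U" and h: "h \<in> smooth_functions A"
  shows "((h \<circ> \<gamma>) has_vector_derivative
      frechet_derivative (\<lambda>x. h (inv_into U \<phi> x)) (at (\<phi> (\<gamma> t))) (vector_derivative (\<phi> \<circ> \<gamma>) (at t))) (at t)"
    and "velocity I \<gamma> t h =
      frechet_derivative (\<lambda>x. h (inv_into U \<phi> x)) (at (\<phi> (\<gamma> t))) (vector_derivative (\<phi> \<circ> \<gamma>) (at t))"
proof -
  let ?T = "{s \<in> I. \<gamma> s \<in> U}"
  have T: "open ?T"
    using \<gamma> continuous_open_preimage[OF _ I chart_open[OF U]] unfolding smooth_curve_on_def Int_def vimage_def by simp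
  have x: "((\<phi> \<circ> \<gamma>) has_vector_derivative vector_derivative (\<phi> \<circ> \<gamma>) (at t)) (at t)"
    by (rule smooth_on_vector_derivative(2)[OF _ T]) (use \<gamma> t U in \<open>auto simp: smooth_curve_on_def\<close>)
  have d: "((\<lambda>x. h (inv_into U \<phi> x)) has_derivative
      frechet_derivative (\<lambda>x. h (inv_into U \<phi> x)) (at (\<phi> (\<gamma> t)))) (at (\<phi> (\<gamma> t)))"
    by (rule smooth_on_has_derivative[OF smooth_in_chart[OF h U] chart_image_open[OF U]]) (use t in auto)
  have d': "((\<lambda>x. h (inv_into U \<phi> x)) has_derivative
      frechet_derivative (\<lambda>x. h (inv_into U \<phi> x)) (at (\<phi> (\<gamma> t)))) (at ((\<phi> \<circ> \<gamma>) t))"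
    using d by simp
  have "((\<lambda>s. h (inv_into U \<phi> ((\<phi> \<circ> \<gamma>) s))) has_vector_derivative
      frechet_derivative (\<lambda>x. h (inv_into U \<phi> x)) (at (\<phi> (\<gamma> t))) (vector_derivative (\<phi> \<circ> \<gamma>) (at t))) (at t)"
    using has_derivative_compose[OF x[unfolded has_vector_derivative_def] d']
    unfolding has_vector_derivative_def
    by (simp only: linear_scale[OF has_derivative_linear[OF d]])
  then show v: "((h \<circ> \<gamma>) has_vector_derivative
      frechet_derivative (\<lambda>x. h (inv_into U \<phi> x)) (at (\<phi> (\<gamma> t))) (vector_derivative (\<phi> \<circ> \<gamma>) (at t))) (at t)"
    by (rule has_vector_derivative_transform_within_open[OF _ T]) (use t U in auto)
  show "velocity I \<gamma> t h =
      frechet_derivative (\<lambda>x. h (inv_into U \<phi> x)) (at (\<phi> (\<gamma> t))) (vector_derivative (\<phi> \<circ> \<gamma>) (at t))"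
    using vector_derivative_at[OF v] at_within_open[OF t(1) I] by (simp add: velocity_def)
qed

end

text \<open>Three concentric radii. Within \<open>r\<close> the cut-off \<beta> is 1, so the global
  coordinate functions and fields built with it are the true ones there. The support of \<beta> lies
  within \<open>2 * r\<close>, a compact part of the chart. The ball of radius \<open>3 * r\<close>
  is a convex domain larger than this support, on which Hadamard's lemma can be applied.\<close>

locale chart_ball = smooth_manifold A
  for A :: "('m::t2_space, 'e::euclidean_space) chart set" +
  fixes U :: "'m set" and \<phi> :: "'m \<Rightarrow> 'e" and c :: 'e and r :: real and \<beta> :: "'e \<Rightarrow> real"
  assumes U: "(U, \<phi>) \<in> A" and r: "r > 0" and ball_subset: "cball c (3 * r) \<subseteq> \<phi> ` U"
    and \<beta>_smooth: "smooth_on UNIV \<beta>"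
    and \<beta>_1: "\<And>x. x \<in> cball c r \<Longrightarrow> \<beta> x = 1"
    and \<beta>_0: "\<And>x. x \<notin> ball c (2 * r) \<Longrightarrow> \<beta> x = 0"
begin

abbreviation \<pi> :: "'e \<Rightarrow> 'm" where "\<pi> \<equiv> inv_into U \<phi>"

definition coordinate :: "'e \<Rightarrow> 'm \<Rightarrow> real" where
  "coordinate b = extend_by_zero U \<phi> (\<lambda>x. \<beta> x * (x \<bullet> b))"

definition coordinate_field :: "'e \<Rightarrow> ('m \<Rightarrow> real) \<Rightarrow> 'm \<Rightarrow> real" where
  "coordinate_field v = (\<lambda>h\<in>smooth_functions A.
     extend_by_zero U \<phi> (\<lambda>x. \<beta> x * frechet_derivative (\<lambda>y. h (\<pi> y)) (at x) v))"

text \<open>These are the coordinates of \<open>X\<close> only over \<open>ball c r\<close>, where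
  \<open>coordinate b\<close> is the actual coordinate; elsewhere the value is just some smooth
  function.\<close>

definition components :: "(('m \<Rightarrow> real) \<Rightarrow> 'm \<Rightarrow> real) \<Rightarrow> 'e \<Rightarrow> 'e" where
  "components X x = (\<Sum>b\<in>Basis. X (coordinate b) (\<pi> x) *\<^sub>R b)"

lemma openU: "open (\<phi> ` U)"
  by (rule chart_image_open[OF U])

lemma ball_in_chart: "x \<in> ball c (3 * r) \<Longrightarrow> x \<in> \<phi> ` U"
  using ball_subset by auto

lemma core_ball_in_chart: "x \<in> ball c r \<Longrightarrow> x \<in> \<phi> ` U"
  using ball_in_chart r by auto

lemma core_chart [simp]: "x \<in> ball c r \<Longrightarrow> \<pi> x \<in> U" "x \<in> ball c r \<Longrightarrow> \<phi> (\<pi> x) = x"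
  by (rule chart_inv_in[OF core_ball_in_chart], assumption, rule chart_right_inverse[OF U core_ball_in_chart])

lemma \<beta>_smooth_on: "open S \<Longrightarrow> smooth_on S \<beta>"
  using smooth_on_subset[OF \<beta>_smooth] by simp

lemma extend_cutoff_smooth:
  assumes "smooth_on (\<phi> ` U) g" "\<And>x. x \<notin> ball c (2 * r) \<Longrightarrow> g x = 0"
  shows "extend_by_zero U \<phi> g \<in> smooth_functions A"
  by (rule extend_by_zero_smooth[OF U assms(1), of "cball c (2 * r)"])
    (use assms(2) ball_subset r in auto)

lemma extend_cutoff_mult_smooth:
  assumes "smooth_on (\<phi> ` U) g"
  shows "extend_by_zero U \<phi> (\<lambda>x. \<beta> x * g x) \<in> smooth_functions A"
  by (rule extend_cutoff_smooth) (simp_all add: smooth_on_mult openU \<beta>_smooth_on assms \<beta>_0)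

text \<open>Made for the coefficients from Hadamard's lemma, which are controlled only on the ball
  of radius \<open>3 * r\<close>. Away from \<open>cball c (2 * r)\<close> the product is zero
  whatever \<open>g\<close> is.\<close>

lemma extend_cutoff_mult_ball_smooth:
  assumes "smooth_on (ball c (3 * r)) g"
  shows "extend_by_zero U \<phi> (\<lambda>x. \<beta> x * g x) \<in> smooth_functions A"
proof (rule extend_cutoff_smooth)
  show "smooth_on (\<phi> ` U) (\<lambda>x. \<beta> x * g x)"
  proof (rule smooth_on_local[OF openU])
    fix x assume x: "x \<in> \<phi> ` U"
    show "\<exists>N. open N \<and> x \<in> N \<and> N \<subseteq> \<phi> ` U \<and> smooth_on N (\<lambda>x. \<beta> x * g x)"
    proof (cases "x \<in> ball c (3 * r)")
      case True
      then show ?thesis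
        using ball_in_chart by (intro exI[of _ "ball c (3 * r)"]) (auto intro!: smooth_on_mult \<beta>_smooth_on assms)
    next
      case False
      let ?N = "\<phi> ` U - cball c (2 * r)"
      have N: "open ?N" using openU by auto
      have "smooth_on ?N (\<lambda>x. 0 :: real) \<longleftrightarrow> smooth_on ?N (\<lambda>x. \<beta> x * g x)"
        by (rule smooth_on_cong) (use \<beta>_0 in auto)
      then show ?thesis
        using N x False r smooth_on_const[OF N] by (intro exI[of _ ?N]) auto
    qed
  qed
qed (simp add: \<beta>_0)

lemma coordinate_smooth: "coordinate b \<in> smooth_functions A"
  unfolding coordinate_def
  by (rule extend_cutoff_mult_smooth, rule smooth_on_linear_compose[OF openU bounded_linear_inner_left smooth_on_id[OF openU]])

lemma coordinate_eq: "x \<in> ball c r \<Longrightarrow> coordinate b (\<pi> x) = x \<bullet> b"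
  by (simp add: coordinate_def extend_by_zero_def \<beta>_1)

lemma smooth_pullback_differentiable:
  "h \<in> smooth_functions A \<Longrightarrow> x \<in> \<phi> ` U \<Longrightarrow> (\<lambda>y. h (\<pi> y)) differentiable (at x)"
  by (rule smooth_on_differentiable[OF smooth_in_chart[OF _ U] openU])

lemma pullback_linear:
  "h \<in> smooth_functions A \<Longrightarrow> x \<in> \<phi> ` U \<Longrightarrow> linear (frechet_derivative (\<lambda>y. h (\<pi> y)) (at x))"
  by (rule linear_frechet_derivative[OF smooth_pullback_differentiable])

lemma frechet_derivative_coordinate:
  assumes "x \<in> ball c r"
  shows "frechet_derivative (\<lambda>y. coordinate b (\<pi> y)) (at x) v = v \<bullet> b"
proof -
  have "frechet_derivative (\<lambda>y. coordinate b (\<pi> y)) (at x) = frechet_derivative (\<lambda>y. y \<bullet> b) (at x)"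
    by (rule frechet_derivative_cong_open[OF open_ball assms coordinate_eq])
  also have "\<dots> = (\<lambda>v. v \<bullet> b)"
    by (rule frechet_derivative_at[symmetric]) (auto intro!: derivative_eq_intros)
  finally show ?thesis by simp
qed

lemma coordinate_field_apply:
  "h \<in> smooth_functions A \<Longrightarrow> coordinate_field v h =
     extend_by_zero U \<phi> (\<lambda>x. \<beta> x * frechet_derivative (\<lambda>y. h (\<pi> y)) (at x) v)"
  by (simp add: coordinate_field_def)

lemma coordinate_field_core:
  "h \<in> smooth_functions A \<Longrightarrow> x \<in> ball c r \<Longrightarrow>
    coordinate_field v h (\<pi> x) = frechet_derivative (\<lambda>y. h (\<pi> y)) (at x) v"
  by (simp add: coordinate_field_apply extend_by_zero_def \<beta>_1)

lemma coordinate_field_vector_field: "coordinate_field v \<in> vector_fields A"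
proof -
  have d: "((\<lambda>y. h (\<pi> y)) has_derivative frechet_derivative (\<lambda>y. h (\<pi> y)) (at x)) (at x)"
    if "h \<in> smooth_functions A" "x \<in> \<phi> ` U" for h x
    using smooth_pullback_differentiable[OF that] by (simp add: frechet_derivative_works)
  have 1: "coordinate_field v h \<in> smooth_functions A" if "h \<in> smooth_functions A" for h
    unfolding coordinate_field_apply[OF that]
    by (rule extend_cutoff_mult_smooth, rule smooth_on_frechet_derivative[OF smooth_in_chart[OF that U] openU])
  have 2: "coordinate_field v (\<lambda>p. g p + h p) = (\<lambda>p. coordinate_field v g p + coordinate_field v h p)"
    if g: "g \<in> smooth_functions A" and h: "h \<in> smooth_functions A" for g h
  proof
    fix p
    have "frechet_derivative (\<lambda>y. g (\<pi> y) + h (\<pi> y)) (at x) v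
        = frechet_derivative (\<lambda>y. g (\<pi> y)) (at x) v + frechet_derivative (\<lambda>y. h (\<pi> y)) (at x) v" if "x \<in> \<phi> ` U" for x
      by (rule fun_cong[OF frechet_derivative_at[OF has_derivative_add[OF d[OF g that] d[OF h that]]], symmetric])
    then show "coordinate_field v (\<lambda>p. g p + h p) p = coordinate_field v g p + coordinate_field v h p"
      using smooth_functions_add[OF g h] g h
      by (simp add: coordinate_field_apply extend_by_zero_def algebra_simps)
  qed
  have 3: "coordinate_field v (\<lambda>p. k * h p) = (\<lambda>p. k * coordinate_field v h p)"
    if h: "h \<in> smooth_functions A" for k h
  proof
    fix p
    have "frechet_derivative (\<lambda>y. k * h (\<pi> y)) (at x) v
        = k * frechet_derivative (\<lambda>y. h (\<pi> y)) (at x) v" if "x \<in> \<phi> ` U" for x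
      by (rule fun_cong[OF frechet_derivative_at[OF has_derivative_mult_right[OF d[OF h that], of k]], symmetric])
    then show "coordinate_field v (\<lambda>p. k * h p) p = k * coordinate_field v h p"
      using smooth_functions_mult[OF smooth_functions_const h, of k] h
      by (simp add: coordinate_field_apply extend_by_zero_def algebra_simps)
  qed
  have 4: "coordinate_field v (\<lambda>p. g p * h p) = (\<lambda>p. g p * coordinate_field v h p + h p * coordinate_field v g p)"
    if g: "g \<in> smooth_functions A" and h: "h \<in> smooth_functions A" for g h
  proof
    fix p
    have "frechet_derivative (\<lambda>y. g (\<pi> y) * h (\<pi> y)) (at x) v
        = g (\<pi> x) * frechet_derivative (\<lambda>y. h (\<pi> y)) (at x) v + frechet_derivative (\<lambda>y. g (\<pi> y)) (at x) v * h (\<pi> x)"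
      if "x \<in> \<phi> ` U" for x
      by (rule fun_cong[OF frechet_derivative_at[OF has_derivative_mult[OF d[OF g that] d[OF h that]]], symmetric])
    then show "coordinate_field v (\<lambda>p. g p * h p) p = g p * coordinate_field v h p + h p * coordinate_field v g p"
      using smooth_functions_mult[OF g h] g h U
      by (simp add: coordinate_field_apply extend_by_zero_def algebra_simps)
  qed
  show ?thesis
    unfolding vector_fields_def using 1 2 3 4 by (auto simp: coordinate_field_def)
qed

text \<open>Hadamard's lemma writes the cut-off of \<open>h\<close> near \<open>p\<close> as \<open>h p\<close> plus products of functions
  vanishing at \<open>p\<close>, so that the Leibniz rule determines \<open>X h p\<close>.\<close>
lemma vector_field_in_chart:
  assumes X: "X \<in> vector_fields A" and h: "h \<in> smooth_functions A" and x: "x \<in> ball c r"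
  shows "X h (\<pi> x) = frechet_derivative (\<lambda>y. h (\<pi> y)) (at x) (components X x)"
proof -
  let ?B = "ball c (3 * r)"
  let ?p = "\<pi> x"
  let ?\<theta> = "extend_by_zero U \<phi> (\<lambda>y. \<beta> y * 1)"
  have xB: "x \<in> ?B" using x r by auto
  have \<theta>: "?\<theta> \<in> smooth_functions A"
    by (rule extend_cutoff_mult_smooth[OF smooth_on_const[OF openU]])
  have \<theta>p: "?\<theta> ?p = 1" using x by (simp add: extend_by_zero_def \<beta>_1)
  \<comment> \<open>In the chart this is \<beta> times the \<open>b\<close>-th coordinate centred at
    \<open>x\<close>: a globally smooth function that vanishes at \<open>?p\<close>.\<close>
  define \<eta> where "\<eta> b p = coordinate b p + - (x \<bullet> b) * ?\<theta> p" for b p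
  have \<eta>_def': "\<eta> b = (\<lambda>p. coordinate b p + - (x \<bullet> b) * ?\<theta> p)" for b by (rule ext) (rule \<eta>_def)
  have s\<theta>: "(\<lambda>p. - (x \<bullet> b) * ?\<theta> p) \<in> smooth_functions A" for b
    using smooth_functions_mult[OF smooth_functions_const \<theta>] .
  have \<eta>: "\<eta> b \<in> smooth_functions A" for b
    unfolding \<eta>_def' by (rule smooth_functions_add[OF coordinate_smooth s\<theta>])
  have \<eta>p: "\<eta> b ?p = 0" for b
    using coordinate_eq[OF x] \<theta>p by (simp add: \<eta>_def)
  have key: "X g ?p = (\<Sum>b\<in>Basis. frechet_derivative (\<lambda>y. g (\<pi> y)) (at x) b * X (\<eta> b) ?p)"
    if g: "g \<in> smooth_functions A" for g
  proof -
    have gs: "smooth_on ?B (\<lambda>y. g (\<pi> y))"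
      by (rule smooth_on_subset[OF smooth_in_chart[OF g U] openU open_ball]) (use ball_in_chart in auto)
    obtain G where G: "\<And>b. smooth_on ?B (G b)" "\<And>b. G b x = frechet_derivative (\<lambda>y. g (\<pi> y)) (at x) b"
      "\<And>y. y \<in> ?B \<Longrightarrow> g (\<pi> y) = g (\<pi> x) + (\<Sum>b\<in>Basis. ((y - x) \<bullet> b) * G b y)"
      by (rule hadamard[OF open_ball convex_ball xB gs], rule that)
    define H where "H b = extend_by_zero U \<phi> (\<lambda>y. \<beta> y * G b y)" for b
    have H: "H b \<in> smooth_functions A" for b
      unfolding H_def by (rule extend_cutoff_mult_ball_smooth[OF G(1)])
    have \<theta>2: "(\<lambda>q. ?\<theta> q * ?\<theta> q) \<in> smooth_functions A" using \<theta> by auto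
    \<comment> \<open>The cut-off is squared because \<eta> and \<open>H\<close> each carry one
      factor of it. Applying \<open>X\<close> at \<open>?p\<close> to both sides, the terms with the
      derivative of the squared cut-off cancel, and only the derivatives of \<eta> remain on the
      right since \<eta> vanishes at \<open>?p\<close>.\<close>
    have eq: "(\<lambda>q. g q * (?\<theta> q * ?\<theta> q)) = (\<lambda>q. g ?p * (?\<theta> q * ?\<theta> q) + (\<Sum>b\<in>Basis. \<eta> b q * H b q))"
    proof
      fix q
      show "g q * (?\<theta> q * ?\<theta> q) = g ?p * (?\<theta> q * ?\<theta> q) + (\<Sum>b\<in>Basis. \<eta> b q * H b q)"
      proof (cases "q \<in> U \<and> \<phi> q \<in> ?B")
        case True
        then have "g q = g ?p + (\<Sum>b\<in>Basis. ((\<phi> q - x) \<bullet> b) * G b (\<phi> q))"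
          using G(3)[of "\<phi> q"] U by simp
        moreover have "\<eta> b q * H b q = (\<beta> (\<phi> q) * \<beta> (\<phi> q)) * (((\<phi> q - x) \<bullet> b) * G b (\<phi> q))" for b
          using True by (simp add: \<eta>_def H_def coordinate_def extend_by_zero_def algebra_simps)
        then have "(\<Sum>b\<in>Basis. \<eta> b q * H b q) = (\<beta> (\<phi> q) * \<beta> (\<phi> q)) * (\<Sum>b\<in>Basis. ((\<phi> q - x) \<bullet> b) * G b (\<phi> q))"
          by (simp only: sum_distrib_left)
        moreover have "?\<theta> q = \<beta> (\<phi> q)" using True by (simp add: extend_by_zero_def)
        ultimately show ?thesis by algebra
      next
        case False
        then have "\<phi> q \<notin> ball c (2 * r)" if "q \<in> U" using that r by auto
        then have "?\<theta> q = 0" "\<And>b. H b q = 0"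
          by (auto simp: extend_by_zero_def H_def \<beta>_0)
        then show ?thesis by simp
      qed
    qed
    have "X (\<lambda>q. g q * (?\<theta> q * ?\<theta> q)) ?p = g ?p * X (\<lambda>q. ?\<theta> q * ?\<theta> q) ?p + X g ?p"
      using vector_fieldsD(5)[OF X g \<theta>2, of ?p] \<theta>p by simp
    moreover have "X (\<lambda>q. g ?p * (?\<theta> q * ?\<theta> q) + (\<Sum>b\<in>Basis. \<eta> b q * H b q)) ?p
        = g ?p * X (\<lambda>q. ?\<theta> q * ?\<theta> q) ?p + (\<Sum>b\<in>Basis. X (\<lambda>q. \<eta> b q * H b q) ?p)"
    proof -
      have "(\<lambda>q. g ?p * (?\<theta> q * ?\<theta> q)) \<in> smooth_functions A"
        by (rule smooth_functions_mult[OF smooth_functions_const \<theta>2])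
      moreover have \<eta>H: "(\<lambda>q. \<eta> b q * H b q) \<in> smooth_functions A" for b
        by (rule smooth_functions_mult[OF \<eta> H])
      moreover have "(\<lambda>q. \<Sum>b\<in>Basis. \<eta> b q * H b q) \<in> smooth_functions A"
        by (rule smooth_functions_sum[OF \<eta>H])
      ultimately show ?thesis
        using vector_fieldsD(3)[OF X, of "\<lambda>q. g ?p * (?\<theta> q * ?\<theta> q)" "\<lambda>q. \<Sum>b\<in>Basis. \<eta> b q * H b q" ?p]
          vector_fieldsD(4)[OF X \<theta>2, of "g ?p" ?p] vector_field_sum[OF X, of Basis "\<lambda>b q. \<eta> b q * H b q" ?p]
        by (simp only: \<eta>H)
    qed
    moreover have "X (\<lambda>q. \<eta> b q * H b q) ?p = frechet_derivative (\<lambda>y. g (\<pi> y)) (at x) b * X (\<eta> b) ?p" for b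
    proof -
      have "H b ?p = G b x" using x by (simp add: H_def extend_by_zero_def \<beta>_1)
      then show ?thesis
        using vector_fieldsD(5)[OF X \<eta>[of b] H[of b], of ?p] \<eta>p[of b] G(2)[of b] by simp
    qed
    ultimately show ?thesis using eq by simp
  qed
  \<comment> \<open>The cut-off is constant near the point, so \<open>key\<close> applied to the
    cut-off itself shows that \<open>X\<close> annihilates it there. Hence \<open>X\<close> does not
    distinguish \<eta> from the coordinate function.\<close>
  have "frechet_derivative (\<lambda>y. ?\<theta> (\<pi> y)) (at x) = frechet_derivative (\<lambda>y. 1) (at x)"
    by (rule frechet_derivative_cong_open[OF open_ball x]) (simp add: extend_by_zero_def \<beta>_1)
  also have "\<dots> = (\<lambda>v. 0)"
    by (rule frechet_derivative_const)
  finally have "X ?\<theta> ?p = 0"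
    by (simp only: key[OF \<theta>] mult_zero_left sum.neutral_const)
  note X\<theta> = this
  have "X (\<eta> b) ?p = X (coordinate b) ?p" for b
  proof -
    have "X (\<eta> b) ?p = X (coordinate b) ?p + X (\<lambda>p. - (x \<bullet> b) * ?\<theta> p) ?p"
      unfolding \<eta>_def' by (rule vector_fieldsD(3)[OF X coordinate_smooth s\<theta>])
    also have "X (\<lambda>p. - (x \<bullet> b) * ?\<theta> p) ?p = - (x \<bullet> b) * X ?\<theta> ?p"
      by (rule vector_fieldsD(4)[OF X \<theta>])
    finally show ?thesis by (simp only: X\<theta> mult_zero_right add_0_right)
  qed
  then have "X h ?p = (\<Sum>b\<in>Basis. frechet_derivative (\<lambda>y. h (\<pi> y)) (at x) b * X (coordinate b) ?p)"
    by (simp only: key[OF h])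
  also have "\<dots> = frechet_derivative (\<lambda>y. h (\<pi> y)) (at x) (components X x)"
    unfolding components_def
    by (simp add: linear_sum[OF pullback_linear[OF h core_ball_in_chart[OF x]]] linear_scale[OF pullback_linear[OF h core_ball_in_chart[OF x]]] mult_ac)
  finally show ?thesis .
qed

lemma components_inner: "b \<in> Basis \<Longrightarrow> components X x \<bullet> b = X (coordinate b) (\<pi> x)"
  unfolding components_def by (rule inner_sum_left_Basis)

lemma components_coordinate_field:
  assumes "x \<in> ball c r"
  shows "components (coordinate_field v) x = v"
proof (rule euclidean_eqI)
  fix b :: 'e assume "b \<in> Basis"
  then show "components (coordinate_field v) x \<bullet> b = v \<bullet> b"
    by (simp only: components_inner coordinate_field_core[OF coordinate_smooth assms] frechet_derivative_coordinate[OF assms])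
qed

lemma components_smooth:
  assumes "X \<in> vector_fields A"
  shows "smooth_on (\<phi> ` U) (components X)"
proof -
  have "smooth_on (\<phi> ` U) (\<lambda>x. X (coordinate b) (\<pi> x) *\<^sub>R b)" for b
    by (rule smooth_on_scaleR[OF openU smooth_in_chart[OF vector_fieldsD(1)[OF assms coordinate_smooth] U]
          smooth_on_const[OF openU]])
  then have "smooth_on (\<phi> ` U) (\<lambda>x. \<Sum>b\<in>Basis. X (coordinate b) (\<pi> x) *\<^sub>R b)"
    by (rule smooth_on_sum[OF openU])
  moreover have "components X = (\<lambda>x. \<Sum>b\<in>Basis. X (coordinate b) (\<pi> x) *\<^sub>R b)"
    by (rule ext) (rule components_def)
  ultimately show ?thesis by (simp only:)
qed

end

subsection \<open>Connections and the geodesic equation in a chart\<close>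

definition vf_sum ::
    "('m, 'e::euclidean_space) chart set \<Rightarrow> 'i set \<Rightarrow> ('i \<Rightarrow> ('m \<Rightarrow> real) \<Rightarrow> 'm \<Rightarrow> real) \<Rightarrow>
     ('m \<Rightarrow> real) \<Rightarrow> 'm \<Rightarrow> real" where
  "vf_sum A I F = (\<lambda>h\<in>smooth_functions A. \<lambda>p. \<Sum>i\<in>I. F i h p)"

context smooth_manifold
begin

lemma vf_add_vector_field:
  assumes X: "X \<in> vector_fields A" and Y: "Y \<in> vector_fields A"
  shows "vf_add A X Y \<in> vector_fields A"
proof -
  note x = vector_fieldsD[OF X] and y = vector_fieldsD[OF Y]
  have "(\<lambda>p. X h p + Y h p) \<in> smooth_functions A" if "h \<in> smooth_functions A" for h
    by (rule smooth_functions_add[OF x(1)[OF that] y(1)[OF that]])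
  moreover have "(\<lambda>p. k * h p) \<in> smooth_functions A" if "h \<in> smooth_functions A" for h k
    by (rule smooth_functions_mult[OF smooth_functions_const that])
  ultimately show ?thesis
    unfolding vector_fields_def vf_add_def
    by (auto simp: smooth_functions_add smooth_functions_mult x(3-5) y(3-5) algebra_simps)
qed

lemma vf_scale_vector_field:
  assumes g: "g \<in> smooth_functions A" and X: "X \<in> vector_fields A"
  shows "vf_scale A g X \<in> vector_fields A"
proof -
  note x = vector_fieldsD[OF X]
  have "(\<lambda>p. g p * X h p) \<in> smooth_functions A" if "h \<in> smooth_functions A" for h
    by (rule smooth_functions_mult[OF g x(1)[OF that]])
  moreover have "(\<lambda>p. k * h p) \<in> smooth_functions A" if "h \<in> smooth_functions A" for h k
    by (rule smooth_functions_mult[OF smooth_functions_const that])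
  ultimately show ?thesis
    unfolding vector_fields_def vf_scale_def
    by (auto simp: smooth_functions_add smooth_functions_mult x(3-5) algebra_simps)
qed

text \<open>Writing the zero field as a multiple of a field lets the scaling rules of the connection
  settle the empty case of sums.\<close>

lemma vf_sum_empty: "vf_sum A {} F = vf_scale A (\<lambda>p. 0) X"
  by (simp add: vf_sum_def vf_scale_def)

lemma vf_sum_insert:
  "finite I \<Longrightarrow> i \<notin> I \<Longrightarrow> vf_sum A (insert i I) F = vf_add A (F i) (vf_sum A I F)"
  by (auto simp: vf_sum_def vf_add_def fun_eq_iff)

lemma vf_sum_vector_field:
  assumes "X \<in> vector_fields A" "finite I" "\<And>i. i \<in> I \<Longrightarrow> F i \<in> vector_fields A"
  shows "vf_sum A I F \<in> vector_fields A"
  using assms(2,3)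
proof (induction I rule: finite_induct)
  case empty
  show ?case
    unfolding vf_sum_empty[of F X] by (rule vf_scale_vector_field[OF smooth_functions_const assms(1)])
next
  case (insert i I)
  then show ?case
    unfolding vf_sum_insert[OF insert(1,2)] by (simp add: vf_add_vector_field)
qed

end

locale manifold_connection = smooth_manifold A
  for A :: "('m::t2_space, 'e::euclidean_space) chart set" +
  fixes D :: "'m connection"
  assumes connection: "affine_connection A D"
begin

lemma D_vector_field: "X \<in> vector_fields A \<Longrightarrow> Y \<in> vector_fields A \<Longrightarrow> D X Y \<in> vector_fields A"
  using connection by (simp add: affine_connection_def)

lemma D_add:
  assumes "X \<in> vector_fields A" "Y \<in> vector_fields A" "Z \<in> vector_fields A" "h \<in> smooth_functions A"
  shows "D (vf_add A X Y) Z h p = D X Z h p + D Y Z h p"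
    and "D X (vf_add A Y Z) h p = D X Y h p + D X Z h p"
  using assms connection by (simp_all add: affine_connection_def vf_add_def[of A "D _ _" "D _ _"])

lemma D_scale:
  assumes "X \<in> vector_fields A" "Y \<in> vector_fields A" "g \<in> smooth_functions A" "h \<in> smooth_functions A"
  shows "D (vf_scale A g X) Y h p = g p * D X Y h p"
    and "D X (vf_scale A g Y) h p = X g p * Y h p + g p * D X Y h p"
proof -
  have "D (vf_scale A g X) Y = vf_scale A g (D X Y)"
    "D X (vf_scale A g Y) = vf_add A (vf_scale A (X g) Y) (vf_scale A g (D X Y))"
    using assms connection by (simp_all add: affine_connection_def)
  then show "D (vf_scale A g X) Y h p = g p * D X Y h p"
    "D X (vf_scale A g Y) h p = X g p * Y h p + g p * D X Y h p"
    using assms(4) by (simp_all add: vf_add_def vf_scale_def)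
qed

lemma D_sum_right:
  assumes "X \<in> vector_fields A" "h \<in> smooth_functions A" "finite I" "\<And>i. i \<in> I \<Longrightarrow> F i \<in> vector_fields A"
  shows "D X (vf_sum A I F) h p = (\<Sum>i\<in>I. D X (F i) h p)"
  using assms(3,4)
proof (induction I rule: finite_induct)
  case empty
  show ?case
    unfolding vf_sum_empty[of F X] D_scale(2)[OF assms(1,1) smooth_functions_const assms(2)]
    by (simp add: vector_field_const[OF assms(1)])
next
  case (insert i I)
  have "D X (vf_sum A (insert i I) F) h p = D X (F i) h p + D X (vf_sum A I F) h p"
    unfolding vf_sum_insert[OF insert(1,2)]
    by (rule D_add(2)[OF assms(1) _ _ assms(2)]) (use insert vf_sum_vector_field[OF assms(1)] in auto)
  then show ?case using insert by simp
qed

lemma D_sum_left: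
  assumes "X \<in> vector_fields A" "h \<in> smooth_functions A" "finite I" "\<And>i. i \<in> I \<Longrightarrow> F i \<in> vector_fields A"
  shows "D (vf_sum A I F) X h p = (\<Sum>i\<in>I. D (F i) X h p)"
  using assms(3,4)
proof (induction I rule: finite_induct)
  case empty
  show ?case
    unfolding vf_sum_empty[of F X] D_scale(1)[OF assms(1,1) smooth_functions_const assms(2)]
    by simp
next
  case (insert i I)
  have "D (vf_sum A (insert i I) F) X h p = D (F i) X h p + D (vf_sum A I F) X h p"
    unfolding vf_sum_insert[OF insert(1,2)]
    by (rule D_add(1)[OF _ _ assms(1) assms(2)]) (use insert vf_sum_vector_field[OF assms(1)] in auto)
  then show ?case using insert by simp
qed

end

locale chart_ball_connection = chart_ball A U \<phi> c r \<beta> + manifold_connection A D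
  for A :: "('m::t2_space, 'e::euclidean_space) chart set" and U \<phi> c r \<beta> D
begin

definition christoffel :: "'e \<Rightarrow> 'e \<Rightarrow> 'e \<Rightarrow> 'e" where
  "christoffel x u v = (\<Sum>i\<in>Basis. \<Sum>j\<in>Basis.
     ((u \<bullet> i) * (v \<bullet> j)) *\<^sub>R components (D (coordinate_field i) (coordinate_field j)) x)"

text \<open>A connection acts only on global fields, so locality has to be extracted from the
  Leibniz rule. As \<theta> is 1 and annihilated by every field at the point, replacing
  \<open>Y\<close> by \<theta> times \<open>Y\<close> does not change its covariant derivatives
  there, and the product is globally a combination of coordinate fields.\<close>

lemma field_localization:
  assumes Y: "Y \<in> vector_fields A" and x: "x \<in> ball c r"
  obtains \<theta> a where "\<theta> \<in> smooth_functions A" "\<And>j. a j \<in> smooth_functions A"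
    "\<theta> (\<pi> x) = 1" "\<And>X. X \<in> vector_fields A \<Longrightarrow> X \<theta> (\<pi> x) = 0"
    "vf_scale A \<theta> Y = vf_sum A Basis (\<lambda>j. vf_scale A (a j) (coordinate_field j))"
    "\<And>j. a j (\<pi> x) = components Y x \<bullet> j"
    "\<And>X j. X \<in> vector_fields A \<Longrightarrow>
       X (a j) (\<pi> x) = frechet_derivative (components Y) (at x) (components X x) \<bullet> j"
proof -
  \<comment> \<open>The support of the new bump must lie in \<open>ball c r\<close>, the region
    where the coordinate fields are a true frame.\<close>
  obtain s where s: "s > 0" "cball x s \<subseteq> ball c r"
    by (meson open_ball open_contains_cball x)
  obtain \<theta>0 :: "'e \<Rightarrow> real" where \<theta>0: "smooth_on UNIV \<theta>0" "\<And>y. y \<in> cball x (s / 2) \<Longrightarrow> \<theta>0 y = 1"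
      "\<And>y. y \<notin> ball x (2 * (s / 2)) \<Longrightarrow> \<theta>0 y = 0"
    by (rule bump_exists[of "s / 2" x]) (use s in \<open>auto\<close>)
  have off: "\<theta>0 y = 0" if "y \<notin> ball c r" for y
  proof -
    have "y \<notin> cball x s" using that s(2) by blast
    then show ?thesis using \<theta>0(3)[of y] by simp
  qed
  define \<theta> where "\<theta> = extend_by_zero U \<phi> \<theta>0"
  define a where "a j = extend_by_zero U \<phi> (\<lambda>y. \<theta>0 y * (components Y y \<bullet> j))" for j
  have K: "cball x s \<subseteq> \<phi> ` U" using s core_ball_in_chart by auto
  have s\<theta>0: "smooth_on (\<phi> ` U) \<theta>0" by (rule smooth_on_subset[OF \<theta>0(1) open_UNIV openU]) simp
  have \<theta>: "\<theta> \<in> smooth_functions A"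
    unfolding \<theta>_def by (rule extend_by_zero_smooth[OF U s\<theta>0 compact_cball K]) (use \<theta>0(3) in auto)
  have "smooth_on (\<phi> ` U) (\<lambda>y. \<theta>0 y * (components Y y \<bullet> j))" for j
    by (rule smooth_on_mult[OF openU s\<theta>0 smooth_on_linear_compose[OF openU bounded_linear_inner_left components_smooth[OF Y]]])
  then have a: "a j \<in> smooth_functions A" for j
    unfolding a_def by (rule extend_by_zero_smooth[OF U _ compact_cball K]) (use \<theta>0(3) in auto)
  have xs: "x \<in> ball x (s / 2)" using s by simp
  have near: "y \<in> ball c r" "\<theta>0 y = 1" if "y \<in> ball x (s / 2)" for y
    using that s \<theta>0(2)[of y] by (auto simp: subset_eq dist_commute)
  have \<theta>near: "\<theta> (\<pi> y) = 1" if "y \<in> ball x (s / 2)" for y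
    using near[OF that] by (simp add: \<theta>_def extend_by_zero_def)
  have anear: "a j (\<pi> y) = components Y y \<bullet> j" if "y \<in> ball x (s / 2)" for y j
    using near[OF that] by (simp add: a_def extend_by_zero_def)
  have X\<theta>: "X \<theta> (\<pi> x) = 0" if X: "X \<in> vector_fields A" for X
  proof -
    have "frechet_derivative (\<lambda>y. \<theta> (\<pi> y)) (at x) = frechet_derivative (\<lambda>y. 1) (at x)"
      by (rule frechet_derivative_cong_open[OF open_ball xs \<theta>near])
    then show ?thesis unfolding vector_field_in_chart[OF X \<theta> x] frechet_derivative_const by simp
  qed
  have Xa: "X (a j) (\<pi> x) = frechet_derivative (components Y) (at x) (components X x) \<bullet> j"
    if X: "X \<in> vector_fields A" for X j
  proof -
    have "(components Y has_derivative frechet_derivative (components Y) (at x)) (at x)"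
      by (rule smooth_on_has_derivative[OF components_smooth[OF Y] openU core_ball_in_chart[OF x]])
    then have "((\<lambda>y. components Y y \<bullet> j) has_derivative (\<lambda>v. frechet_derivative (components Y) (at x) v \<bullet> j)) (at x)"
      by (auto intro!: derivative_eq_intros)
    then have "frechet_derivative (\<lambda>y. components Y y \<bullet> j) (at x) = (\<lambda>v. frechet_derivative (components Y) (at x) v \<bullet> j)"
      by (rule frechet_derivative_at[symmetric])
    moreover have "frechet_derivative (\<lambda>y. a j (\<pi> y)) (at x) = frechet_derivative (\<lambda>y. components Y y \<bullet> j) (at x)"
      by (rule frechet_derivative_cong_open[OF open_ball xs anear])
    ultimately show ?thesis unfolding vector_field_in_chart[OF X a x] by simp
  qed
  have "vf_scale A \<theta> Y = vf_sum A Basis (\<lambda>j. vf_scale A (a j) (coordinate_field j))"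
  proof (rule ext)
    fix h
    show "vf_scale A \<theta> Y h = vf_sum A Basis (\<lambda>j. vf_scale A (a j) (coordinate_field j)) h"
    proof (cases "h \<in> smooth_functions A")
      case h: True
      have "\<theta> p * Y h p = (\<Sum>j\<in>Basis. a j p * coordinate_field j h p)" for p
      proof (cases "p \<in> U \<and> \<phi> p \<in> ball c r")
        case True
        define y where "y = \<phi> p"
        have y: "y \<in> ball c r" "p = \<pi> y" using True U by (auto simp: y_def)
        have d: "(\<lambda>y. h (\<pi> y)) differentiable (at y)"
          by (rule smooth_pullback_differentiable[OF h core_ball_in_chart[OF y(1)]])
        have "Y h p = (\<Sum>j\<in>Basis. (components Y y \<bullet> j) * coordinate_field j h p)"
          unfolding y(2) vector_field_in_chart[OF Y h y(1)] coordinate_field_core[OF h y(1)]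
            frechet_derivative_components[OF d, of "components Y y"] by simp
        moreover have "\<theta> p = \<theta>0 y" "\<And>j. a j p = \<theta>0 y * (components Y y \<bullet> j)"
          using y by (simp_all add: \<theta>_def a_def extend_by_zero_def)
        ultimately show ?thesis by (simp add: sum_distrib_left mult.assoc)
      next
        case False
        then have "\<theta> p = 0" "\<And>j. a j p = 0"
          using off[of "\<phi> p"] by (auto simp: \<theta>_def a_def extend_by_zero_def)
        then show ?thesis by simp
      qed
      then show ?thesis using h by (simp add: vf_scale_def vf_sum_def)
    next
      case False
      then show ?thesis by (simp add: vf_scale_def vf_sum_def)
    qed
  qed
  note decomposition = this
  show ?thesis
  proof (rule that[of \<theta> a])
    show "X \<theta> (\<pi> x) = 0" if "X \<in> vector_fields A" for X by (rule X\<theta>[OF that])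
    show "X (a j) (\<pi> x) = frechet_derivative (components Y) (at x) (components X x) \<bullet> j"
      if "X \<in> vector_fields A" for X j by (rule Xa[OF that])
  qed (rule \<theta> a \<theta>near[OF xs] decomposition anear[OF xs])+
qed

lemma D_in_chart_right:
  assumes X: "X \<in> vector_fields A" and Y: "Y \<in> vector_fields A" and h: "h \<in> smooth_functions A" and x: "x \<in> ball c r"
  shows "D X Y h (\<pi> x) = frechet_derivative (\<lambda>y. h (\<pi> y)) (at x) (frechet_derivative (components Y) (at x) (components X x))
    + (\<Sum>j\<in>Basis. (components Y x \<bullet> j) * D X (coordinate_field j) h (\<pi> x))"
proof -
  obtain \<theta> a where \<theta>: "\<theta> \<in> smooth_functions A" "\<And>j. a j \<in> smooth_functions A"
    "\<theta> (\<pi> x) = 1" "\<And>X. X \<in> vector_fields A \<Longrightarrow> X \<theta> (\<pi> x) = 0"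
    "vf_scale A \<theta> Y = vf_sum A Basis (\<lambda>j. vf_scale A (a j) (coordinate_field j))"
    "\<And>j. a j (\<pi> x) = components Y x \<bullet> j"
    "\<And>X j. X \<in> vector_fields A \<Longrightarrow>
       X (a j) (\<pi> x) = frechet_derivative (components Y) (at x) (components X x) \<bullet> j"
    by (rule field_localization[OF Y x], rule that)
  have d: "(\<lambda>y. h (\<pi> y)) differentiable (at x)"
    by (rule smooth_pullback_differentiable[OF h core_ball_in_chart[OF x]])
  have "D X Y h (\<pi> x) = D X (vf_scale A \<theta> Y) h (\<pi> x)"
    unfolding D_scale(2)[OF X Y \<theta>(1) h] \<theta>(3) \<theta>(4)[OF X] by simp
  also have "\<dots> = (\<Sum>j\<in>Basis. D X (vf_scale A (a j) (coordinate_field j)) h (\<pi> x))"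
    unfolding \<theta>(5)
    by (rule D_sum_right[OF X h finite_Basis]) (rule vf_scale_vector_field[OF \<theta>(2) coordinate_field_vector_field])
  also have "\<dots> = (\<Sum>j\<in>Basis. (frechet_derivative (components Y) (at x) (components X x) \<bullet> j) * frechet_derivative (\<lambda>y. h (\<pi> y)) (at x) j
      + (components Y x \<bullet> j) * D X (coordinate_field j) h (\<pi> x))"
    unfolding D_scale(2)[OF X coordinate_field_vector_field \<theta>(2) h] \<theta>(6) \<theta>(7)[OF X] coordinate_field_core[OF h x] ..
  finally show ?thesis
    unfolding frechet_derivative_components[OF d, of "frechet_derivative (components Y) (at x) (components X x)"]
    by (simp add: sum.distrib)
qed

text \<open>The scaling rule in the first argument has no derivative term, so \<open>X\<close>
  enters only through its value at the point.\<close>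

lemma D_in_chart_left:
  assumes X: "X \<in> vector_fields A" and Y: "Y \<in> vector_fields A" and h: "h \<in> smooth_functions A" and x: "x \<in> ball c r"
  shows "D X Y h (\<pi> x) = (\<Sum>i\<in>Basis. (components X x \<bullet> i) * D (coordinate_field i) Y h (\<pi> x))"
proof -
  obtain \<theta> a where \<theta>: "\<theta> \<in> smooth_functions A" "\<And>j. a j \<in> smooth_functions A"
    "\<theta> (\<pi> x) = 1" "\<And>X. X \<in> vector_fields A \<Longrightarrow> X \<theta> (\<pi> x) = 0"
    "vf_scale A \<theta> X = vf_sum A Basis (\<lambda>j. vf_scale A (a j) (coordinate_field j))"
    "\<And>j. a j (\<pi> x) = components X x \<bullet> j"
    "\<And>Z j. Z \<in> vector_fields A \<Longrightarrow>
       Z (a j) (\<pi> x) = frechet_derivative (components X) (at x) (components Z x) \<bullet> j"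
    by (rule field_localization[OF X x], rule that)
  have "D X Y h (\<pi> x) = D (vf_scale A \<theta> X) Y h (\<pi> x)"
    unfolding D_scale(1)[OF X Y \<theta>(1) h] \<theta>(3) by simp
  also have "\<dots> = (\<Sum>j\<in>Basis. D (vf_scale A (a j) (coordinate_field j)) Y h (\<pi> x))"
    unfolding \<theta>(5)
    by (rule D_sum_left[OF Y h finite_Basis]) (rule vf_scale_vector_field[OF \<theta>(2) coordinate_field_vector_field])
  finally show ?thesis
    unfolding D_scale(1)[OF coordinate_field_vector_field Y \<theta>(2) h] \<theta>(6) .
qed

lemma components_D:
  assumes X: "X \<in> vector_fields A" and Y: "Y \<in> vector_fields A" and x: "x \<in> ball c r"
  shows "components (D X Y) x = frechet_derivative (components Y) (at x) (components X x)
    + christoffel x (components X x) (components Y x)"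
proof (rule euclidean_eqI)
  fix b :: 'e assume b: "b \<in> Basis"
  note cf = coordinate_field_vector_field
  have "components (D X Y) x \<bullet> b = D X Y (coordinate b) (\<pi> x)"
    by (rule components_inner[OF b])
  also have "\<dots> = frechet_derivative (components Y) (at x) (components X x) \<bullet> b
    + (\<Sum>j\<in>Basis. (components Y x \<bullet> j) * (\<Sum>i\<in>Basis. (components X x \<bullet> i) * (components (D (coordinate_field i) (coordinate_field j)) x \<bullet> b)))"
    unfolding D_in_chart_right[OF X Y coordinate_smooth x] frechet_derivative_coordinate[OF x]
      D_in_chart_left[OF X cf coordinate_smooth x] components_inner[OF b] ..
  also have "(\<Sum>j\<in>Basis. (components Y x \<bullet> j) * (\<Sum>i\<in>Basis. (components X x \<bullet> i) * (components (D (coordinate_field i) (coordinate_field j)) x \<bullet> b)))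
      = christoffel x (components X x) (components Y x) \<bullet> b"
    unfolding christoffel_def inner_sum_left sum_distrib_left inner_scaleR_left
    by (subst sum.swap) (simp add: mult_ac)
  finally show "components (D X Y) x \<bullet> b = (frechet_derivative (components Y) (at x) (components X x)
    + christoffel x (components X x) (components Y x)) \<bullet> b"
    by (simp add: inner_add_left)
qed

lemma christoffel_linear: "linear (christoffel x u)"
  by (rule linearI)
    (simp_all add: christoffel_def inner_add_left scaleR_sum_right algebra_simps sum.distrib)

lemma smooth_on_christoffel:
  "smooth_on (ball c r) (\<lambda>x. components (D (coordinate_field i) (coordinate_field j)) x)"
  by (rule smooth_on_subset[OF components_smooth[OF D_vector_field[OF coordinate_field_vector_field coordinate_field_vector_field]] openU open_ball])
    (use core_ball_in_chart in auto)

text \<open>The definition of the covariant derivative along a curve only asserts that some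
  decomposition exists. For the forward direction an arbitrary one is differentiated by the product
  rule, so the choice drops out; for the converse the coordinate frame supplies one.\<close>

lemma geodesic_equation:
  assumes \<gamma>: "smooth_curve_on A I \<gamma>" and I: "open I" and t: "t \<in> I" "\<gamma> t \<in> U" "\<phi> (\<gamma> t) \<in> ball c r"
  defines "x' \<equiv> \<lambda>s. vector_derivative (\<phi> \<circ> \<gamma>) (at s)"
  shows "has_covariant_derivative_along A D I \<gamma> (velocity I \<gamma>) t (\<lambda>_. 0) \<longleftrightarrow>
    (x' has_vector_derivative - christoffel (\<phi> (\<gamma> t)) (x' t) (x' t)) (at t)"
proof -
  note cf = coordinate_field_vector_field
  define x where "x = \<phi> \<circ> \<gamma>"
  define TU where "TU = {s \<in> I. \<gamma> s \<in> U}"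
  define T0 where "T0 = {s \<in> I. \<gamma> s \<in> U \<and> x s \<in> ball c r}"
  have opre: "open {s \<in> I. \<gamma> s \<in> W}" if "open W" for W
    using \<gamma> continuous_open_preimage[OF _ I that] unfolding smooth_curve_on_def Int_def vimage_def by simp
  have TU: "open TU" unfolding TU_def by (rule opre[OF chart_open[OF U]])
  have T0: "open T0" using opre[OF chart_vimage_open[OF U open_ball]] by (simp add: T0_def x_def)
  have T0t: "t \<in> T0" "t \<in> TU" using t by (auto simp: T0_def TU_def x_def)
  have T0D: "s \<in> I" "\<gamma> s \<in> U" "x s \<in> ball c r" "s \<in> TU" "\<pi> (x s) = \<gamma> s" if "s \<in> T0" for s
    using that U by (auto simp: T0_def TU_def x_def)
  have xs: "smooth_on TU x" using \<gamma> U by (auto simp: smooth_curve_on_def TU_def x_def)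
  have x'_def: "x' s = vector_derivative x (at s)" for s by (simp add: x'_def x_def)
  have dx: "(x has_vector_derivative x' s) (at s)" if "s \<in> TU" for s
    unfolding x'_def by (rule smooth_on_vector_derivative(2)[OF xs TU that])
  have sx': "smooth_on TU x'"
    using smooth_on_vector_derivative(1)[OF xs TU] x'_def by presburger
  have dx': "(x' has_vector_derivative vector_derivative x' (at t)) (at t)"
    by (rule smooth_on_vector_derivative(2)[OF sx' TU T0t(2)])
  have vel: "velocity I \<gamma> s h = frechet_derivative (\<lambda>y. h (\<pi> y)) (at (x s)) (x' s)"
    if "s \<in> T0" "h \<in> smooth_functions A" for s h
    using velocity_in_chart(2)[OF \<gamma> I U T0D(1,2)[OF that(1)] that(2)] by (simp add: x_def x'_def)
  have velc: "velocity I \<gamma> s (coordinate b) = x' s \<bullet> b" if "s \<in> T0" for s b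
    unfolding vel[OF that coordinate_smooth] by (rule frechet_derivative_coordinate[OF T0D(3)[OF that]])
  have at_I: "at t within I = at t" by (rule at_within_open[OF t(1) I])
  have xt: "x t \<in> ball c r" "\<pi> (x t) = \<gamma> t" using T0D[OF T0t(1)] by auto
  let ?C = "christoffel (x t) (x' t)"
  interpret C: linear ?C by (rule christoffel_linear)
  have "has_covariant_derivative_along A D I \<gamma> (velocity I \<gamma>) t (\<lambda>_. 0) \<longleftrightarrow>
    (x' has_vector_derivative - ?C (x' t)) (at t)"
  proof
    assume "has_covariant_derivative_along A D I \<gamma> (velocity I \<gamma>) t (\<lambda>_. 0)"
    then obtain X T n a Y where X: "X \<in> vector_fields A"
      and Xv0: "\<forall>h\<in>smooth_functions A. X h (\<gamma> t) = velocity I \<gamma> t h"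
      and T: "openin (top_of_set I) T" "t \<in> T"
      and aY0: "\<forall>j<(n::nat). smooth_on T (a j) \<and> Y j \<in> vector_fields A"
      and V0: "\<forall>s\<in>T. \<forall>h\<in>smooth_functions A. velocity I \<gamma> s h = (\<Sum>j<n. a j s * Y j h (\<gamma> s))"
      and W0: "\<forall>h\<in>smooth_functions A.
           0 = (\<Sum>j<n. vector_derivative (a j) (at t within I) * Y j h (\<gamma> t) + a j t * D X (Y j) h (\<gamma> t))"
      unfolding has_covariant_derivative_along_def by (elim bexE exE conjE)
    note Xv = Xv0[rule_format] and V = V0[rule_format] and W = W0[rule_format]
    have aY: "\<And>j. j < n \<Longrightarrow> smooth_on T (a j)" "\<And>j. j < n \<Longrightarrow> Y j \<in> vector_fields A"
      using aY0 by blast+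
    have oT: "open T" using T I by (simp add: openin_open_eq)
    have Xx: "components X (x t) = x' t"
    proof (rule euclidean_eqI)
      fix b :: 'e assume b: "b \<in> Basis"
      show "components X (x t) \<bullet> b = x' t \<bullet> b"
        unfolding components_inner[OF b] xt(2) Xv[OF coordinate_smooth] by (rule velc[OF T0t(1)])
    qed
    have x'eq: "x' s = (\<Sum>j<n. a j s *\<^sub>R components (Y j) (x s))" if s: "s \<in> T \<inter> T0" for s
    proof (rule euclidean_eqI)
      fix b :: 'e assume b: "b \<in> Basis"
      have "x' s \<bullet> b = (\<Sum>j<n. a j s * Y j (coordinate b) (\<gamma> s))"
        using velc[of s b] V[of s "coordinate b"] s coordinate_smooth by simp
      then show "x' s \<bullet> b = (\<Sum>j<n. a j s *\<^sub>R components (Y j) (x s)) \<bullet> b"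
        using T0D(5)[of s] s by (simp add: inner_sum_left components_inner[OF b])
    qed
    let ?a' = "\<lambda>j. vector_derivative (a j) (at t)"
    let ?Y' = "\<lambda>j. frechet_derivative (components (Y j)) (at (x t)) (x' t)"
    have "((\<lambda>s. \<Sum>j<n. a j s *\<^sub>R components (Y j) (x s)) has_vector_derivative
        (\<Sum>j<n. a j t *\<^sub>R ?Y' j + ?a' j *\<^sub>R components (Y j) (x t))) (at t)"
    proof (rule has_vector_derivative_sum)
      fix j assume "j \<in> {..<n}"
      then have j: "j < n" by simp
      have 1: "(a j has_real_derivative ?a' j) (at t)"
        using smooth_on_vector_derivative(2)[OF aY(1)[OF j] oT T(2)] by (simp add: has_real_derivative_iff_has_vector_derivative)
      have d: "(components (Y j) has_derivative frechet_derivative (components (Y j)) (at (x t))) (at (x t))"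
        by (rule smooth_on_has_derivative[OF components_smooth[OF aY(2)[OF j]] openU core_ball_in_chart[OF xt(1)]])
      have 2: "((\<lambda>s. components (Y j) (x s)) has_vector_derivative ?Y' j) (at t)"
        using has_derivative_compose[OF dx[OF T0t(2), unfolded has_vector_derivative_def] d]
        unfolding has_vector_derivative_def by (simp only: linear_scale[OF has_derivative_linear[OF d]])
      show "((\<lambda>s. a j s *\<^sub>R components (Y j) (x s)) has_vector_derivative
        a j t *\<^sub>R ?Y' j + ?a' j *\<^sub>R components (Y j) (x t)) (at t)"
        by (rule has_vector_derivative_scaleR[OF 1 2])
    qed
    then have x'': "(x' has_vector_derivative (\<Sum>j<n. a j t *\<^sub>R ?Y' j + ?a' j *\<^sub>R components (Y j) (x t))) (at t)"
      by (rule has_vector_derivative_transform_within_open[of _ _ _ "T \<inter> T0"]) (use oT T0 T T0t x'eq in auto)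
    \<comment> \<open>The vanishing covariant derivative, tested on the coordinate functions. Once
      \<open>components_D\<close> has expanded \<open>D X (Y j)\<close>, the sum is the second
      derivative of the curve plus the Christoffel term.\<close>
    have "(\<Sum>j<n. ?a' j *\<^sub>R components (Y j) (x t) + a j t *\<^sub>R (?Y' j + ?C (components (Y j) (x t)))) = 0"
    proof (rule euclidean_eqI)
      fix b :: 'e assume b: "b \<in> Basis"
      have "(\<Sum>j<n. ?a' j *\<^sub>R components (Y j) (x t) + a j t *\<^sub>R (?Y' j + ?C (components (Y j) (x t)))) \<bullet> b
        = (\<Sum>j<n. ?a' j * (components (Y j) (x t) \<bullet> b) + a j t * (components (D X (Y j)) (x t) \<bullet> b))"
        unfolding inner_sum_left
        by (rule sum.cong) (simp_all add: components_D[OF X aY(2) xt(1)] Xx inner_add_left)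
      also have "\<dots> = 0"
        using W[OF coordinate_smooth[of b]] by (simp add: components_inner[OF b] xt(2) at_I)
      finally show "(\<Sum>j<n. ?a' j *\<^sub>R components (Y j) (x t) + a j t *\<^sub>R (?Y' j + ?C (components (Y j) (x t)))) \<bullet> b = 0 \<bullet> b"
        by simp
    qed
    then have "(\<Sum>j<n. a j t *\<^sub>R ?Y' j + ?a' j *\<^sub>R components (Y j) (x t)) + (\<Sum>j<n. a j t *\<^sub>R ?C (components (Y j) (x t))) = 0"
      by (simp add: sum.distrib scaleR_add_right algebra_simps)
    moreover have "(\<Sum>j<n. a j t *\<^sub>R ?C (components (Y j) (x t))) = ?C (\<Sum>j<n. a j t *\<^sub>R components (Y j) (x t))"
      by (simp only: C.sum C.scale)
    moreover have "\<dots> = ?C (x' t)"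
      by (rule arg_cong[of _ _ ?C], rule x'eq[symmetric]) (use T(2) T0t in simp)
    ultimately have "(\<Sum>j<n. a j t *\<^sub>R ?Y' j + ?a' j *\<^sub>R components (Y j) (x t)) = - ?C (x' t)"
      by (simp only: eq_neg_iff_add_eq_0)
    with x'' show "(x' has_vector_derivative - ?C (x' t)) (at t)"
      by (simp only:)
  next
    assume x'': "(x' has_vector_derivative - ?C (x' t)) (at t)"
    \<comment> \<open>The fields in the definition are indexed by natural numbers, so the basis is
      enumerated.\<close>
    obtain e :: "nat \<Rightarrow> 'e" and n where e: "bij_betw e {..<n} Basis"
      using ex_bij_betw_nat_finite[OF finite_Basis] by (auto simp: lessThan_atLeast0)
    have reidx: "(\<Sum>j<n. g (e j)) = (\<Sum>b\<in>Basis. g b)" for g :: "'e \<Rightarrow> real"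
      by (rule sum.reindex_bij_betw[OF e])
    have eB: "e j \<in> Basis" if "j < n" for j using e that by (auto simp: bij_betw_def)
    \<comment> \<open>The velocity at \<open>t\<close> is extended with constant coefficients; along
      the curve the coefficients in the coordinate frame are the components of the velocity.\<close>
    let ?X = "coordinate_field (x' t)" and ?Y = "\<lambda>j. coordinate_field (e j)" and ?a = "\<lambda>j s. x' s \<bullet> e j"
    have d: "(\<lambda>y. h (\<pi> y)) differentiable (at (x s))" if "h \<in> smooth_functions A" "s \<in> T0" for h s
      by (rule smooth_pullback_differentiable[OF that(1) core_ball_in_chart[OF T0D(3)[OF that(2)]]])
    show "has_covariant_derivative_along A D I \<gamma> (velocity I \<gamma>) t (\<lambda>_. 0)"
      unfolding has_covariant_derivative_along_def
    proof (intro bexI[of _ ?X] exI[of _ T0] exI[of _ n] exI[of _ ?a] exI[of _ ?Y] conjI ballI allI impI)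
      fix h assume h: "h \<in> smooth_functions A"
      show "?X h (\<gamma> t) = velocity I \<gamma> t h"
        unfolding vel[OF T0t(1) h] using coordinate_field_core[OF h xt(1)] xt(2) by simp
      have pt: "?Y j h (\<gamma> t) = frechet_derivative (\<lambda>y. h (\<pi> y)) (at (x t)) (e j)" for j
        using coordinate_field_core[OF h xt(1)] xt(2) by simp
      have DX: "D ?X (?Y j) h (\<gamma> t) = frechet_derivative (\<lambda>y. h (\<pi> y)) (at (x t)) (?C (e j))" for j
      proof -
        have "frechet_derivative (components (?Y j)) (at (x t)) = frechet_derivative (\<lambda>y. e j) (at (x t))"
          by (rule frechet_derivative_cong_open[OF open_ball xt(1) components_coordinate_field])
        then have "components (D ?X (?Y j)) (x t) = ?C (e j)"
          unfolding components_D[OF cf cf xt(1)] components_coordinate_field[OF xt(1)] frechet_derivative_const by simp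
        then show ?thesis
          using vector_field_in_chart[OF D_vector_field[OF cf cf] h xt(1), of "x' t" "e j"] xt(2) by simp
      qed
      interpret dh: linear "frechet_derivative (\<lambda>y. h (\<pi> y)) (at (x t))"
        by (rule pullback_linear[OF h core_ball_in_chart[OF xt(1)]])
      have a': "vector_derivative (?a j) (at t within I) = - ?C (x' t) \<bullet> e j" for j
        unfolding at_I
        by (rule vector_derivative_at)
          (use bounded_linear.has_vector_derivative[OF bounded_linear_inner_left x''] in simp)
      have "(\<Sum>j<n. vector_derivative (?a j) (at t within I) * ?Y j h (\<gamma> t) + ?a j t * D ?X (?Y j) h (\<gamma> t))
        = (\<Sum>j<n. frechet_derivative (\<lambda>y. h (\<pi> y)) (at (x t)) ((- ?C (x' t) \<bullet> e j) *\<^sub>R e j)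
            + frechet_derivative (\<lambda>y. h (\<pi> y)) (at (x t)) ((x' t \<bullet> e j) *\<^sub>R ?C (e j)))"
        by (simp only: a' pt DX dh.scale real_scaleR_def)
      also have "\<dots> = (\<Sum>b\<in>Basis. frechet_derivative (\<lambda>y. h (\<pi> y)) (at (x t)) ((- ?C (x' t) \<bullet> b) *\<^sub>R b)
            + frechet_derivative (\<lambda>y. h (\<pi> y)) (at (x t)) ((x' t \<bullet> b) *\<^sub>R ?C b))"
        by (rule reidx)
      also have "\<dots> = frechet_derivative (\<lambda>y. h (\<pi> y)) (at (x t)) ((\<Sum>b\<in>Basis. (- ?C (x' t) \<bullet> b) *\<^sub>R b) + (\<Sum>b\<in>Basis. (x' t \<bullet> b) *\<^sub>R ?C b))"
        by (simp only: dh.add dh.sum sum.distrib)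
      also have "(\<Sum>b\<in>Basis. (x' t \<bullet> b) *\<^sub>R ?C b) = ?C (\<Sum>b\<in>Basis. (x' t \<bullet> b) *\<^sub>R b)"
        by (simp only: C.sum C.scale)
      finally show "0 = (\<Sum>j<n. vector_derivative (?a j) (at t within I) * ?Y j h (\<gamma> t) + ?a j t * D ?X (?Y j) h (\<gamma> t))"
        by (simp only: euclidean_representation) (simp add: dh.zero)
    next
      fix s h assume s: "s \<in> T0" and h: "h \<in> smooth_functions A"
      have "velocity I \<gamma> s h = (\<Sum>b\<in>Basis. (x' s \<bullet> b) * frechet_derivative (\<lambda>y. h (\<pi> y)) (at (x s)) b)"
        unfolding vel[OF s h] frechet_derivative_components[OF d[OF h s], of "x' s"] by simp
      also have "\<dots> = (\<Sum>j<n. (x' s \<bullet> e j) * frechet_derivative (\<lambda>y. h (\<pi> y)) (at (x s)) (e j))"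
        by (rule reidx[symmetric])
      finally show "velocity I \<gamma> s h = (\<Sum>j<n. ?a j s * ?Y j h (\<gamma> s))"
        using coordinate_field_core[OF h T0D(3)[OF s]] T0D(5)[OF s] by simp
    next
      show "openin (top_of_set I) T0"
        using T0 T0D(1) I by (auto simp: openin_open_eq)
      show "smooth_on T0 (?a j)" for j
        by (rule smooth_on_subset[OF smooth_on_linear_compose[OF TU bounded_linear_inner_left sx'] TU T0]) (use T0D in auto)
    qed (use T0t cf in auto)
  qed
  then show ?thesis by (simp add: x_def)
qed

end

subsection \<open>Ordinary differential equations\<close>

lemma smooth_on_imp_lipschitz_on_cball:
  fixes F :: "'a::euclidean_space \<Rightarrow> 'b::real_normed_vector"
  assumes F: "smooth_on W F" "open W" "cball z R \<subseteq> W"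
  obtains L where "L \<ge> 0" "\<And>x y. x \<in> cball z R \<Longrightarrow> y \<in> cball z R \<Longrightarrow> norm (F x - F y) \<le> L * norm (x - y)"
proof -
  let ?F' = "\<lambda>x. frechet_derivative F (at x)"
  \<comment> \<open>The norms of the partial derivatives add up to a bound for the operator norm
    that is continuous, hence bounded on the closed ball.\<close>
  let ?g = "\<lambda>x. \<Sum>b\<in>Basis. norm (?F' x b)"
  have "continuous_on (cball z R) (\<lambda>x. ?F' x b)" for b
    by (rule continuous_on_subset[OF smooth_on_imp_continuous_on[OF smooth_on_frechet_derivative[OF F(1,2)]] F(3)])
  then have "continuous_on (cball z R) ?g"
    by (intro continuous_on_sum continuous_on_norm)
  then have "compact (?g ` cball z R)"
    by (rule compact_continuous_image[OF _ compact_cball])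
  then have "bounded (?g ` cball z R)" by (rule compact_imp_bounded)
  then obtain L where L: "L > 0" "\<And>x. x \<in> cball z R \<Longrightarrow> \<bar>?g x\<bar> \<le> L"
    unfolding bounded_pos by auto
  have "norm (F x - F y) \<le> L * norm (x - y)" if "x \<in> cball z R" "y \<in> cball z R" for x y
  proof (rule differentiable_bound[OF convex_cball _ _ that])
    fix x assume x: "x \<in> cball z R"
    show "(F has_derivative ?F' x) (at x within cball z R)"
      by (rule has_derivative_at_withinI[OF smooth_on_has_derivative[OF F(1,2)]]) (use x F(3) in blast)
    have d: "F differentiable (at x)"
      by (rule smooth_on_differentiable[OF F(1,2)]) (use x F(3) in blast)
    show "onorm (?F' x) \<le> L"
    proof (rule onorm_le)
      fix v
      have "norm (?F' x v) \<le> (\<Sum>b\<in>Basis. norm ((v \<bullet> b) *\<^sub>R ?F' x b))"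
        unfolding frechet_derivative_components[OF d, of v] by (rule norm_sum)
      also have "\<dots> \<le> (\<Sum>b\<in>Basis. norm (?F' x b) * norm v)"
        by (rule sum_mono) (simp add: Basis_le_norm mult.commute[of "norm (?F' x _)"] mult_right_mono)
      also have "\<dots> = ?g x * norm v" by (simp add: sum_distrib_right)
      also have "\<dots> \<le> L * norm v"
        by (rule mult_right_mono) (use L(2)[OF x] in auto)
      finally show "norm (?F' x v) \<le> L * norm v" .
    qed
  qed
  then show ?thesis using that[of L] L(1) by simp
qed

text \<open>With a globally Lipschitz and bounded right-hand side, the Picard operator acts on the
  complete space of all bounded continuous curves on the line; time is clamped to the interval of
  radius \<delta>. The two integrals below run over lengths at most 2\<delta> and \<delta>, whence
  the factor 3\<delta> and, with 4L\<delta> \<le> 1, the contraction constant 3/4.\<close>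

lemma picard:
  fixes F :: "'a::euclidean_space \<Rightarrow> 'a"
  assumes lip: "\<And>x y. norm (F x - F y) \<le> L * norm (x - y)"
    and bnd: "\<And>x. norm (F x) \<le> M"
    and \<delta>: "\<delta> > 0" "4 * L * \<delta> \<le> 1" and L: "L \<ge> 0"
  obtains u where "u 0 = z" "\<And>t. t \<in> {-\<delta><..<\<delta>} \<Longrightarrow> (u has_vector_derivative F (u t)) (at t)"
    "\<And>t. norm (u t - z) \<le> 3 * \<delta> * M"
proof -
  let ?cl = "\<lambda>t. max (-\<delta>) (min \<delta> t)"
  have cl: "?cl t \<in> {-\<delta>..\<delta>}" for t using \<delta> by auto
  have cF: "continuous_on S F" for S
    by (rule lipschitz_on_continuous_on[of L]) (auto simp: lipschitz_on_def dist_norm lip L)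
  have M: "M \<ge> 0" using bnd[of 0] norm_ge_zero[of "F 0"] by linarith
  \<comment> \<open>The integral from 0 to the clamped time, written as a difference of integrals
    from -\<delta> so that negative times need no separate treatment.\<close>
  define G where "G w t = z + (integral {-\<delta>..?cl t} (\<lambda>s. F (w s)) - integral {-\<delta>..0} (\<lambda>s. F (w s)))"
    for w t
  have cFw: "continuous_on S (\<lambda>s. F (w s))" if "continuous_on UNIV w" for w :: "real \<Rightarrow> 'a" and S
    by (rule continuous_on_compose2[OF cF[of UNIV] continuous_on_subset[OF that]]) auto
  have ib: "norm (integral {-\<delta>..a} f) \<le> B * (2 * \<delta>)"
    if "a \<in> {-\<delta>..\<delta>}" "continuous_on {-\<delta>..a} f" "\<And>s. norm (f s) \<le> B" "B \<ge> 0" for a B and f :: "real \<Rightarrow> 'a"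
  proof -
    have "norm (integral {-\<delta>..a} f) \<le> B * (a - -\<delta>)"
      by (rule integral_bound) (use that in auto)
    also have "\<dots> \<le> B * (2 * \<delta>)" by (rule mult_left_mono) (use that in auto)
    finally show ?thesis .
  qed
  have ib0: "norm (integral {-\<delta>..0} f) \<le> B * \<delta>"
    if "continuous_on {-\<delta>..0} f" "\<And>s. norm (f s) \<le> B" for B and f :: "real \<Rightarrow> 'a"
    using integral_bound[of "-\<delta>" 0 f B] that \<delta> by auto
  have Gbound: "norm (G w t - z) \<le> 3 * \<delta> * M" if "continuous_on UNIV w" for w t
  proof -
    have "norm (G w t - z) \<le> norm (integral {-\<delta>..?cl t} (\<lambda>s. F (w s))) + norm (integral {-\<delta>..0} (\<lambda>s. F (w s)))"
      unfolding G_def by (simp add: norm_triangle_ineq4)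
    also have "\<dots> \<le> M * (2 * \<delta>) + M * \<delta>"
      by (rule add_mono[OF ib[OF cl cFw[OF that] bnd M] ib0[OF cFw[OF that] bnd]])
    finally show ?thesis by (simp add: algebra_simps)
  qed
  have Gcont: "continuous_on UNIV (G w)" if "continuous_on UNIV w" for w
  proof -
    have "continuous_on {-\<delta>..\<delta>} (\<lambda>x. integral {-\<delta>..x} (\<lambda>s. F (w s)))"
      by (rule indefinite_integral_continuous_1) (intro integrable_continuous_interval cFw that)
    moreover have "continuous_on UNIV ?cl"
      by (intro continuous_on_max continuous_on_min continuous_on_const continuous_on_id)
    ultimately have "continuous_on UNIV (\<lambda>t. integral {-\<delta>..?cl t} (\<lambda>s. F (w s)))"
      by (rule continuous_on_compose2) (use cl in blast)
    then show ?thesis unfolding G_def[abs_def] by (intro continuous_intros)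
  qed
  have Gb: "G w \<in> bcontfun" if "continuous_on UNIV w" for w
  proof (rule bcontfun_normI[OF Gcont[OF that]])
    fix t
    show "norm (G w t) \<le> 3 * \<delta> * M + norm z"
      using Gbound[OF that, of t] norm_triangle_ineq[of "G w t - z" z] by simp
  qed
  define P where "P w = Bcontfun (G (apply_bcontfun w))" for w :: "real \<Rightarrow>\<^sub>C 'a"
  have Papp: "apply_bcontfun (P w) t = G (apply_bcontfun w) t" for w t
    by (simp add: P_def Bcontfun_inverse Gb)
  have "dist (P w) (P v) \<le> (3/4) * dist w v" for w v
  proof (rule dist_bound)
    fix t
    let ?w = "apply_bcontfun w" and ?v = "apply_bcontfun v"
    let ?f = "\<lambda>s. F (?w s) - F (?v s)"
    have c: "continuous_on S (\<lambda>s. F (?w s))" "continuous_on S (\<lambda>s. F (?v s))" for S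
      by (rule cFw, simp)+
    have i: "integral {-\<delta>..a} ?f = integral {-\<delta>..a} (\<lambda>s. F (?w s)) - integral {-\<delta>..a} (\<lambda>s. F (?v s))" for a
      by (rule Henstock_Kurzweil_Integration.integral_diff) (intro integrable_continuous_interval c)+
    have fb: "norm (?f s) \<le> L * dist w v" for s
    proof -
      have "norm (?f s) \<le> L * norm (?w s - ?v s)" by (rule lip)
      also have "\<dots> \<le> L * dist w v"
        using dist_bounded[of w s v] by (intro mult_left_mono L) (simp add: dist_norm)
      finally show ?thesis .
    qed
    have "dist (P w t) (P v t) = norm (integral {-\<delta>..?cl t} ?f - integral {-\<delta>..0} ?f)"
      unfolding Papp dist_norm G_def i by (simp add: algebra_simps)
    also have "\<dots> \<le> norm (integral {-\<delta>..?cl t} ?f) + norm (integral {-\<delta>..0} ?f)"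
      by (rule norm_triangle_ineq4)
    also have "\<dots> \<le> L * dist w v * (2 * \<delta>) + L * dist w v * \<delta>"
      by (rule add_mono[OF ib[OF cl _ fb] ib0[OF _ fb]]) (intro continuous_on_diff c mult_nonneg_nonneg L zero_le_dist)+
    also have "\<dots> = (3/4) * (4 * L * \<delta>) * dist w v" by (simp add: algebra_simps)
    also have "\<dots> \<le> (3/4) * 1 * dist w v"
      by (intro mult_right_mono mult_left_mono \<delta>) auto
    finally show "dist (P w t) (P v t) \<le> (3/4) * dist w v" by simp
  qed
  then obtain w where w: "P w = w"
    using banach_fix_type[of "3/4" P] by auto
  let ?u = "apply_bcontfun w"
  have u: "?u t = G ?u t" for t using Papp[of w t] w by simp
  have cw: "continuous_on UNIV ?u" by simp
  show ?thesis
  proof (rule that[of ?u])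
    show "?u 0 = z" using u[of 0] \<delta> by (simp add: G_def)
    show "norm (?u t - z) \<le> 3 * \<delta> * M" for t
      using Gbound[OF cw, of t] u[of t] by simp
    fix t assume t: "t \<in> {-\<delta><..<\<delta>}"
    have "((\<lambda>x. integral {-\<delta>..x} (\<lambda>s. F (?u s))) has_vector_derivative F (?u t)) (at t within {-\<delta>..\<delta>})"
      by (rule integral_has_vector_derivative[OF cFw[OF cw]]) (use t in auto)
    then have "((\<lambda>x. integral {-\<delta>..x} (\<lambda>s. F (?u s))) has_vector_derivative F (?u t)) (at t)"
      using at_within_interior[of t "{-\<delta>..\<delta>}"] t by simp
    then have "((\<lambda>x. z + (integral {-\<delta>..x} (\<lambda>s. F (?u s)) - integral {-\<delta>..0} (\<lambda>s. F (?u s)))) has_vector_derivative F (?u t)) (at t)"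
      by (auto intro!: derivative_eq_intros)
    moreover have "z + (integral {-\<delta>..x} (\<lambda>s. F (?u s)) - integral {-\<delta>..0} (\<lambda>s. F (?u s))) = ?u x"
      if "x \<in> {-\<delta><..<\<delta>}" for x
    proof -
      have "?cl x = x" using that by auto
      then show ?thesis using u[of x] by (simp only: G_def)
    qed
    ultimately show "(?u has_vector_derivative F (?u t)) (at t)"
      by (rule has_vector_derivative_transform_within_open[OF _ open_greaterThanLessThan t])
  qed
qed

text \<open>The point is that one \<delta> serves all initial values near \<open>z0\<close>.
  Precomposing \<open>F\<close> with the projection onto the larger ball makes \<open>picard\<close>
  applicable, and a solution starting in the smaller ball never leaves the larger one, where the
  projection is the identity.\<close>

lemma ode_local_existence:
  fixes F :: "'a::euclidean_space \<Rightarrow> 'a"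
  assumes F: "smooth_on W F" "open W" and z0: "z0 \<in> W"
  obtains \<delta> r L where "\<delta> > 0" "r > 0" "L \<ge> 0" "cball z0 (2 * r) \<subseteq> W"
    "\<And>x y. x \<in> cball z0 (2 * r) \<Longrightarrow> y \<in> cball z0 (2 * r) \<Longrightarrow> norm (F x - F y) \<le> L * norm (x - y)"
    "\<And>z. z \<in> cball z0 r \<Longrightarrow> \<exists>u. u 0 = z \<and>
       (\<forall>t\<in>{-\<delta><..<\<delta>}. u t \<in> cball z0 (2 * r) \<and> (u has_vector_derivative F (u t)) (at t))"
proof -
  obtain e where e: "e > 0" "cball z0 e \<subseteq> W"
    using F(2) z0 by (meson open_contains_cball)
  define r where "r = e / 2"
  have r: "r > 0" "cball z0 (2 * r) \<subseteq> W" using e by (simp_all add: r_def)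
  let ?K = "cball z0 (2 * r)"
  obtain L where L: "L \<ge> 0" "\<And>x y. x \<in> ?K \<Longrightarrow> y \<in> ?K \<Longrightarrow> norm (F x - F y) \<le> L * norm (x - y)"
    by (rule smooth_on_imp_lipschitz_on_cball[OF F r(2)], rule that)
  have "compact (F ` ?K)"
    by (rule compact_continuous_image[OF continuous_on_subset[OF smooth_on_imp_continuous_on[OF F(1)] r(2)] compact_cball])
  then obtain M where M: "M > 0" "\<And>x. x \<in> ?K \<Longrightarrow> norm (F x) \<le> M"
    using compact_imp_bounded[of "F ` ?K"] unfolding bounded_pos by auto
  \<comment> \<open>The first entry is for the contraction, the second keeps solutions within
    distance \<open>r\<close> of their initial value.\<close>
  define \<delta> where "\<delta> = min (1 / (4 * (L + 1))) (r / (3 * M))"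
  have \<delta>: "\<delta> > 0" "4 * L * \<delta> \<le> 1" "3 * \<delta> * M \<le> r"
  proof -
    show "\<delta> > 0" using r L M by (simp add: \<delta>_def)
    have "4 * L * \<delta> \<le> 4 * L * (1 / (4 * (L + 1)))"
      by (rule mult_left_mono) (use L in \<open>simp_all add: \<delta>_def\<close>)
    also have "\<dots> \<le> 1" using L by (simp add: field_simps)
    finally show "4 * L * \<delta> \<le> 1" .
    have "3 * M * \<delta> \<le> 3 * M * (r / (3 * M))"
      by (rule mult_left_mono) (use M in \<open>simp_all add: \<delta>_def\<close>)
    also have "\<dots> = r" using M by simp
    finally show "3 * \<delta> * M \<le> r" by (simp add: mult_ac)
  qed
  \<comment> \<open>Projection onto a convex set does not increase distances, so the Lipschitz
    constant survives.\<close>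
  let ?cp = "closest_point ?K"
  have K: "convex ?K" "closed ?K" "?K \<noteq> {}" using r by auto
  have cpK: "?cp x \<in> ?K" for x by (rule closest_point_in_set[OF K(2,3)])
  have lip: "norm (F (?cp x) - F (?cp y)) \<le> L * norm (x - y)" for x y
  proof -
    have "norm (F (?cp x) - F (?cp y)) \<le> L * norm (?cp x - ?cp y)" by (rule L(2)[OF cpK cpK])
    also have "\<dots> \<le> L * norm (x - y)"
      using closest_point_lipschitz[OF K, of x y] L(1) by (intro mult_left_mono) (simp_all add: dist_norm)
    finally show ?thesis .
  qed
  have "\<exists>u. u 0 = z \<and> (\<forall>t\<in>{-\<delta><..<\<delta>}. u t \<in> ?K \<and> (u has_vector_derivative F (u t)) (at t))"
    if z: "z \<in> cball z0 r" for z
  proof -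
    obtain u where u: "u 0 = z" "\<And>t. t \<in> {-\<delta><..<\<delta>} \<Longrightarrow> (u has_vector_derivative F (?cp (u t))) (at t)"
      "\<And>t. norm (u t - z) \<le> 3 * \<delta> * M"
      by (rule picard[OF lip _ \<delta>(1,2) L(1), of M z]) (use M(2)[OF cpK] in auto)
    have "u t \<in> ?K" for t
    proof -
      have "dist z0 (u t) \<le> dist z0 z + dist z (u t)" by (rule dist_triangle)
      also have "\<dots> \<le> r + r" using z u(3)[of t] \<delta>(3) by (intro add_mono) (auto simp: dist_norm norm_minus_commute)
      finally show ?thesis by simp
    qed
    then show ?thesis using u(1,2) closest_point_self[of _ ?K] by (intro exI[of _ u]) auto
  qed
  note sol = this
  show ?thesis
  proof (rule that[OF \<delta>(1) r(1) L(1) r(2)])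
    show "\<exists>u. u 0 = z \<and> (\<forall>t\<in>{-\<delta><..<\<delta>}. u t \<in> ?K \<and> (u has_vector_derivative F (u t)) (at t))"
      if "z \<in> cball z0 r" for z by (rule sol[OF that])
  qed (rule L(2))
qed

text \<open>The squared distance is used because it is differentiable where the two solutions meet.
  Its derivative is at most 2L times itself in absolute value, so multiplying by the exponential of
  -2Lt, or of 2Lt for backward time, gives a monotone function.\<close>

lemma gronwall:
  fixes F :: "'a::euclidean_space \<Rightarrow> 'a" and J :: "real set"
  assumes lip: "\<And>x y. x \<in> K \<Longrightarrow> y \<in> K \<Longrightarrow> norm (F x - F y) \<le> L * norm (x - y)"
    and J: "is_interval J"
    and u: "\<And>t. t \<in> J \<Longrightarrow> u t \<in> K \<and> (u has_vector_derivative F (u t)) (at t)"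
    and w: "\<And>t. t \<in> J \<Longrightarrow> w t \<in> K \<and> (w has_vector_derivative F (w t)) (at t)"
    and st: "s \<in> J" "t \<in> J"
  shows "norm (u t - w t) \<le> exp (L * \<bar>t - s\<bar>) * norm (u s - w s)"
proof -
  let ?\<phi> = "\<lambda>x. (u x - w x) \<bullet> (u x - w x)"
  let ?\<phi>' = "\<lambda>x. 2 * ((u x - w x) \<bullet> (F (u x) - F (w x)))"
  have d\<phi>: "(?\<phi> has_real_derivative ?\<phi>' x) (at x)" if "x \<in> J" for x
  proof -
    have d: "((\<lambda>x. u x - w x) has_vector_derivative F (u x) - F (w x)) (at x)"
      using u[OF that] w[OF that] by (intro has_vector_derivative_diff) auto
    show ?thesis
      unfolding has_field_derivative_def
      by (rule has_derivative_eq_rhs[OF has_derivative_inner[OF d[unfolded has_vector_derivative_def] d[unfolded has_vector_derivative_def]]])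
        (simp add: fun_eq_iff inner_commute)
  qed
  have b: "\<bar>?\<phi>' x\<bar> \<le> 2 * L * ?\<phi> x" if "x \<in> J" for x
  proof -
    have "\<bar>(u x - w x) \<bullet> (F (u x) - F (w x))\<bar> \<le> norm (u x - w x) * norm (F (u x) - F (w x))"
      by (rule Cauchy_Schwarz_ineq2)
    also have "\<dots> \<le> norm (u x - w x) * (L * norm (u x - w x))"
      using u[OF that] w[OF that] by (intro mult_left_mono lip) auto
    finally show ?thesis by (simp add: dot_square_norm power2_eq_square algebra_simps)
  qed
  have mem: "x \<in> J" if "a \<in> J" "b \<in> J" "a \<le> x" "x \<le> b" for a b x
    using J that unfolding is_interval_1 by blast
  have "?\<phi> t \<le> exp (2 * L * \<bar>t - s\<bar>) * ?\<phi> s"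
  proof (cases "s \<le> t")
    case True
    have "?\<phi> t * exp (- (2 * L) * t) \<le> ?\<phi> s * exp (- (2 * L) * s)"
    proof (rule DERIV_nonpos_imp_nonincreasing[OF True])
      fix x assume "s \<le> x" "x \<le> t"
      then have x: "x \<in> J" using mem st by blast
      have "((\<lambda>x. ?\<phi> x * exp (- (2 * L) * x)) has_real_derivative
          ?\<phi>' x * exp (- (2 * L) * x) + exp (- (2 * L) * x) * - (2 * L) * ?\<phi> x) (at x)"
        using d\<phi>[OF x] by (auto intro!: derivative_eq_intros)
      moreover have "?\<phi>' x * exp (- (2 * L) * x) + exp (- (2 * L) * x) * - (2 * L) * ?\<phi> x
          = exp (- (2 * L) * x) * (?\<phi>' x - 2 * L * ?\<phi> x)" by (simp add: algebra_simps)
      moreover have "\<dots> \<le> 0" by (rule mult_nonneg_nonpos) (use b[OF x] in auto)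
      ultimately show "\<exists>y. ((\<lambda>x. ?\<phi> x * exp (- (2 * L) * x)) has_real_derivative y) (at x) \<and> y \<le> 0"
        by (intro exI conjI) (assumption, simp only:)
    qed
    then have "exp (2 * L * t) * (?\<phi> t * exp (- (2 * L) * t)) \<le> exp (2 * L * t) * (?\<phi> s * exp (- (2 * L) * s))"
      by (rule mult_left_mono) simp
    moreover have "exp (2 * L * t) * (?\<phi> t * exp (- (2 * L) * t)) = ?\<phi> t * exp (2 * L * t + - (2 * L) * t)"
      "exp (2 * L * t) * (?\<phi> s * exp (- (2 * L) * s)) = exp (2 * L * t + - (2 * L) * s) * ?\<phi> s"
      by (simp_all only: exp_add mult_ac)
    moreover have "2 * L * t + - (2 * L) * t = 0" "2 * L * t + - (2 * L) * s = 2 * L * \<bar>t - s\<bar>"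
      using True by (simp_all add: algebra_simps)
    ultimately show ?thesis by (simp only: exp_zero mult_1_right)
  next
    case False
    then have le: "t \<le> s" by simp
    have "?\<phi> t * exp (2 * L * t) \<le> ?\<phi> s * exp (2 * L * s)"
    proof (rule DERIV_nonneg_imp_nondecreasing[OF le])
      fix x assume "t \<le> x" "x \<le> s"
      then have x: "x \<in> J" using mem st by blast
      have "((\<lambda>x. ?\<phi> x * exp (2 * L * x)) has_real_derivative
          ?\<phi>' x * exp (2 * L * x) + exp (2 * L * x) * (2 * L) * ?\<phi> x) (at x)"
        using d\<phi>[OF x] by (auto intro!: derivative_eq_intros)
      moreover have "?\<phi>' x * exp (2 * L * x) + exp (2 * L * x) * (2 * L) * ?\<phi> x
          = exp (2 * L * x) * (?\<phi>' x + 2 * L * ?\<phi> x)" by (simp add: algebra_simps)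
      moreover have "\<dots> \<ge> 0" by (rule mult_nonneg_nonneg) (use b[OF x] in auto)
      ultimately show "\<exists>y. ((\<lambda>x. ?\<phi> x * exp (2 * L * x)) has_real_derivative y) (at x) \<and> y \<ge> 0"
        by (intro exI conjI) (assumption, simp only:)
    qed
    then have "exp (- (2 * L) * t) * (?\<phi> t * exp (2 * L * t)) \<le> exp (- (2 * L) * t) * (?\<phi> s * exp (2 * L * s))"
      by (rule mult_left_mono) simp
    moreover have "exp (- (2 * L) * t) * (?\<phi> t * exp (2 * L * t)) = ?\<phi> t * exp (2 * L * t + - (2 * L) * t)"
      "exp (- (2 * L) * t) * (?\<phi> s * exp (2 * L * s)) = exp (2 * L * s + - (2 * L) * t) * ?\<phi> s"
      by (simp_all only: exp_add mult_ac)
    moreover have "2 * L * t + - (2 * L) * t = 0" "2 * L * s + - (2 * L) * t = 2 * L * \<bar>t - s\<bar>"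
      using le by (simp_all add: algebra_simps)
    ultimately show ?thesis by (simp only: exp_zero mult_1_right)
  qed
  also have "exp (2 * L * \<bar>t - s\<bar>) = (exp (L * \<bar>t - s\<bar>))\<^sup>2"
    by (simp add: exp_add[symmetric] power2_eq_square)
  finally have "(norm (u t - w t))\<^sup>2 \<le> (exp (L * \<bar>t - s\<bar>) * norm (u s - w s))\<^sup>2"
    by (simp add: dot_square_norm power_mult_distrib)
  then show ?thesis by (rule power2_le_imp_le) simp
qed

text \<open>Bootstrapping: the equation expresses the derivative of \<open>z\<close> through
  \<open>z\<close>, so each order of differentiability yields the next.\<close>

lemma ode_solution_smooth:
  fixes F :: "'a::euclidean_space \<Rightarrow> 'a" and J :: "real set"
  assumes F: "smooth_on W F" "open W" and J: "open J" "z ` J \<subseteq> W"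
    and z: "\<And>t. t \<in> J \<Longrightarrow> (z has_vector_derivative F (z t)) (at t)"
  shows "smooth_on J z"
proof (rule smooth_onI)
  fix k show "times_differentiable_on k J z"
  proof (induction k)
    case 0
    show ?case
      using z by (auto intro!: continuous_at_imp_continuous_on has_vector_derivative_continuous)
  next
    case (Suc k)
    show ?case
    proof (rule times_differentiable_on_SucI[OF J(1)])
      show "(z has_derivative (\<lambda>v. v *\<^sub>R F (z t))) (at t)" if "t \<in> J" for t
        using z[OF that] by (simp add: has_vector_derivative_def)
      show "times_differentiable_on k J (\<lambda>t. v *\<^sub>R F (z t))" for v
        by (rule times_differentiable_on_linear_compose[OF J(1) bounded_linear_scaleR_right
              times_differentiable_on_compose[OF J(1) F(2) J(2) Suc smooth_onD[OF F(1)]]])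
    qed
  qed
qed

subsection \<open>Proper maps from a Euclidean space\<close>

lemma homotopic_with_canonI:
  fixes H :: "real \<times> 'a::topological_space \<Rightarrow> 'b::topological_space"
  assumes "continuous_on ({0..1} \<times> S) H" "\<And>t x. t \<in> {0..1} \<Longrightarrow> x \<in> S \<Longrightarrow> H (t, x) \<in> T"
    and "\<And>x. H (0, x) = f x" "\<And>x. H (1, x) = g x" "\<And>t. t \<in> {0..1} \<Longrightarrow> P (\<lambda>x. H (t, x))"
  shows "homotopic_with_canon P S T f g"
  unfolding homotopic_with_def
proof (rule exI[of _ H], intro conjI)
  show "continuous_map (prod_topology (top_of_set {0..1}) (top_of_set S)) (top_of_set T) H"
    using assms(1,2) by (auto simp: Pi_iff)
qed (rule allI ballI assms(3-5) | assumption)+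

lemma homotopic_with_canonD:
  fixes f g :: "'a::topological_space \<Rightarrow> 'b::topological_space"
  assumes "homotopic_with_canon P S T f g"
  shows "\<exists>H :: real \<times> 'a \<Rightarrow> 'b. continuous_on ({0..1} \<times> S) H \<and> (\<forall>x. H (0, x) = f x) \<and>
    (\<forall>x. H (1, x) = g x) \<and> (\<forall>t\<in>{0..1}. P (\<lambda>x. H (t, x)))"
proof -
  obtain H :: "real \<times> 'a \<Rightarrow> 'b"
    where c: "continuous_map (prod_topology (top_of_set {0..1}) (top_of_set S)) (top_of_set T) H"
      and H: "\<forall>x. H (0, x) = f x" "\<forall>x. H (1, x) = g x" "\<forall>t\<in>{0..1}. P (\<lambda>x. H (t, x))"
    using assms unfolding homotopic_with_def by (elim exE conjE)
  have "continuous_on ({0..1} \<times> S) H" using c by auto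
  then show ?thesis using H by (intro exI[of _ H] conjI)
qed

text \<open>The straight segment between two unit vectors meets the origin only at its midpoint and
  only if they are antipodal; otherwise it can be normalised.\<close>

lemma nonantipodal_imp_homotopic:
  fixes f g :: "'a::topological_space \<Rightarrow> 'b::real_normed_vector"
  assumes f: "continuous_on S f" "\<And>x. norm (f x) = 1" and g: "continuous_on S g" "\<And>x. norm (g x) = 1"
    and anti: "\<And>x. f x \<noteq> - g x"
  shows "homotopic_with_canon (\<lambda>_. True) S (sphere 0 1) f g"
proof -
  let ?h = "\<lambda>z. (1 - fst z) *\<^sub>R f (snd z) + fst z *\<^sub>R g (snd z)"
  have nz: "?h (t, x) \<noteq> 0" if "t \<in> {0..1}" for t x
  proof
    assume "?h (t, x) = 0"
    then have e: "(1 - t) *\<^sub>R f x = t *\<^sub>R - g x" by (simp add: eq_neg_iff_add_eq_0)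
    then have "norm ((1 - t) *\<^sub>R f x) = norm (t *\<^sub>R - g x)" by simp
    then have "t = 1/2" using f(2) g(2) that by simp
    then have "(1/2) *\<^sub>R f x = (1/2) *\<^sub>R - g x" using e unfolding \<open>t = 1/2\<close> by simp
    then have "f x = - g x" by (simp only: scaleR_cancel_left) simp
    then show False using anti[of x] by simp
  qed
  have c: "continuous_on ({0..1} \<times> S) ?h"
    by (intro continuous_intros continuous_on_compose2[OF f(1)] continuous_on_compose2[OF g(1)]) auto
  show ?thesis
  proof (rule homotopic_with_canonI[where H = "\<lambda>z. (1 / norm (?h z)) *\<^sub>R ?h z"])
    show "continuous_on ({0..1} \<times> S) (\<lambda>z. (1 / norm (?h z)) *\<^sub>R ?h z)"
      by (intro continuous_on_scaleR continuous_on_divide continuous_on_const continuous_on_norm c) (use nz in force)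
    show "(1 / norm (?h (t, x))) *\<^sub>R ?h (t, x) \<in> sphere 0 1" if "t \<in> {0..1}" "x \<in> S" for t x
      using nz[OF that(1), of x] by simp
  qed (use f(2) g(2) in simp_all)
qed

text \<open>Inverse stereographic projection of \<open>w / m\<close>, written homogeneously so that it extends to the
  north pole at \<open>m = 0\<close>.\<close>
definition stereo :: "'e::euclidean_space \<Rightarrow> real \<Rightarrow> 'e \<times> real" where
  "stereo w m = (1 / ((norm w)\<^sup>2 + m\<^sup>2)) *\<^sub>R ((2 * m) *\<^sub>R w, (norm w)\<^sup>2 - m\<^sup>2)"

lemma stereo_denom_pos: "w \<noteq> 0 \<or> m \<noteq> 0 \<Longrightarrow> (norm (w :: 'e::euclidean_space))\<^sup>2 + m\<^sup>2 > 0"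
  by (metis add_pos_nonneg add_nonneg_pos zero_le_power2 zero_less_norm_iff zero_less_power zero_less_power2)

lemma norm_stereo:
  assumes "w \<noteq> 0 \<or> m \<noteq> 0"
  shows "norm (stereo w m) = 1"
proof -
  let ?d = "(norm w)\<^sup>2 + m\<^sup>2"
  have d: "?d > 0" by (rule stereo_denom_pos[OF assms])
  have "(norm ((2 * m) *\<^sub>R w, (norm w)\<^sup>2 - m\<^sup>2))\<^sup>2 = (2 * m * norm w)\<^sup>2 + ((norm w)\<^sup>2 - m\<^sup>2)\<^sup>2"
    by (simp add: norm_Pair power_mult_distrib)
  also have "\<dots> = ?d\<^sup>2" by (simp add: power2_eq_square algebra_simps)
  finally have n: "norm ((2 * m) *\<^sub>R w, (norm w)\<^sup>2 - m\<^sup>2) = ?d"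
    using d by (metis abs_norm_cancel abs_of_pos power2_eq_iff_nonneg norm_ge_zero less_imp_le)
  have "\<bar>1 / d\<bar> * d = 1" if "d > 0" for d :: real using that by simp
  from this[OF d] show ?thesis unfolding stereo_def norm_scaleR n .
qed

lemma stereo_pole: "w \<noteq> 0 \<Longrightarrow> stereo w 0 = (0, 1)"
  by (simp add: stereo_def)

lemma stereo_zero: "m \<noteq> 0 \<Longrightarrow> stereo 0 m = (0, -1)"
  by (simp add: stereo_def)

lemma stereo_eq_south:
  assumes "stereo w m = (0, -1)" "w \<noteq> 0 \<or> m \<noteq> 0"
  shows "w = 0"
proof -
  have d: "(norm w)\<^sup>2 + m\<^sup>2 > 0" by (rule stereo_denom_pos[OF assms(2)])
  have "((norm w)\<^sup>2 - m\<^sup>2) / ((norm w)\<^sup>2 + m\<^sup>2) = -1"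
    using assms(1) by (simp add: stereo_def)
  then have "(norm w)\<^sup>2 - m\<^sup>2 = -1 * ((norm w)\<^sup>2 + m\<^sup>2)"
    by (rule iffD1[OF nonzero_divide_eq_eq[OF less_imp_neq[OF d, THEN not_sym]]])
  then have "(norm w)\<^sup>2 = 0" by simp
  then show ?thesis by simp
qed

text \<open>Take the inner product of the first components with \<open>v\<close>: it is nonnegative
  on the left and, unless \<open>v\<close> is 0, negative on the right. This later excludes
  antipodal values.\<close>

lemma stereo_eq_uminus_stereo_1:
  assumes "stereo w m = - stereo v 1" "w \<noteq> 0 \<or> m \<noteq> 0" "m \<ge> 0" "v \<bullet> w \<ge> 0"
  shows "v = 0"
proof -
  have d: "(norm w)\<^sup>2 + m\<^sup>2 > 0" "(norm v)\<^sup>2 + 1 > 0"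
    using stereo_denom_pos[OF assms(2)] by (auto intro: add_nonneg_pos)
  have "v \<bullet> fst (stereo w m) = - (v \<bullet> fst (stereo v 1))" using assms(1) by simp
  then have "(2 * m * (v \<bullet> w)) / ((norm w)\<^sup>2 + m\<^sup>2) = - (2 * (v \<bullet> v) / ((norm v)\<^sup>2 + 1))"
    by (simp add: stereo_def)
  moreover have "(2 * m * (v \<bullet> w)) / ((norm w)\<^sup>2 + m\<^sup>2) \<ge> 0"
    using assms d by simp
  ultimately have "2 * (v \<bullet> v) / ((norm v)\<^sup>2 + 1) \<le> 0" by simp
  then have "v \<bullet> v \<le> 0" using d(2) by (simp add: divide_le_0_iff)
  then show "v = 0" by (metis inner_eq_zero_iff inner_ge_zero order_antisym)
qed

lemma continuous_on_stereo:
  assumes "continuous_on S w" "continuous_on S m" "\<And>x. x \<in> S \<Longrightarrow> w x \<noteq> 0 \<or> m x \<noteq> 0"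
  shows "continuous_on S (\<lambda>x. stereo (w x) (m x))"
  unfolding stereo_def
  by (intro continuous_intros assms(1,2)) (use stereo_denom_pos[OF assms(3)] in force)

text \<open>The sphere is the one-point compactification of the domain of \<open>F\<close>, with \<open>(0, 1)\<close> as the point
  at infinity.\<close>
lemma sphere_extension_continuous:
  fixes F :: "real \<times> 'e::euclidean_space \<Rightarrow> 'e \<times> real"
  assumes F: "continuous_on ({0..1} \<times> UNIV) F" "\<And>t v. t \<in> {0..1} \<Longrightarrow> norm v \<ge> R \<Longrightarrow> F (t, v) = (0, 1)"
  shows "continuous_on ({0..1} \<times> sphere 0 1)
    (\<lambda>(t, y). if snd y = 1 then (0, 1) else F (t, (1 / (1 - snd y)) *\<^sub>R fst y))"
proof -
  \<comment> \<open>A point at height h on the sphere corresponds to a vector of squared norm (1 +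
    h) / (1 - h), which is at least R^2 once h \<ge> (R^2 - 1) / (R^2 + 1). Above the height
    \<open>h0\<close> the extended map is therefore constant, and continuity follows by pasting
    along this height.\<close>
  define h0 where "h0 = max 0 ((R\<^sup>2 - 1) / (R\<^sup>2 + 1))"
  have Rp: "R\<^sup>2 + 1 > 0" by (intro add_nonneg_pos) auto
  have h0: "h0 < 1" "(R\<^sup>2 - 1) / (R\<^sup>2 + 1) \<le> h0"
    using Rp by (auto simp: h0_def field_simps)
  let ?G = "\<lambda>z. F (fst z, (1 / (1 - snd (snd z))) *\<^sub>R fst (snd z))"
  let ?S = "({0..1} \<times> sphere 0 1) \<inter> {z :: real \<times> 'e \<times> real. snd (snd z) \<le> h0}"
  let ?T = "({0..1} \<times> sphere 0 1) \<inter> {z :: real \<times> 'e \<times> real. snd (snd z) \<ge> h0}"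
  have far: "norm ((1 / (1 - h)) *\<^sub>R y) \<ge> R" if y: "(y, h) \<in> sphere 0 1" and h: "h \<ge> h0" "h \<noteq> 1" for y :: 'e and h
  proof -
    have n: "(norm y)\<^sup>2 + h\<^sup>2 = 1" using y by (simp add: norm_Pair)
    have "h\<^sup>2 \<le> 1" using n by (metis le_add_same_cancel2 zero_le_power2)
    then have h1: "h < 1" using h(2) by (simp add: abs_square_le_1 abs_le_iff)
    have "(R\<^sup>2 - 1) \<le> h * (R\<^sup>2 + 1)"
      using h0(2) h(1) Rp by (simp add: pos_divide_le_eq)
        (meson h(1) mult_right_mono order_trans less_imp_le)
    then have "R\<^sup>2 * (1 - h) \<le> 1 + h" by (simp add: algebra_simps)
    then have "R\<^sup>2 * (1 - h) * (1 - h) \<le> (1 + h) * (1 - h)"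
      by (rule mult_right_mono) (use h1 in simp)
    also have "\<dots> = (norm y)\<^sup>2" using n by (simp add: power2_eq_square algebra_simps)
    finally have "(R * (1 - h))\<^sup>2 \<le> (norm y)\<^sup>2" by (simp add: power2_eq_square mult_ac)
    then have "R * (1 - h) \<le> norm y" by (rule power2_le_imp_le) simp
    then show ?thesis using h1 by (simp add: field_simps)
  qed
  have "continuous_on (?S \<union> ?T) (\<lambda>z. if snd (snd z) \<le> h0 then ?G z else (0, 1))"
  proof (rule continuous_on_cases_local)
    have cl: "closed {z :: real \<times> 'e \<times> real. snd (snd z) \<le> h0}" "closed {z :: real \<times> 'e \<times> real. snd (snd z) \<ge> h0}"
      by (intro closed_Collect_le continuous_intros)+
    have un: "?S \<union> ?T = {0..1} \<times> sphere 0 1" by auto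
    show "closedin (top_of_set (?S \<union> ?T)) ?S" "closedin (top_of_set (?S \<union> ?T)) ?T"
      unfolding un by (intro closedin_closed_Int cl)+
    show "continuous_on ?S ?G"
      by (rule continuous_on_compose2[OF F(1)]) (use h0 in \<open>auto intro!: continuous_intros\<close>)
    show "continuous_on ?T (\<lambda>z. (0, 1))" by simp
    show "?G z = (0, 1)" if "z \<in> ?S \<and> \<not> snd (snd z) \<le> h0 \<or> z \<in> ?T \<and> snd (snd z) \<le> h0" for z
      using that far[of "fst (snd z)" "snd (snd z)"] h0 by (intro F(2)) auto
  qed
  moreover have "?S \<union> ?T = {0..1} \<times> sphere 0 1" by auto
  ultimately have "continuous_on ({0..1} \<times> sphere 0 1) (\<lambda>z. if snd (snd z) \<le> h0 then ?G z else (0, 1))"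
    by simp
  then show ?thesis
  proof (rule continuous_on_eq)
    fix z :: "real \<times> 'e \<times> real" assume z: "z \<in> {0..1} \<times> sphere 0 1"
    show "(if snd (snd z) \<le> h0 then ?G z else (0, 1)) =
        (case z of (t, y) \<Rightarrow> if snd y = 1 then (0, 1) else F (t, (1 / (1 - snd y)) *\<^sub>R fst y))"
      using z h0 far[of "fst (snd z)" "snd (snd z)"] F(2) by (auto simp: split_beta)
  qed
qed

lemma stereo_inverse:
  assumes "y \<in> sphere (0 :: 'e::euclidean_space \<times> real) 1" "snd y \<noteq> 1"
  shows "stereo ((1 / (1 - snd y)) *\<^sub>R fst y) 1 = y"
proof -
  obtain v h where y: "y = (v, h)" by (cases y)
  have n: "(norm v)\<^sup>2 = (1 - h) * (1 + h)" using assms(1) by (simp add: y norm_Pair power2_eq_square algebra_simps)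
  have h: "1 - h \<noteq> 0" using assms(2) by (simp add: y)
  have q: "(norm ((1 / (1 - h)) *\<^sub>R v))\<^sup>2 = (1 + h) / (1 - h)"
    using h by (simp add: power_divide power_mult_distrib n) (simp add: power2_eq_square divide_simps)
  have s: "(1 + h) / (1 - h) + 1 = 2 / (1 - h)" "(1 + h) / (1 - h) - 1 = 2 * h / (1 - h)"
    using h by (simp_all add: field_simps)
  show ?thesis
    unfolding y stereo_def snd_conv fst_conv q one_power2 s scaleR_Pair scaleR_scaleR
  proof (rule arg_cong2[of _ _ _ _ Pair])
    have "1 / (2 / (1 - h)) * (2 * 1 * (1 / (1 - h))) = 1" using h by (simp add: divide_simps)
    then show "(1 / (2 / (1 - h)) * (2 * 1 * (1 / (1 - h)))) *\<^sub>R v = v" by (simp only: scaleR_one)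
    show "(1 / (2 / (1 - h))) *\<^sub>R (2 * h / (1 - h)) = h" using h by (simp add: divide_simps)
  qed
qed

text \<open>Connectedness as a proof rule: a locally constant property that holds at one point holds
  everywhere. It is applied to points of the manifold as well as to times along geodesics.\<close>

lemma clopen_of_local:
  fixes Q :: "'m::topological_space \<Rightarrow> bool"
  assumes nb: "\<And>x. \<exists>N. open N \<and> x \<in> N \<and> (\<forall>y\<in>N. Q y \<longleftrightarrow> Q x)"
    and conn: "connected (UNIV :: 'm set)" and q: "Q q"
  shows "Q p"
proof -
  have op: "open {x. Q x = b}" for b
  proof (subst open_subopen, rule ballI)
    fix x assume x: "x \<in> {x. Q x = b}"
    obtain N where N: "open N" "x \<in> N" "\<forall>y\<in>N. Q y \<longleftrightarrow> Q x"
      using nb[of x] by auto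
    have "N \<subseteq> {x. Q x = b}"
      using N(3) x by auto
    with N(1,2) show "\<exists>T. open T \<and> x \<in> T \<and> T \<subseteq> {x. Q x = b}"
      by (intro exI[of _ N] conjI)
  qed
  have "{x. Q x = True} \<inter> {x. Q x = False} \<inter> UNIV = {}" "UNIV \<subseteq> {x. Q x = True} \<union> {x. Q x = False}"
    by auto
  from connectedD[OF conn op op this] have "{x. Q x = False} = {}"
    using q by auto
  then show ?thesis by auto
qed

section \<open>Deforming proper maps into a connected manifold\<close>

context smooth_manifold
begin

lemma chart_ball_compact:
  "(U, \<phi>) \<in> A \<Longrightarrow> cball c s \<subseteq> \<phi> ` U \<Longrightarrow> compact (inv_into U \<phi> ` cball c s)"
  by (rule compact_continuous_image[OF continuous_on_subset[OF chart_inv_continuous] compact_cball])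

lemma chart_ball_open:
  assumes "(U, \<phi>) \<in> A" "cball c s \<subseteq> \<phi> ` U"
  shows "open (inv_into U \<phi> ` ball c s)"
proof -
  have "inv_into U \<phi> ` ball c s = {p \<in> U. \<phi> p \<in> ball c s}"
    using assms by (force intro: inv_into_into simp: subset_iff f_inv_into_f)
  then show ?thesis using chart_vimage_open[OF assms(1) open_ball] by simp
qed

text \<open>Both pieces are closed: the closed chart ball is compact in a Hausdorff space, and the
  open one is open in the manifold. They overlap in the sphere only. The factor
  \<open>{0..1}\<close> is carried along so that homotopies can be pasted too.\<close>

lemma continuous_on_chart_ball_paste:
  fixes k :: "real \<times> 'm \<Rightarrow> 'z::topological_space"
  assumes U: "(U, \<phi>) \<in> A" "cball c s \<subseteq> \<phi> ` U"
    and g: "continuous_on ({0..1} \<times> cball c s) g" and k: "continuous_on ({0..1} \<times> UNIV) k"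
    and eq: "\<And>t x. t \<in> {0..1} \<Longrightarrow> x \<in> sphere c s \<Longrightarrow> g (t, x) = k (t, inv_into U \<phi> x)"
  shows "continuous_on ({0..1} \<times> UNIV)
    (\<lambda>z. if snd z \<in> inv_into U \<phi> ` cball c s then g (fst z, \<phi> (snd z)) else k z)"
proof -
  let ?B = "inv_into U \<phi> ` cball c s" and ?O = "inv_into U \<phi> ` ball c s"
  let ?S = "{0..1::real} \<times> ?B" and ?T = "{0..1::real} \<times> - ?O"
  have sub: "?O \<subseteq> ?B" by auto
  then have un: "?S \<union> ?T = {0..1} \<times> UNIV" by auto
  have B: "p \<in> U \<and> \<phi> p \<in> cball c s" if "p \<in> ?B" for p
    using that U by (auto intro: inv_into_into simp: subset_iff f_inv_into_f)
  have "continuous_on (?S \<union> ?T) (\<lambda>z. if snd z \<in> ?B then g (fst z, \<phi> (snd z)) else k z)"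
  proof (rule continuous_on_cases_local)
    show "closedin (top_of_set (?S \<union> ?T)) ?S" "closedin (top_of_set (?S \<union> ?T)) ?T"
      unfolding un using compact_imp_closed[OF chart_ball_compact[OF U]] chart_ball_open[OF U]
      by (auto intro!: closed_subset closed_Times)
    show "continuous_on ?S (\<lambda>z. g (fst z, \<phi> (snd z)))"
      by (rule continuous_on_compose2[OF g])
        (use B in \<open>auto intro!: continuous_on_Pair continuous_on_fst continuous_on_id
            continuous_on_compose2[OF chart_continuous[OF U(1)]] continuous_on_snd\<close>)
    show "continuous_on ?T k" by (rule continuous_on_subset[OF k]) auto
    show "g (fst z, \<phi> (snd z)) = k z" if "z \<in> ?S \<and> snd z \<notin> ?B \<or> z \<in> ?T \<and> snd z \<in> ?B" for z
    proof -
      obtain t p where z: "z = (t, p)" by (cases z)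
      with that have tp: "t \<in> {0..1}" "p \<in> ?B" "p \<notin> ?O" by auto
      have p: "inv_into U \<phi> (\<phi> p) = p" using B[OF tp(2)] U by simp
      have "\<phi> p \<notin> ball c s" using tp(3) p by (metis imageI)
      then have "\<phi> p \<in> sphere c s" using B[OF tp(2)] by auto
      from eq[OF tp(1) this] show ?thesis using z p by simp
    qed
  qed
  then show ?thesis unfolding un .
qed

text \<open>A stand-in for vanishing degree over \<open>x\<close>. The deformation is held fixed
  outside some ball, whose radius may depend on it.\<close>

definition missable :: "('e \<Rightarrow> 'm) \<Rightarrow> 'm \<Rightarrow> bool" where
  "missable e x \<longleftrightarrow> (\<exists>g R. homotopic_with_canon (\<lambda>g. \<forall>v. norm v \<ge> R \<longrightarrow> g v = e v) UNIV UNIV e g \<and> x \<notin> range g)"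

text \<open>The deformed map is followed by the straight-line homotopy, inside the chart ball, from
  the identity to \<open>f\<close>. The stages in between need not be injective; only the final map
  \<open>f\<close> must be, so that what avoids \<open>a\<close> comes to avoid
  \<open>f a\<close>.\<close>

lemma missable_move:
  assumes proper: "\<And>K. compact K \<Longrightarrow> bounded (e -` K)"
    and U: "(U, \<phi>) \<in> A" "cball c s \<subseteq> \<phi> ` U"
    and f: "continuous_on (cball c s) f" "f ` cball c s \<subseteq> cball c s" "inj_on f (cball c s)"
      "\<And>x. x \<in> sphere c s \<Longrightarrow> f x = x"
    and a: "a \<in> cball c s" and miss: "missable e (inv_into U \<phi> a)"
  shows "missable e (inv_into U \<phi> (f a))"
proof -
  let ?P = "inv_into U \<phi>" and ?B = "inv_into U \<phi> ` cball c s"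
  obtain g R where g: "homotopic_with_canon (\<lambda>g. \<forall>v. norm v \<ge> R \<longrightarrow> g v = e v) UNIV UNIV e g" "?P a \<notin> range g"
    using miss unfolding missable_def by blast
  let ?l = "\<lambda>t x. (1 - t) *\<^sub>R x + t *\<^sub>R f x"
  let ?H = "\<lambda>z. if snd z \<in> ?B then ?P (?l (fst z) (\<phi> (snd z))) else snd z"
  have l: "?l t x \<in> cball c s" if "t \<in> {0..1}" "x \<in> cball c s" for t x
  proof -
    have "f x \<in> cball c s" using that(2) f(2) by blast
    from convexD_alt[OF convex_cball that(2) this, of t] that(1) show ?thesis by simp
  qed
  have "continuous_on ({0..1} \<times> UNIV) (\<lambda>z. if snd z \<in> ?B then (\<lambda>z. ?P (?l (fst z) (snd z))) (fst z, \<phi> (snd z)) else snd z)"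
  proof (rule continuous_on_chart_ball_paste[OF U])
    show "continuous_on ({0..1} \<times> cball c s) (\<lambda>z. ?P (?l (fst z) (snd z)))"
    proof (rule continuous_on_compose2[OF continuous_on_subset[OF chart_inv_continuous[OF U(1)] U(2)]])
      show "continuous_on ({0..1} \<times> cball c s) (\<lambda>z. ?l (fst z) (snd z))"
        by (intro continuous_intros continuous_on_compose2[OF f(1)]) auto
    qed (use l in auto)
    show "continuous_on ({0..1} \<times> UNIV) (snd :: real \<times> 'm \<Rightarrow> 'm)" by (intro continuous_intros)
    show "(\<lambda>z. ?P (?l (fst z) (snd z))) (t, x) = snd (t, ?P x)" if "t \<in> {0..1}" "x \<in> sphere c s" for t x
      using f(4)[OF that(2)] by (simp add: algebra_simps)
  qed
  then have H: "continuous_on ({0..1} \<times> UNIV) ?H" unfolding fst_conv snd_conv .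
  have B: "?P (\<phi> p) = p" "\<phi> p \<in> cball c s" if "p \<in> ?B" for p
    using that U by (auto intro: inv_into_into simp: subset_iff f_inv_into_f)
  obtain R' where R': "\<And>v. e v \<in> ?B \<Longrightarrow> norm v \<le> R'"
    using proper[OF chart_ball_compact[OF U]] unfolding bounded_iff by auto
  \<comment> \<open>Properness bounds the vectors that \<open>e\<close> sends into the chart ball by
    \<open>R'\<close>. From norm \<open>R' + 1\<close> on, the values of \<open>e\<close> lie where
    the homotopy is stationary.\<close>
  define R2 where "R2 = max R (R' + 1)"
  have far: "e v \<notin> ?B" if "norm v \<ge> R2" for v
    using R'[of v] that by (auto simp: R2_def)
  have cg: "continuous_on UNIV g"
    using homotopic_with_imp_continuous[OF g(1)] by simp
  have gR: "g v = e v" if "norm v \<ge> R" for v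
    using homotopic_with_imp_property[OF g(1)] that by blast
  let ?g = "\<lambda>v. ?H (1, g v)"
  have "homotopic_with_canon (\<lambda>g. \<forall>v. norm v \<ge> R2 \<longrightarrow> g v = e v) UNIV UNIV g ?g"
  proof (rule homotopic_with_canonI[where H = "\<lambda>z. ?H (fst z, g (snd z))"])
    show "continuous_on ({0..1} \<times> UNIV) (\<lambda>z. ?H (fst z, g (snd z)))"
      by (rule continuous_on_compose2[OF H])
        (auto intro!: continuous_on_Pair continuous_on_fst continuous_on_id continuous_on_compose2[OF cg] continuous_on_snd)
    show "?H (fst (0, x), g (snd (0, x))) = g x" for x :: 'e
      using B[of "g x"] by simp
    show "\<forall>v. R2 \<le> norm v \<longrightarrow> ?H (fst (t, v), g (snd (t, v))) = e v" for t
      using far gR by (auto simp: R2_def)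
  qed simp_all
  moreover have "homotopic_with_canon (\<lambda>g. \<forall>v. norm v \<ge> R2 \<longrightarrow> g v = e v) UNIV UNIV e g"
    by (rule homotopic_with_mono[OF g(1)]) (auto simp: R2_def)
  ultimately have "homotopic_with_canon (\<lambda>g. \<forall>v. norm v \<ge> R2 \<longrightarrow> g v = e v) UNIV UNIV e ?g"
    using homotopic_with_trans by blast
  moreover have "?P (f a) \<notin> range ?g"
  proof
    assume "?P (f a) \<in> range ?g"
    then obtain v where v: "?P (f a) = ?H (1, g v)" by (rule rangeE)
    have fa: "f a \<in> cball c s" using f(2) a by blast
    show False
    proof (cases "g v \<in> ?B")
      case True
      then have e: "?P (f a) = ?P (f (\<phi> (g v)))" using v by simp
      have "f (\<phi> (g v)) \<in> cball c s" using f(2) B(2)[OF True] by blast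
      then have "f a = f (\<phi> (g v))"
        using arg_cong[OF e, of \<phi>] fa U(2) chart_right_inverse[OF U(1)] by (metis subsetD)
      then have "a = \<phi> (g v)" using inj_onD[OF f(3) _ a B(2)[OF True]] by simp
      then have "?P a = g v" using B(1)[OF True] by simp
      then show False using g(2) by auto
    next
      case False
      then have "?P (f a) = g v" using v by simp
      then show False using False fa by (metis imageI)
    qed
  qed
  ultimately show ?thesis unfolding missable_def by blast
qed

text \<open>A homeomorphism of a closed ball fixing the boundary can carry the centre to any
  interior point. Used in both directions, it shows that missability is constant on a chart
  ball.\<close>

lemma missable_everywhere:
  assumes proper: "\<And>K. compact K \<Longrightarrow> bounded (e -` K)" and conn: "connected (UNIV :: 'm set)"
    and q: "missable e q"
  shows "missable e p"
proof -
  have nb: "\<exists>N. open N \<and> x \<in> N \<and> (\<forall>y\<in>N. missable e y \<longleftrightarrow> missable e x)" for x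
  proof -
    obtain U \<phi> where U: "(U, \<phi>) \<in> A" "x \<in> U" using chart_cover by blast
    obtain s where s: "s > 0" "cball (\<phi> x) s \<subseteq> \<phi> ` U"
      using chart_image_open[OF U(1)] U(2) by (meson imageI open_contains_cball)
    let ?P = "inv_into U \<phi>"
    have "missable e y \<longleftrightarrow> missable e x" if "y \<in> ?P ` ball (\<phi> x) s" for y
    proof -
      obtain u where u: "u \<in> ball (\<phi> x) s" "y = ?P u" using \<open>y \<in> _\<close> by auto
      obtain f g where fg: "homeomorphism (cball (\<phi> x) s \<inter> UNIV) (cball (\<phi> x) s \<inter> UNIV) f g"
        "f (\<phi> x) = u" "\<And>z. z \<in> sphere (\<phi> x) s \<Longrightarrow> f z = z"
        by (rule homeomorphism_moving_point_1[OF affine_UNIV UNIV_I, of u "\<phi> x" s]) (use u in auto)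
      have h: "homeomorphism (cball (\<phi> x) s) (cball (\<phi> x) s) f g" using fg(1) by simp
      have c: "\<phi> x \<in> cball (\<phi> x) s" using s by simp
      have gf: "g (f z) = z" "f (g z) = z" if "z \<in> cball (\<phi> x) s" for z
        using h that by (auto simp: homeomorphism_def)
      have gs: "g z = z" if "z \<in> sphere (\<phi> x) s" for z
        using gf(1)[of z] fg(3)[OF that] that by auto
      have inj: "inj_on f (cball (\<phi> x) s)" "inj_on g (cball (\<phi> x) s)"
        using gf by (metis inj_onI)+
      have px: "?P (\<phi> x) = x" using U by simp
      show ?thesis
      proof
        assume "missable e x"
        then have "missable e (?P (f (\<phi> x)))"
          using missable_move[OF proper U(1) s(2) homeomorphism_cont1[OF h] _ inj(1) fg(3) c] px h
          by (simp add: homeomorphism_def)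
        then show "missable e y" using u fg(2) by simp
      next
        assume "missable e y"
        then have "missable e (?P (g u))"
          using missable_move[OF proper U(1) s(2) homeomorphism_cont2[OF h] _ inj(2) gs, of u] u h
          by (simp add: homeomorphism_def)
        then show "missable e x" using px gf(1)[OF c] fg(2) by simp
      qed
    qed
    then have "\<forall>y\<in>?P ` ball (\<phi> x) s. missable e y \<longleftrightarrow> missable e x" by (rule ballI)
    moreover have "x \<in> ?P ` ball (\<phi> x) s"
      by (rule image_eqI[of _ _ "\<phi> x"]) (use U s in simp_all)
    ultimately show ?thesis
      using chart_ball_open[OF U(1) s(2)] by (intro exI[of _ "?P ` ball (\<phi> x) s"] conjI)
  qed
  then show ?thesis by (rule clopen_of_local[where Q = "missable e", OF _ conn q])
qed

text \<open>If \<open>e\<close> misses a point, pushing that point to \<open>p\<close> deforms \<open>e\<close>, keeping it fixed near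
  infinity, to a map that misses \<open>p\<close>. Collapsing the complement of a small ball around \<open>p\<close> turns this
  into a null-homotopy of a map of spheres that is homotopic to the identity.\<close>
lemma proper_map_surj:
  fixes e :: "'e \<Rightarrow> 'm"
  assumes conn: "connected (UNIV :: 'm set)" and e: "continuous_on UNIV e"
    and proper: "\<And>K. compact K \<Longrightarrow> bounded (e -` K)"
    and e0: "\<And>v. e v = p \<longleftrightarrow> v = 0"
    and U: "(U, \<phi>) \<in> A" "p \<in> U"
    and \<epsilon>: "\<epsilon> > 0" "\<And>v. norm v < \<epsilon> \<Longrightarrow> e v \<in> U \<and> norm (\<phi> (e v) - \<phi> p - v) \<le> norm v / 2"
  shows "surj e"
proof (rule ccontr)
  assume "\<not> surj e"
  then obtain q where q: "q \<notin> range e" by auto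
  have "missable e q"
    unfolding missable_def by (rule exI[of _ e], rule exI[of _ 0]) (use e q in simp)
  then have "missable e p" by (rule missable_everywhere[OF proper conn, rotated])
  then obtain g R where g: "homotopic_with_canon (\<lambda>g. \<forall>v. norm v \<ge> R \<longrightarrow> g v = e v) UNIV UNIV e g" "p \<notin> range g"
    unfolding missable_def by blast
  let ?P = "inv_into U \<phi>"
  obtain s0 where s0: "s0 > 0" "cball (\<phi> p) s0 \<subseteq> \<phi> ` U"
    using chart_image_open[OF U(1)] U(2) by (meson imageI open_contains_cball)
  have Pin: "?P x \<in> U" "\<phi> (?P x) = x" if "x \<in> cball (\<phi> p) s0" for x
    using that s0 U by (auto intro: inv_into_into simp: subset_iff f_inv_into_f)
  \<comment> \<open>The chart ball is shrunk until all its preimages under \<open>e\<close> lie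
    where the estimate at 0 holds. The vectors of norm at least \<epsilon> that land in the first
    ball form a compact set on which \<open>e\<close> avoids \<open>p\<close>, so their images keep
    a positive distance from \<open>p\<close>.\<close>
  obtain s where s: "s > 0" "s \<le> s0" "\<And>v. e v \<in> ?P ` cball (\<phi> p) s \<Longrightarrow> norm v < \<epsilon>"
  proof -
    let ?B = "?P ` cball (\<phi> p) s0"
    let ?Q = "e -` ?B - ball 0 \<epsilon>"
    have B: "compact ?B" by (rule chart_ball_compact[OF U(1) s0(2)])
    have "closed (e -` ?B)"
      by (rule closed_vimage[OF compact_imp_closed[OF B] e])
    then have Q: "compact ?Q"
      using proper[OF B] by (auto simp: compact_eq_bounded_closed intro: bounded_subset)
    show ?thesis
    proof (cases "?Q = {}")
      case True
      have "norm v < \<epsilon>" if "e v \<in> ?B" for v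
      proof -
        have "v \<notin> ?Q" unfolding True by simp
        then show ?thesis using that by simp
      qed
      then show ?thesis by (rule that[OF s0(1) order_refl])
    next
      case False
      have "continuous_on ?Q (\<lambda>v. norm (\<phi> (e v) - \<phi> p))"
        by (intro continuous_intros continuous_on_compose2[OF chart_continuous[OF U(1)]] continuous_on_subset[OF e])
          (use Pin in auto)
      from continuous_attains_inf[OF Q False this] obtain v0 where
        v0: "v0 \<in> ?Q" "\<forall>v\<in>?Q. norm (\<phi> (e v0) - \<phi> p) \<le> norm (\<phi> (e v) - \<phi> p)" by (rule bexE)
      have "\<phi> (e v0) \<noteq> \<phi> p"
      proof
        assume "\<phi> (e v0) = \<phi> p"
        moreover have "e v0 \<in> U" using v0(1) Pin by auto
        ultimately have "e v0 = p" using U by (metis chart_inv)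
        then show False using e0 v0(1) \<epsilon>(1) by simp
      qed
      then have m: "norm (\<phi> (e v0) - \<phi> p) > 0" by simp
      define s where "s = min s0 (norm (\<phi> (e v0) - \<phi> p) / 2)"
      have ss: "s > 0" "s \<le> s0" "s < norm (\<phi> (e v0) - \<phi> p)"
        unfolding s_def using m s0(1) by linarith+
      show ?thesis
      proof (rule that[OF ss(1,2)])
        fix v assume "e v \<in> ?P ` cball (\<phi> p) s"
        then obtain x where x: "x \<in> cball (\<phi> p) s" "e v = ?P x" by auto
        then have x0: "x \<in> cball (\<phi> p) s0" using ss by auto
        then have "norm (\<phi> (e v) - \<phi> p) \<le> s" using x Pin(2) by (simp add: dist_norm norm_minus_commute)
        have "v \<notin> ?Q"
        proof
          assume "v \<in> ?Q"
          with v0(2) have "norm (\<phi> (e v0) - \<phi> p) \<le> norm (\<phi> (e v) - \<phi> p)" by (rule bspec)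
          with \<open>norm (\<phi> (e v) - \<phi> p) \<le> s\<close> ss(3) show False by linarith
        qed
        then show "norm v < \<epsilon>" using x x0 by auto
      qed
    qed
  qed
  let ?B = "?P ` cball (\<phi> p) s"
  have Us: "cball (\<phi> p) s \<subseteq> \<phi> ` U" using s0 s by (meson order_trans cball_subset_cball_iff subset_cball)
  have PinB: "z \<in> U" "\<phi> z \<in> cball (\<phi> p) s" if "z \<in> ?B" for z
    using that Pin s by auto
  have Pp: "?P (\<phi> p) = p" using U by simp
  \<comment> \<open>The denominator of the stereographic coordinate falls to 0 at the boundary. Thus
    \<open>C\<close> below sends the boundary of the chart ball, and everything outside, to the
    north pole, and only \<open>p\<close> to the south pole.\<close>
  define m where "m w = max 0 (s - norm w)" for w :: 'e
  have nz: "w \<noteq> 0 \<or> m w \<noteq> 0" "m w \<ge> 0" for w using s(1) by (auto simp: m_def)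
  have cm: "continuous_on S m" for S unfolding m_def by (intro continuous_intros)
  define C where "C z = (if z \<in> ?B then stereo (\<phi> z - \<phi> p) (m (\<phi> z - \<phi> p)) else (0, 1))" for z
  have CB: "C z = stereo (\<phi> z - \<phi> p) (m (\<phi> z - \<phi> p))" if "z \<in> ?B" for z
    using that by (simp only: C_def if_True)
  have Cout: "C z = (0, 1)" if "z \<notin> ?B" for z
    using that by (simp only: C_def if_False)
  have "continuous_on ({0..1} \<times> UNIV) (\<lambda>z :: real \<times> 'm. if snd z \<in> ?B then
      (\<lambda>z. stereo (snd z - \<phi> p) (m (snd z - \<phi> p))) (fst z, \<phi> (snd z)) else (0 :: 'e, 1 :: real))"
  proof (rule continuous_on_chart_ball_paste[where g = "\<lambda>z. stereo (snd z - \<phi> p) (m (snd z - \<phi> p))"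
        and k = "\<lambda>z. (0, 1)", OF U(1) Us])
    show "continuous_on ({0..1} \<times> cball (\<phi> p) s) (\<lambda>z. stereo (snd z - \<phi> p) (m (snd z - \<phi> p)))"
      by (rule continuous_on_stereo)
        (use nz in \<open>auto intro!: continuous_intros continuous_on_compose2[OF cm[of UNIV]]\<close>)
    show "(\<lambda>z. stereo (snd z - \<phi> p) (m (snd z - \<phi> p))) (t, x) = (0, 1)"
      if "t \<in> {0..1}" "x \<in> sphere (\<phi> p) s" for t :: real and x
      using that s(1) by (auto simp: m_def dist_norm norm_minus_commute intro!: stereo_pole)
  qed simp
  then have cC: "continuous_on ({0..1} \<times> UNIV) (\<lambda>z :: real \<times> 'm. C (snd z))"
    unfolding snd_conv C_def .
  have nC: "norm (C z) = 1" for z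
    unfolding C_def by (simp only: norm_stereo[OF nz(1)] split: if_split) (simp add: norm_Pair)
  have Csouth: "z = p" if "C z = (0, -1)" for z
  proof -
    have z: "z \<in> ?B"
    proof (rule ccontr)
      assume "z \<notin> ?B"
      from Cout[OF this] that show False by simp
    qed
    with that CB[OF z] have "stereo (\<phi> z - \<phi> p) (m (\<phi> z - \<phi> p)) = (0, -1)" by simp
    then have "\<phi> z - \<phi> p = 0" by (rule stereo_eq_south[OF _ nz(1)])
    then show ?thesis using PinB(1)[OF z] U by (metis chart_inv right_minus_eq)
  qed
  obtain H :: "real \<times> 'e \<Rightarrow> 'm" where H1: "continuous_on ({0..1} \<times> UNIV) H"
    and H: "\<forall>x. H (0, x) = e x" "\<forall>x. H (1, x) = g x" "\<forall>t\<in>{0..1}. \<forall>v. norm v \<ge> R \<longrightarrow> H (t, v) = e v"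
    using homotopic_with_canonD[OF g(1)] by (elim exE conjE)
  define F where "F = (\<lambda>z. C (H z))"
  have "continuous_on ({0..1} \<times> UNIV) (\<lambda>z. C (snd (fst z, H z)))"
    by (rule continuous_on_compose2[OF cC continuous_on_Pair[OF continuous_on_fst[OF continuous_on_id] H1]]) auto
  then have cF: "continuous_on ({0..1} \<times> UNIV) F"
    unfolding F_def snd_conv .
  have Ffar: "F (t, v) = (0, 1)" if "t \<in> {0..1}" "norm v \<ge> max R \<epsilon>" for t v
  proof -
    have "H (t, v) = e v" using H(3) that by simp
    moreover have "e v \<notin> ?B" using s(3)[of v] that(2) by auto
    ultimately show ?thesis using Cout by (simp add: F_def)
  qed
  let ?F = "\<lambda>(t, y). if snd y = 1 then (0, 1) else F (t, (1 / (1 - snd y)) *\<^sub>R fst y)"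
  have cFs: "continuous_on ({0..1} \<times> sphere 0 1) ?F"
    by (rule sphere_extension_continuous[OF cF Ffar])
  have nF: "norm (?F (t, y)) = 1" for t y using nC by (auto simp: F_def norm_Pair)
  let ?F0 = "\<lambda>y. ?F (0, y)" and ?F1 = "\<lambda>y. ?F (1, y)"
  let ?S = "sphere (0 :: 'e \<times> real) 1"
  have "homotopic_with_canon (\<lambda>_. True) ?S ?S ?F0 ?F1"
    by (rule homotopic_with_canonI[OF cFs]) (use nF in auto)
  \<comment> \<open>As \<open>g\<close> misses \<open>p\<close>, the map at time 1 misses the south
    pole and is nowhere antipodal to the constant north pole.\<close>
  moreover have "homotopic_with_canon (\<lambda>_. True) ?S ?S ?F1 (\<lambda>y. (0, 1))"
  proof (rule nonantipodal_imp_homotopic)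
    show "continuous_on ?S ?F1"
      by (rule continuous_on_compose2[OF cFs, of _ "\<lambda>y. (1, y)"]) (auto intro!: continuous_intros)
    have "C (g v) \<noteq> (0, -1)" for v
    proof
      assume "C (g v) = (0, -1)"
      then have "g v = p" by (rule Csouth)
      then show False using g(2) by (metis rangeI)
    qed
    then have "F (1, v) \<noteq> (0, -1)" for v
      unfolding F_def H(2)[rule_format] .
    then show "?F1 y \<noteq> - (0, 1)" for y by simp
  qed (use nF in \<open>auto simp: norm_Pair\<close>)
  moreover have "homotopic_with_canon (\<lambda>_. True) ?S ?S ?F0 id"
  proof -
    \<comment> \<open>An antipodal value would have to occur inside the chart ball with v = 0, or
      outside it at the south pole, again with v = 0; but 0 is sent to \<open>p\<close>, which lies
      inside and goes to the south pole itself.\<close>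
    have key: "?F0 y \<noteq> - y" if y: "y \<in> ?S" for y
    proof
      assume a: "?F0 y = - y"
      show False
      proof (cases "snd y = 1")
        case True
        then have "(0, 1) = - y" using a by simp
        then have "1 = - snd y" by (metis snd_conv snd_uminus)
        then show False using True by simp
      next
        case False
        define v where "v = (1 / (1 - snd y)) *\<^sub>R fst y"
        have yv: "y = stereo v 1" using stereo_inverse[OF y False] by (simp add: v_def)
        have "?F0 y = F (0, v)" using False by (simp add: v_def)
        also have "\<dots> = C (e v)" using H(1) by (simp add: F_def)
        finally have Fv: "C (e v) = - stereo v 1" using a yv by simp
        show False
        proof (cases "e v \<in> ?B")
          case True
          let ?w = "\<phi> (e v) - \<phi> p"
          have "norm (?w - v) \<le> norm v / 2" using \<epsilon>(2)[OF s(3)[OF True]] by (rule conjunct2)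
          then have "norm (?w - v) \<le> norm v" using norm_ge_zero[of v] by linarith
          \<comment> \<open>Expanding the square turns closeness of \<open>?w\<close> to
            \<open>v\<close> into a nonnegative inner product, which is the hypothesis of
            \<open>stereo_eq_uminus_stereo_1\<close>.\<close>
          then have "(norm (?w - v))\<^sup>2 \<le> (norm v)\<^sup>2" by (rule power_mono) simp
          moreover have "(norm (?w - v))\<^sup>2 = ?w \<bullet> ?w - 2 * (v \<bullet> ?w) + (norm v)\<^sup>2"
            by (simp add: power2_norm_eq_inner inner_diff_left inner_diff_right inner_commute)
          ultimately have "v \<bullet> ?w \<ge> 0" using inner_ge_zero[of ?w] by linarith
          with nz(2) have v: "v = 0"
            by (rule stereo_eq_uminus_stereo_1[OF Fv[unfolded CB[OF True]] nz(1)])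
          then have "e v = p" using e0 by simp
          then have "C (e v) = stereo 0 (m 0)" using CB[OF True] by simp
          moreover have "m 0 \<noteq> 0" using s(1) by (simp add: m_def)
          ultimately have "C (e v) = (0, -1)" by (simp add: stereo_zero)
          then show False using Fv v by (simp add: stereo_zero)
        next
          case nB: False
          then have "- stereo v 1 = (0, 1)" using Fv Cout[OF nB] by simp
          then have "stereo v 1 = - (0, 1)" by (metis add.inverse_inverse)
          then have "stereo v 1 = (0, -1)" by simp
          then have "v = 0" by (rule stereo_eq_south) simp
          then have "e v = p" using e0 by simp
          then show False using nB Pp s(1) by (metis centre_in_cball imageI less_imp_le)
        qed
      qed
    qed
    \<comment> \<open>\<open>nonantipodal_imp_homotopic\<close> asks for unit norm at every
      argument, so both maps get the value (0, 1) off the sphere.\<close>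
    let ?f = "\<lambda>y. if y \<in> ?S then ?F0 y else (0, 1)" and ?i = "\<lambda>y. if y \<in> ?S then y else (0, 1)"
    have "homotopic_with_canon (\<lambda>_. True) ?S ?S ?f ?i"
    proof (rule nonantipodal_imp_homotopic)
      have "continuous_on ?S ?F0"
        by (rule continuous_on_compose2[OF cFs, of _ "\<lambda>y. (0, y)"]) (auto intro!: continuous_intros)
      then show "continuous_on ?S ?f" by (rule continuous_on_eq) simp
      show "continuous_on ?S ?i" by (rule continuous_on_eq[OF continuous_on_id]) simp
      show "norm (?f x) = 1" for x using nF[of 0 x] by (auto simp: norm_Pair)
      show "norm (?i x) = 1" for x by (auto simp: norm_Pair)
      show "?f x \<noteq> - ?i x" for x using key[of x] by auto
    qed
    then show ?thesis
      by (rule homotopic_with_eq) auto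
  qed
  ultimately have "homotopic_with_canon (\<lambda>_. True) ?S ?S id (\<lambda>y. (0, 1))"
    using homotopic_with_trans homotopic_with_symD by blast
  then have "contractible ?S" unfolding contractible_def by blast
  then show False by (simp add: contractible_sphere)
qed

end

subsection \<open>Geodesics\<close>

context smooth_manifold
begin

lemma smooth_functions_continuous:
  assumes h: "h \<in> smooth_functions A"
  shows "continuous_on UNIV h"
proof -
  have "isCont h p" for p
  proof -
    obtain U \<phi> where U: "(U, \<phi>) \<in> A" "p \<in> U" using chart_cover by blast
    have "continuous_on U (\<lambda>q. h (inv_into U \<phi> (\<phi> q)))"
      by (rule continuous_on_compose2[OF smooth_on_imp_continuous_on[OF smooth_in_chart[OF h U(1)]] chart_continuous[OF U(1)]]) simp
    then have "continuous_on U h"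
      by (rule continuous_on_eq) (use U in simp)
    then show ?thesis using chart_open[OF U(1)] U(2) continuous_on_eq_continuous_at by blast
  qed
  then show ?thesis by (simp add: continuous_on_eq_continuous_at)
qed

lemma smooth_curve_vimage_open:
  "smooth_curve_on A I \<gamma> \<Longrightarrow> open I \<Longrightarrow> open W \<Longrightarrow> open {s \<in> I. \<gamma> s \<in> W}"
  using continuous_open_preimage[of I \<gamma> W] unfolding smooth_curve_on_def Int_def vimage_def by simp

lemma smooth_curve_chart:
  assumes "smooth_curve_on A I \<gamma>" "(U, \<phi>) \<in> A"
  shows "smooth_on {s \<in> I. \<gamma> s \<in> U} (\<phi> \<circ> \<gamma>)"
  using assms by (auto simp: smooth_curve_on_def)

lemma smooth_function_along_curve:
  assumes \<gamma>: "smooth_curve_on A I \<gamma>" and I: "open I" and h: "h \<in> smooth_functions A"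
  shows "smooth_on I (\<lambda>s. h (\<gamma> s))"
proof (rule smooth_on_local[OF I])
  fix t assume t: "t \<in> I"
  obtain U \<phi> where U: "(U, \<phi>) \<in> A" "\<gamma> t \<in> U" using chart_cover by blast
  let ?N = "{s \<in> I. \<gamma> s \<in> U}"
  have N: "open ?N" by (rule smooth_curve_vimage_open[OF \<gamma> I chart_open[OF U(1)]])
  have *: "smooth_on ?N (\<lambda>s. h (inv_into U \<phi> ((\<phi> \<circ> \<gamma>) s)))"
    by (rule smooth_on_compose[OF N chart_image_open[OF U(1)] _ smooth_curve_chart[OF \<gamma> U(1)] smooth_in_chart[OF h U(1)]]) auto
  have "h (\<gamma> s) = h (inv_into U \<phi> ((\<phi> \<circ> \<gamma>) s))" if "s \<in> ?N" for s
    using that U by simp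
  then have "smooth_on ?N (\<lambda>s. h (\<gamma> s)) \<longleftrightarrow> smooth_on ?N (\<lambda>s. h (inv_into U \<phi> ((\<phi> \<circ> \<gamma>) s)))"
    by (rule smooth_on_cong)
  with * have "smooth_on ?N (\<lambda>s. h (\<gamma> s))" by simp
  then show "\<exists>N. open N \<and> t \<in> N \<and> N \<subseteq> I \<and> smooth_on N (\<lambda>s. h (\<gamma> s))"
    using N t U by (intro exI[of _ ?N]) auto
qed

end

definition curve_state :: "('m \<Rightarrow> 'e) \<Rightarrow> (real \<Rightarrow> 'm) \<Rightarrow> real \<Rightarrow> 'e \<times> 'e::real_normed_vector" where
  "curve_state \<phi> \<gamma> t = (\<phi> (\<gamma> t), vector_derivative (\<phi> \<circ> \<gamma>) (at t))"

context manifold_connection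
begin

lemma geodesic_on_smooth_curve: "geodesic_on A D I \<gamma> \<Longrightarrow> smooth_curve_on A I \<gamma>"
  by (simp add: geodesic_on_def)

text \<open>The witnesses of the definition are rescaled directly, without charts: the field and the
  coefficients are each multiplied by \<open>a\<close>, and the covariant derivative by its square.
  With a = -1 this reverses a geodesic, with a = 1 it shifts time.\<close>

lemma geodesic_affine:
  assumes \<gamma>: "geodesic_on A D UNIV \<gamma>"
  shows "geodesic_on A D UNIV (\<lambda>t. \<gamma> (a * t + b))"
proof -
  let ?l = "\<lambda>t :: real. a * t + b" and ?\<gamma> = "\<lambda>t. \<gamma> (a * t + b)"
  have sc: "smooth_curve_on A UNIV \<gamma>" by (rule geodesic_on_smooth_curve[OF \<gamma>])
  then have c\<gamma>: "continuous_on UNIV \<gamma>" by (simp add: smooth_curve_on_def)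
  have cl: "continuous_on S ?l" for S by (intro continuous_intros)
  have ol: "open {t. ?l t \<in> T}" if "open T" for T
    using open_vimage[OF that cl[of UNIV]] by (simp add: vimage_def)
  have dl: "(?l has_vector_derivative a) (at t)" for t
    by (auto intro!: derivative_eq_intros)
  have sl: "smooth_on S ?l" if "open S" for S
    by (rule smooth_on_add[OF that smooth_on_linear_compose[OF that bounded_linear_mult_right smooth_on_id[OF that]] smooth_on_const[OF that]])
  have chain: "((\<lambda>t. k (?l t)) has_vector_derivative a *\<^sub>R d) (at t)"
    if "(k has_vector_derivative d) (at (?l t))" for k :: "real \<Rightarrow> real" and d t
    using vector_diff_chain_at[OF dl that] by (simp add: o_def)
  have "smooth_on {t \<in> UNIV. ?\<gamma> t \<in> U} (\<phi> \<circ> ?\<gamma>)" if U: "(U, \<phi>) \<in> A" for U \<phi>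
  proof -
    have oN: "open {s \<in> UNIV. \<gamma> s \<in> U}" by (rule smooth_curve_vimage_open[OF sc open_UNIV chart_open[OF U]])
    have "open {t \<in> UNIV. ?\<gamma> t \<in> U}" using ol[OF oN] by simp
    from smooth_on_compose[OF this oN _ sl[OF this] smooth_curve_chart[OF sc U]]
    show ?thesis by (auto simp: o_def)
  qed
  then have "smooth_curve_on A UNIV ?\<gamma>"
    unfolding smooth_curve_on_def using continuous_on_compose2[OF c\<gamma> cl] by auto
  moreover have "has_covariant_derivative_along A D UNIV ?\<gamma> (velocity UNIV ?\<gamma>) t (\<lambda>_. 0)" for t
  proof -
    have "has_covariant_derivative_along A D UNIV \<gamma> (velocity UNIV \<gamma>) (?l t) (\<lambda>_. 0)"
      using \<gamma> by (simp add: geodesic_on_def)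
    then obtain X T n k Y where X: "X \<in> vector_fields A"
      and Xv0: "\<forall>h\<in>smooth_functions A. X h (\<gamma> (?l t)) = velocity UNIV \<gamma> (?l t) h"
      and T: "openin (top_of_set UNIV) T" "?l t \<in> T"
      and kY0: "\<forall>j<(n::nat). smooth_on T (k j) \<and> Y j \<in> vector_fields A"
      and V0: "\<forall>s\<in>T. \<forall>h\<in>smooth_functions A. velocity UNIV \<gamma> s h = (\<Sum>j<n. k j s * Y j h (\<gamma> s))"
      and W0: "\<forall>h\<in>smooth_functions A.
           0 = (\<Sum>j<n. vector_derivative (k j) (at (?l t)) * Y j h (\<gamma> (?l t)) + k j (?l t) * D X (Y j) h (\<gamma> (?l t)))"
      unfolding has_covariant_derivative_along_def by (elim bexE exE conjE)
    note Xv = Xv0[rule_format] and kY = kY0[rule_format] and V = V0[rule_format] and W = W0[rule_format]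
    have oT: "open T" using T by simp
    have vel: "velocity UNIV ?\<gamma> s h = a * velocity UNIV \<gamma> (?l s) h" if h: "h \<in> smooth_functions A" for s h
      unfolding velocity_def
      using chain[OF smooth_on_vector_derivative(2)[OF smooth_function_along_curve[OF sc open_UNIV h] open_UNIV UNIV_I]]
      by (simp add: o_def vector_derivative_at)
    let ?X = "vf_scale A (\<lambda>_. a) X" and ?T = "{s. ?l s \<in> T}" and ?k = "\<lambda>j s. a * k j (?l s)"
    have oT': "open ?T" by (rule ol[OF oT])
    show ?thesis
      unfolding has_covariant_derivative_along_def
    proof (intro bexI[of _ ?X] exI[of _ ?T] exI[of _ n] exI[of _ ?k] exI[of _ Y] conjI ballI allI impI)
      show "?X \<in> vector_fields A" by (rule vf_scale_vector_field[OF smooth_functions_const X])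
      show "?X h (?\<gamma> t) = velocity UNIV ?\<gamma> t h" if "h \<in> smooth_functions A" for h
        using that by (simp add: vel Xv vf_scale_def)
      show "openin (top_of_set UNIV) ?T" "t \<in> ?T" using oT' T(2) by simp_all
      show "Y j \<in> vector_fields A" if "j < n" for j using kY[OF that] by simp
      show "smooth_on ?T (?k j)" if "j < n" for j
        by (rule smooth_on_mult[OF oT' smooth_on_const[OF oT'] smooth_on_compose[OF oT' oT _ sl[OF oT']]])
          (use kY[OF that] in auto)
      show "velocity UNIV ?\<gamma> s h = (\<Sum>j<n. ?k j s * Y j h (?\<gamma> s))"
        if "s \<in> ?T" "h \<in> smooth_functions A" for s h
        using that by (simp add: vel V sum_distrib_left mult.assoc)
      fix h assume h: "h \<in> smooth_functions A"
      have dk: "vector_derivative (?k j) (at t within UNIV) = a * a * vector_derivative (k j) (at (?l t))" if "j < n" for j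
      proof -
        have "(k j has_vector_derivative vector_derivative (k j) (at (?l t))) (at (?l t))"
          by (rule smooth_on_vector_derivative(2)[OF _ oT T(2)]) (use kY[OF that] in simp)
        from has_vector_derivative_mult_right[OF chain[OF this], of a] show ?thesis
          by (simp add: vector_derivative_at mult.assoc)
      qed
      have "(\<Sum>j<n. vector_derivative (?k j) (at t within UNIV) * Y j h (?\<gamma> t) + ?k j t * D ?X (Y j) h (?\<gamma> t))
        = (\<Sum>j<n. (a * a) * (vector_derivative (k j) (at (?l t)) * Y j h (\<gamma> (?l t)) + k j (?l t) * D X (Y j) h (\<gamma> (?l t))))"
      proof (rule sum.cong[OF refl])
        fix j assume "j \<in> {..<n}"
        then have j: "j < n" "Y j \<in> vector_fields A" using kY by auto
        show "vector_derivative (?k j) (at t within UNIV) * Y j h (?\<gamma> t) + ?k j t * D ?X (Y j) h (?\<gamma> t)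
          = (a * a) * (vector_derivative (k j) (at (?l t)) * Y j h (\<gamma> (?l t)) + k j (?l t) * D X (Y j) h (\<gamma> (?l t)))"
          unfolding dk[OF j(1)] D_scale(1)[OF X j(2) smooth_functions_const h] by (simp add: algebra_simps)
      qed
      then show "0 = (\<Sum>j<n. vector_derivative (?k j) (at t within UNIV) * Y j h (?\<gamma> t) + ?k j t * D ?X (Y j) h (?\<gamma> t))"
        using W[OF h] by (simp add: sum_distrib_left[symmetric])
    qed
  qed
  ultimately show ?thesis by (simp add: geodesic_on_def)
qed

text \<open>\<open>g_convex\<close> concerns geodesics on \<open>{0..1}\<close>, where all
  derivatives are taken within the interval. The same witnesses work after restriction.\<close>

lemma geodesic_restrict_unit_interval:
  assumes \<gamma>: "geodesic_on A D UNIV \<gamma>"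
  shows "geodesic_on A D {0..1} \<gamma>"
proof -
  have sc: "smooth_curve_on A UNIV \<gamma>" by (rule geodesic_on_smooth_curve[OF \<gamma>])
  \<comment> \<open>A relatively open part of \<open>{0..1}\<close> has no isolated points, so
    derivatives within it are unique.\<close>
  have lim: "at x within T \<inter> {0..1} \<noteq> bot" if "open T" "x \<in> T \<inter> {0..1}" for x :: real and T
  proof -
    have "at x within T \<inter> {0..1} = at x within {0..1}"
      by (rule at_within_nhd[of x T]) (use that in auto)
    moreover have "x islimpt {0..1}"
      by (rule connected_imp_perfect) (use that in auto)
    ultimately show ?thesis using trivial_limit_within[of x "{0..1}"] by (simp add: trivial_limit_def)
  qed
  have vd: "vector_derivative k (at t within {0..1}) = vector_derivative k (at t)"
    if "t \<in> {0..1}" "smooth_on T k" "open T" "t \<in> T" for k :: "real \<Rightarrow> real" and t T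
    using vector_derivative_at_within_ivl[OF smooth_on_vector_derivative(2)[OF that(2-4)], of 0 1] that(1) by simp
  have vel: "velocity {0..1} \<gamma> t h = velocity UNIV \<gamma> t h" if "t \<in> {0..1}" "h \<in> smooth_functions A" for t h
    unfolding velocity_def o_def
    by (rule vd[OF that(1) smooth_function_along_curve[OF sc open_UNIV that(2)]]) simp_all
  have "smooth_on {t \<in> {0..1}. \<gamma> t \<in> U} (\<phi> \<circ> \<gamma>)" if U: "(U, \<phi>) \<in> A" for U \<phi>
  proof -
    have oN: "open {s \<in> UNIV. \<gamma> s \<in> U}" by (rule smooth_curve_vimage_open[OF sc open_UNIV chart_open[OF U]])
    have eq: "{t \<in> {0..1}. \<gamma> t \<in> U} = {s \<in> UNIV. \<gamma> s \<in> U} \<inter> {0..1}" by auto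
    show ?thesis unfolding eq
      by (rule smooth_on_subset_real[OF oN smooth_curve_chart[OF sc U] _ lim[OF oN]]) auto
  qed
  then have "smooth_curve_on A {0..1} \<gamma>"
    using sc continuous_on_subset by (fastforce simp: smooth_curve_on_def)
  moreover have "has_covariant_derivative_along A D {0..1} \<gamma> (velocity {0..1} \<gamma>) t (\<lambda>_. 0)" if t: "t \<in> {0..1}" for t
  proof -
    have "has_covariant_derivative_along A D UNIV \<gamma> (velocity UNIV \<gamma>) t (\<lambda>_. 0)"
      using \<gamma> by (simp add: geodesic_on_def)
    then obtain X T n k Y where X: "X \<in> vector_fields A"
      and Xv0: "\<forall>h\<in>smooth_functions A. X h (\<gamma> t) = velocity UNIV \<gamma> t h"
      and T: "openin (top_of_set UNIV) T" "t \<in> T"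
      and kY0: "\<forall>j<(n::nat). smooth_on T (k j) \<and> Y j \<in> vector_fields A"
      and V0: "\<forall>s\<in>T. \<forall>h\<in>smooth_functions A. velocity UNIV \<gamma> s h = (\<Sum>j<n. k j s * Y j h (\<gamma> s))"
      and W0: "\<forall>h\<in>smooth_functions A.
           0 = (\<Sum>j<n. vector_derivative (k j) (at t) * Y j h (\<gamma> t) + k j t * D X (Y j) h (\<gamma> t))"
      unfolding has_covariant_derivative_along_def by (elim bexE exE conjE)
    note Xv = Xv0[rule_format] and kY = kY0[rule_format] and V = V0[rule_format] and W = W0[rule_format]
    have oT: "open T" using T by simp
    show ?thesis
      unfolding has_covariant_derivative_along_def
    proof (intro bexI[of _ X] exI[of _ "T \<inter> {0..1}"] exI[of _ n] exI[of _ k] exI[of _ Y] conjI ballI allI impI)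
      show "X h (\<gamma> t) = velocity {0..1} \<gamma> t h" if "h \<in> smooth_functions A" for h
        using that t by (simp add: vel Xv)
      show "openin (top_of_set {0..1}) (T \<inter> {0..1})" using oT by (metis inf_commute openin_open_Int)
      show "smooth_on (T \<inter> {0..1}) (k j)" if "j < n" for j
        by (rule smooth_on_subset_real[OF oT _ _ lim[OF oT]]) (use kY[OF that] in auto)
      show "Y j \<in> vector_fields A" if "j < n" for j using kY[OF that] by simp
      show "velocity {0..1} \<gamma> s h = (\<Sum>j<n. k j s * Y j h (\<gamma> s))"
        if "s \<in> T \<inter> {0..1}" "h \<in> smooth_functions A" for s h
        using that by (simp add: vel V)
      fix h assume h: "h \<in> smooth_functions A"
      have "vector_derivative (k j) (at t within {0..1}) = vector_derivative (k j) (at t)" if "j < n" for j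
        by (rule vd[OF t _ oT T(2)]) (use kY[OF that] in simp)
      then show "0 = (\<Sum>j<n. vector_derivative (k j) (at t within {0..1}) * Y j h (\<gamma> t) + k j t * D X (Y j) h (\<gamma> t))"
        using W[OF h] by simp
    qed (use X t T in auto)
  qed
  ultimately show ?thesis by (simp add: geodesic_on_def)
qed

lemma exists_chart_ball:
  obtains U \<phi> r \<beta> where "chart_ball_connection A U \<phi> (\<phi> p) r \<beta> D" "p \<in> U"
proof -
  obtain U \<phi> where U: "(U, \<phi>) \<in> A" "p \<in> U" using chart_cover by blast
  obtain e where e: "e > 0" "cball (\<phi> p) e \<subseteq> \<phi> ` U"
    using chart_image_open[OF U(1)] U(2) by (meson imageI open_contains_cball)
  define r where "r = e / 3"
  have r: "r > 0" "cball (\<phi> p) (3 * r) \<subseteq> \<phi> ` U" using e by (simp_all add: r_def)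
  obtain \<beta> :: "'e \<Rightarrow> real" where \<beta>: "smooth_on UNIV \<beta>" "\<And>x. x \<in> cball (\<phi> p) r \<Longrightarrow> \<beta> x = 1"
    "\<And>x. x \<notin> ball (\<phi> p) (2 * r) \<Longrightarrow> \<beta> x = 0"
    by (rule bump_exists[OF r(1), of "\<phi> p"]) blast
  have "chart_ball_connection A U \<phi> (\<phi> p) r \<beta> D"
    by unfold_locales (use U r \<beta> in auto)
  then show ?thesis by (rule that[OF _ U(2)])
qed

end

section \<open>The geodesic equation as a first-order system\<close>

context chart_ball_connection
begin

definition core :: "'m set" where
  "core = {p \<in> U. \<phi> p \<in> ball c r}"

definition spray :: "'e \<times> 'e \<Rightarrow> 'e \<times> 'e" where
  "spray z = (snd z, - christoffel (fst z) (snd z) (snd z))"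

lemma open_core: "open core"
  unfolding core_def by (rule chart_vimage_open[OF U open_ball])

lemma coreD: "p \<in> core \<Longrightarrow> p \<in> U" "p \<in> core \<Longrightarrow> \<phi> p \<in> ball c r" "p \<in> core \<Longrightarrow> \<pi> (\<phi> p) = p"
  using U by (auto simp: core_def)

lemma core_image: "x \<in> ball c r \<Longrightarrow> \<pi> x \<in> core"
  by (simp add: core_def)

lemma smooth_on_spray: "smooth_on (ball c r \<times> UNIV) spray"
proof -
  let ?W = "ball c r \<times> (UNIV :: 'e set)"
  have W: "open ?W" by (intro open_Times open_ball open_UNIV)
  have f: "smooth_on ?W fst" and s: "smooth_on ?W snd"
    by (rule smooth_on_bounded_linear[OF W], rule bounded_linear_fst, rule smooth_on_bounded_linear[OF W], rule bounded_linear_snd)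
  have si: "smooth_on ?W (\<lambda>z. snd z \<bullet> i)" for i
    by (rule smooth_on_linear_compose[OF W bounded_linear_inner_left s])
  have C: "smooth_on ?W (\<lambda>z. components (D (coordinate_field i) (coordinate_field j)) (fst z))" for i j
    by (rule smooth_on_compose[OF W open_ball _ f smooth_on_christoffel]) auto
  have "smooth_on ?W (\<lambda>z. \<Sum>i\<in>Basis. \<Sum>j\<in>Basis. ((snd z \<bullet> i) * (snd z \<bullet> j)) *\<^sub>R
      components (D (coordinate_field i) (coordinate_field j)) (fst z))"
    by (rule smooth_on_sum[OF W], rule smooth_on_sum[OF W], rule smooth_on_scaleR[OF W smooth_on_mult[OF W si si] C])
  then have "smooth_on ?W (\<lambda>z. (snd z, - (\<Sum>i\<in>Basis. \<Sum>j\<in>Basis. ((snd z \<bullet> i) * (snd z \<bullet> j)) *\<^sub>R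
      components (D (coordinate_field i) (coordinate_field j)) (fst z))))"
    by (rule smooth_on_Pair[OF W s smooth_on_uminus[OF W]])
  moreover have "spray = (\<lambda>z. (snd z, - (\<Sum>i\<in>Basis. \<Sum>j\<in>Basis. ((snd z \<bullet> i) * (snd z \<bullet> j)) *\<^sub>R
      components (D (coordinate_field i) (coordinate_field j)) (fst z))))"
    by (simp add: spray_def christoffel_def fun_eq_iff)
  ultimately show ?thesis by (simp only:)
qed

lemma geodesic_imp_ode:
  assumes \<gamma>: "geodesic_on A D I \<gamma>" and I: "open I" and t: "t \<in> I" "\<gamma> t \<in> core"
  shows "(curve_state \<phi> \<gamma> has_vector_derivative spray (curve_state \<phi> \<gamma> t)) (at t)"
proof -
  have sc: "smooth_curve_on A I \<gamma>" by (rule geodesic_on_smooth_curve[OF \<gamma>])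
  have "has_covariant_derivative_along A D I \<gamma> (velocity I \<gamma>) t (\<lambda>_. 0)"
    using \<gamma> t by (simp add: geodesic_on_def)
  then have 2: "((\<lambda>s. vector_derivative (\<phi> \<circ> \<gamma>) (at s)) has_vector_derivative
      - christoffel (\<phi> (\<gamma> t)) (vector_derivative (\<phi> \<circ> \<gamma>) (at t)) (vector_derivative (\<phi> \<circ> \<gamma>) (at t))) (at t)"
    using geodesic_equation[OF sc I t(1) coreD(1,2)[OF t(2)]] by blast
  have 1: "((\<phi> \<circ> \<gamma>) has_vector_derivative vector_derivative (\<phi> \<circ> \<gamma>) (at t)) (at t)"
    by (rule smooth_on_vector_derivative(2)[OF smooth_curve_chart[OF sc U] smooth_curve_vimage_open[OF sc I chart_open[OF U]]])
      (use t coreD(1) in auto)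
  show ?thesis
    using has_vector_derivative_Pair[OF 1 2] by (simp add: curve_state_def[abs_def] spray_def o_def)
qed

text \<open>A solution is a priori only differentiable. \<open>ode_solution_smooth\<close> makes it
  smooth, and the transition maps carry this to every other chart.\<close>

lemma ode_imp_geodesic:
  assumes J: "open J" and u: "\<And>t. t \<in> J \<Longrightarrow> fst (u t) \<in> ball c r"
    "\<And>t. t \<in> J \<Longrightarrow> (u has_vector_derivative spray (u t)) (at t)"
  shows "geodesic_on A D J (\<lambda>t. \<pi> (fst (u t)))"
    and "\<And>t. t \<in> J \<Longrightarrow> curve_state \<phi> (\<lambda>t. \<pi> (fst (u t))) t = u t"
proof -
  let ?\<gamma> = "\<lambda>t. \<pi> (fst (u t))"
  have W: "open (ball c r \<times> (UNIV :: 'e set))" by (intro open_Times open_ball open_UNIV)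
  have us: "smooth_on J u"
    by (rule ode_solution_smooth[OF smooth_on_spray W J _ u(2)])
      (rule image_subsetI, simp only: mem_Times_iff UNIV_I simp_thms u(1))
  have x: "smooth_on J (\<lambda>t. fst (u t))" by (rule smooth_on_linear_compose[OF J bounded_linear_fst us])
  have im: "(\<lambda>t. fst (u t)) ` J \<subseteq> \<phi> ` U" using u(1) core_ball_in_chart by blast
  have cont: "continuous_on J ?\<gamma>"
    by (rule continuous_on_compose2[OF chart_inv_continuous[OF U] smooth_on_imp_continuous_on[OF x] im])
  have "smooth_on {t \<in> J. ?\<gamma> t \<in> V} (\<psi> \<circ> ?\<gamma>)" if V: "(V, \<psi>) \<in> A" for V \<psi>
  proof -
    have N: "open {t \<in> J. ?\<gamma> t \<in> V}"
      using continuous_open_preimage[OF cont J chart_open[OF V]] by (simp add: Int_def vimage_def)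
    have UV: "open (\<phi> ` (U \<inter> V))"
      by (rule chart_image_open_subset[OF U]) (use chart_open U V in auto)
    have sub: "(\<lambda>t. fst (u t)) ` {t \<in> J. ?\<gamma> t \<in> V} \<subseteq> \<phi> ` (U \<inter> V)"
    proof
      fix y assume "y \<in> (\<lambda>t. fst (u t)) ` {t \<in> J. ?\<gamma> t \<in> V}"
      then obtain t where t: "t \<in> J" "?\<gamma> t \<in> V" "y = fst (u t)" by auto
      then show "y \<in> \<phi> ` (U \<inter> V)"
        using core_chart[OF u(1)[OF t(1)]] by (intro image_eqI[of _ _ "?\<gamma> t"]) auto
    qed
    show ?thesis
      using smooth_on_compose[OF N UV sub smooth_on_subset[OF x J N] chart_transition[OF U V]] by (auto simp: o_def)
  qed
  then have sc: "smooth_curve_on A J ?\<gamma>" using cont by (auto simp: smooth_curve_on_def)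
  have du: "((\<lambda>t. fst (u t)) has_vector_derivative snd (u t)) (at t)"
    "((\<lambda>t. snd (u t)) has_vector_derivative - christoffel (fst (u t)) (snd (u t)) (snd (u t))) (at t)" if "t \<in> J" for t
    using bounded_linear.has_vector_derivative[OF bounded_linear_fst u(2)[OF that]]
      bounded_linear.has_vector_derivative[OF bounded_linear_snd u(2)[OF that]] by (simp_all add: spray_def)
  have vd: "vector_derivative (\<phi> \<circ> ?\<gamma>) (at t) = snd (u t)" if t: "t \<in> J" for t
  proof -
    have "vector_derivative (\<phi> \<circ> ?\<gamma>) (at t) = vector_derivative (\<lambda>t. fst (u t)) (at t)"
      by (rule vector_derivative_cong_open[OF J t]) (simp only: o_def core_chart(2)[OF u(1)])
    then show ?thesis using vector_derivative_at[OF du(1)[OF t]] by simp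
  qed
  show "curve_state \<phi> ?\<gamma> t = u t" if "t \<in> J" for t
    using vd[OF that] u(1)[OF that] by (simp add: curve_state_def)
  show "geodesic_on A D J ?\<gamma>"
    unfolding geodesic_on_def
  proof (intro conjI ballI sc)
    fix t assume t: "t \<in> J"
    have "((\<lambda>s. vector_derivative (\<phi> \<circ> ?\<gamma>) (at s)) has_vector_derivative
        - christoffel (fst (u t)) (snd (u t)) (snd (u t))) (at t)"
      by (rule has_vector_derivative_transform_within_open[OF du(2)[OF t] J t]) (simp add: vd)
    then show "has_covariant_derivative_along A D J ?\<gamma> (velocity J ?\<gamma>) t (\<lambda>_. 0)"
      using geodesic_equation[OF sc J t] u(1)[OF t] by (simp add: vd[OF t])
  qed
qed

lemma derivative_along_curve:
  assumes \<gamma>: "smooth_curve_on A UNIV \<gamma>" and t: "\<gamma> t \<in> core" and h: "h \<in> smooth_functions A"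
  shows "vector_derivative (h \<circ> \<gamma>) (at t) =
    frechet_derivative (\<lambda>x. h (\<pi> x)) (at (fst (curve_state \<phi> \<gamma> t))) (snd (curve_state \<phi> \<gamma> t))"
  using vector_derivative_at[OF velocity_in_chart(1)[OF \<gamma> open_UNIV U UNIV_I coreD(1)[OF t] h]]
  by (simp add: curve_state_def)

lemma coordinate_derivative_along_curve:
  assumes "smooth_curve_on A UNIV \<gamma>" "\<gamma> t \<in> core"
  shows "vector_derivative (coordinate b \<circ> \<gamma>) (at t) = snd (curve_state \<phi> \<gamma> t) \<bullet> b"
  unfolding derivative_along_curve[OF assms coordinate_smooth]
  by (rule frechet_derivative_coordinate) (use coreD(2)[OF assms(2)] in \<open>simp add: curve_state_def\<close>)

lemma coordinate_core: "p \<in> core \<Longrightarrow> coordinate b p = \<phi> p \<bullet> b"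
  using coordinate_eq[OF coreD(2), of p b] coreD(3)[of p] by simp

text \<open>Turns membership in \<open>core\<close> into positivity of a smooth function, so that it
  can be read off from convergence tested on smooth functions.\<close>

lemma local_bump:
  assumes p: "p \<in> core"
  obtains \<theta> where "\<theta> \<in> smooth_functions A" "\<theta> p = 1" "\<And>q. \<theta> q \<noteq> 0 \<Longrightarrow> q \<in> core"
proof -
  obtain s where s: "s > 0" "cball (\<phi> p) s \<subseteq> ball c r"
    by (meson open_ball open_contains_cball coreD(2)[OF p])
  obtain \<theta>0 :: "'e \<Rightarrow> real" where \<theta>0: "smooth_on UNIV \<theta>0" "\<And>y. y \<in> cball (\<phi> p) (s / 2) \<Longrightarrow> \<theta>0 y = 1"
      "\<And>y. y \<notin> ball (\<phi> p) (2 * (s / 2)) \<Longrightarrow> \<theta>0 y = 0"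
    by (rule bump_exists[of "s / 2" "\<phi> p"]) (use s in \<open>auto\<close>)
  have K: "cball (\<phi> p) s \<subseteq> \<phi> ` U" using s core_ball_in_chart by blast
  have s\<theta>: "smooth_on (\<phi> ` U) \<theta>0" by (rule smooth_on_subset[OF \<theta>0(1) open_UNIV openU]) simp
  show ?thesis
  proof (rule that)
    show "extend_by_zero U \<phi> \<theta>0 \<in> smooth_functions A"
      by (rule extend_by_zero_smooth[OF U s\<theta> compact_cball K]) (use \<theta>0(3) in auto)
    show "extend_by_zero U \<phi> \<theta>0 p = 1"
      using coreD(1)[OF p] \<theta>0(2) s by (simp add: extend_by_zero_def)
    fix q assume "extend_by_zero U \<phi> \<theta>0 q \<noteq> 0"
    then have q: "q \<in> U" "\<theta>0 (\<phi> q) \<noteq> 0" by (auto simp: extend_by_zero_def split: if_splits)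
    then have "\<phi> q \<in> ball (\<phi> p) (2 * (s / 2))" using \<theta>0(3) by blast
    then have "\<phi> q \<in> cball (\<phi> p) s" by simp
    then show "q \<in> core" using q s(2) by (auto simp: core_def)
  qed
qed

lemma continuous_curve_state:
  assumes \<gamma>: "geodesic_on A D UNIV \<gamma>" and t: "\<gamma> t \<in> core"
  shows "isCont (curve_state \<phi> \<gamma>) t"
  by (rule has_vector_derivative_continuous[OF geodesic_imp_ode[OF \<gamma> open_UNIV UNIV_I t]])

end

subsection \<open>Dependence of geodesics on initial values\<close>

text \<open>Convergence of positions and velocities at time \<open>t\<close>, free of charts. In any
  chart around the limit it amounts to convergence of \<open>curve_state\<close> by the next two
  lemmas, so it can be handed from one chart to the next.\<close>

definition states_converge ::
    "('m, 'e::euclidean_space) chart set \<Rightarrow> 'w filter \<Rightarrow> ('w \<Rightarrow> real \<Rightarrow> 'm) \<Rightarrow> (real \<Rightarrow> 'm) \<Rightarrow> real \<Rightarrow> bool" where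
  "states_converge A \<F> G \<gamma> t \<longleftrightarrow> (\<forall>h\<in>smooth_functions A.
     ((\<lambda>w. h (G w t)) \<longlongrightarrow> h (\<gamma> t)) \<F> \<and>
     ((\<lambda>w. vector_derivative (h \<circ> G w) (at t)) \<longlongrightarrow> vector_derivative (h \<circ> \<gamma>) (at t)) \<F>)"

context chart_ball_connection
begin

text \<open>A bump function at the limit point forces the positions into the chart; after that the
  cut-off coordinate functions yield every component of position and velocity.\<close>

lemma states_converge_imp_chart:
  assumes G: "\<And>w. smooth_curve_on A UNIV (G w)" and \<gamma>: "smooth_curve_on A UNIV \<gamma>"
    and t: "\<gamma> t \<in> core" and conv: "states_converge A \<F> G \<gamma> t"
  shows "\<forall>\<^sub>F w in \<F>. G w t \<in> core"
    and "((\<lambda>w. curve_state \<phi> (G w) t) \<longlongrightarrow> curve_state \<phi> \<gamma> t) \<F>"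
proof -
  obtain \<theta> where \<theta>: "\<theta> \<in> smooth_functions A" "\<theta> (\<gamma> t) = 1" "\<And>q. \<theta> q \<noteq> 0 \<Longrightarrow> q \<in> core"
    by (rule local_bump[OF t]) blast
  have "((\<lambda>w. \<theta> (G w t)) \<longlongrightarrow> 1) \<F>"
    using conv \<theta>(1,2) by (auto simp: states_converge_def)
  then have "\<forall>\<^sub>F w in \<F>. \<theta> (G w t) > 0" by (rule order_tendstoD(1)) simp
  then show ev: "\<forall>\<^sub>F w in \<F>. G w t \<in> core"
    by (rule eventually_mono) (use \<theta>(3) in force)
  have "((\<lambda>w. \<phi> (G w t)) \<longlongrightarrow> \<phi> (\<gamma> t)) \<F>"
    unfolding tendsto_componentwise_iff[of "\<lambda>w. \<phi> (G w t)"]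
  proof
    fix b :: 'e
    have "((\<lambda>w. coordinate b (G w t)) \<longlongrightarrow> coordinate b (\<gamma> t)) \<F>"
      using conv coordinate_smooth by (simp add: states_converge_def)
    then show "((\<lambda>w. \<phi> (G w t) \<bullet> b) \<longlongrightarrow> \<phi> (\<gamma> t) \<bullet> b) \<F>"
      unfolding coordinate_core[OF t]
      by (rule Lim_transform_eventually) (rule eventually_mono[OF ev coordinate_core])
  qed
  moreover have "((\<lambda>w. vector_derivative (\<phi> \<circ> G w) (at t)) \<longlongrightarrow> vector_derivative (\<phi> \<circ> \<gamma>) (at t)) \<F>"
    unfolding tendsto_componentwise_iff[of "\<lambda>w. vector_derivative (\<phi> \<circ> G w) (at t)"]
  proof
    fix b :: 'e
    have "((\<lambda>w. vector_derivative (coordinate b \<circ> G w) (at t)) \<longlongrightarrow> vector_derivative (coordinate b \<circ> \<gamma>) (at t)) \<F>"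
      using conv coordinate_smooth by (simp add: states_converge_def)
    then have "((\<lambda>w. vector_derivative (coordinate b \<circ> G w) (at t)) \<longlongrightarrow> snd (curve_state \<phi> \<gamma> t) \<bullet> b) \<F>"
      unfolding coordinate_derivative_along_curve[OF \<gamma> t] .
    then have "((\<lambda>w. snd (curve_state \<phi> (G w) t) \<bullet> b) \<longlongrightarrow> snd (curve_state \<phi> \<gamma> t) \<bullet> b) \<F>"
      by (rule Lim_transform_eventually)
        (rule eventually_mono[OF ev coordinate_derivative_along_curve[OF G]])
    then show "((\<lambda>w. vector_derivative (\<phi> \<circ> G w) (at t) \<bullet> b) \<longlongrightarrow> vector_derivative (\<phi> \<circ> \<gamma>) (at t) \<bullet> b) \<F>"
      by (simp add: curve_state_def)
  qed
  ultimately show "((\<lambda>w. curve_state \<phi> (G w) t) \<longlongrightarrow> curve_state \<phi> \<gamma> t) \<F>"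
    unfolding curve_state_def by (rule tendsto_Pair)
qed

lemma states_converge_from_chart:
  assumes G: "\<And>w. smooth_curve_on A UNIV (G w)" and \<gamma>: "smooth_curve_on A UNIV \<gamma>"
    and t: "\<gamma> t \<in> core" and ev: "\<forall>\<^sub>F w in \<F>. G w t \<in> core"
    and conv: "((\<lambda>w. curve_state \<phi> (G w) t) \<longlongrightarrow> curve_state \<phi> \<gamma> t) \<F>"
  shows "states_converge A \<F> G \<gamma> t"
  unfolding states_converge_def
proof (intro ballI conjI)
  fix h assume h: "h \<in> smooth_functions A"
  let ?z = "\<lambda>w. curve_state \<phi> (G w) t" and ?y = "curve_state \<phi> \<gamma> t"
  have f: "((\<lambda>w. fst (?z w)) \<longlongrightarrow> fst ?y) \<F>" and s: "((\<lambda>w. snd (?z w)) \<longlongrightarrow> snd ?y) \<F>"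
    by (rule tendsto_fst[OF conv], rule tendsto_snd[OF conv])
  have z0: "fst ?y \<in> \<phi> ` U" using coreD(1)[OF t] by (simp add: curve_state_def)
  have isC: "isCont g (fst ?y)" if "smooth_on (\<phi> ` U) g" for g :: "'e \<Rightarrow> real"
    using smooth_on_imp_continuous_on[OF that] openU z0 continuous_on_eq_continuous_at by blast
  have "((\<lambda>w. h (\<pi> (fst (?z w)))) \<longlongrightarrow> h (\<pi> (fst ?y))) \<F>"
    by (rule isCont_tendsto_compose[OF isC[OF smooth_in_chart[OF h U]] f])
  then have "((\<lambda>w. h (\<pi> (fst (?z w)))) \<longlongrightarrow> h (\<gamma> t)) \<F>"
    using coreD(3)[OF t] by (simp add: curve_state_def)
  then show "((\<lambda>w. h (G w t)) \<longlongrightarrow> h (\<gamma> t)) \<F>"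
  proof (rule Lim_transform_eventually)
    show "\<forall>\<^sub>F w in \<F>. h (\<pi> (fst (?z w))) = h (G w t)"
      by (rule eventually_mono[OF ev]) (simp add: curve_state_def coreD(3))
  qed
  have comp: "vector_derivative (h \<circ> \<sigma>) (at t) = (\<Sum>b\<in>Basis. (snd (curve_state \<phi> \<sigma> t) \<bullet> b) *\<^sub>R
      frechet_derivative (\<lambda>x. h (\<pi> x)) (at (fst (curve_state \<phi> \<sigma> t))) b)"
    if "smooth_curve_on A UNIV \<sigma>" "\<sigma> t \<in> core" for \<sigma>
    unfolding derivative_along_curve[OF that h]
    by (rule frechet_derivative_components[OF smooth_pullback_differentiable[OF h]])
      (use coreD(1)[OF that(2)] in \<open>simp add: curve_state_def\<close>)
  have "((\<lambda>w. \<Sum>b\<in>Basis. (snd (?z w) \<bullet> b) *\<^sub>R frechet_derivative (\<lambda>x. h (\<pi> x)) (at (fst (?z w))) b) \<longlongrightarrow>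
      (\<Sum>b\<in>Basis. (snd ?y \<bullet> b) *\<^sub>R frechet_derivative (\<lambda>x. h (\<pi> x)) (at (fst ?y)) b)) \<F>"
    by (rule tendsto_sum, rule tendsto_scaleR[OF tendsto_inner[OF s tendsto_const]],
        rule isCont_tendsto_compose[OF isC[OF smooth_on_frechet_derivative[OF smooth_in_chart[OF h U] openU]] f])
  then show "((\<lambda>w. vector_derivative (h \<circ> G w) (at t)) \<longlongrightarrow> vector_derivative (h \<circ> \<gamma>) (at t)) \<F>"
    unfolding comp[OF \<gamma> t]
    by (rule Lim_transform_eventually)
      (rule eventually_mono[OF ev], rule comp[OF G, symmetric])
qed

end

section \<open>Uniqueness of geodesics\<close>

context manifold_connection
begin

definition same_state :: "(real \<Rightarrow> 'm) \<Rightarrow> (real \<Rightarrow> 'm) \<Rightarrow> real \<Rightarrow> bool" where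
  "same_state \<gamma> \<sigma> t \<longleftrightarrow> \<gamma> t = \<sigma> t \<and>
     (\<forall>h\<in>smooth_functions A. vector_derivative (h \<circ> \<gamma>) (at t) = vector_derivative (h \<circ> \<sigma>) (at t))"

end

lemma (in chart_ball_connection) same_state_iff:
  assumes "smooth_curve_on A UNIV \<gamma>" "smooth_curve_on A UNIV \<sigma>" "\<gamma> t \<in> core" "\<sigma> t \<in> core"
  shows "same_state \<gamma> \<sigma> t \<longleftrightarrow> curve_state \<phi> \<gamma> t = curve_state \<phi> \<sigma> t"
proof
  assume s: "same_state \<gamma> \<sigma> t"
  have "snd (curve_state \<phi> \<gamma> t) = snd (curve_state \<phi> \<sigma> t)"
  proof (rule euclidean_eqI)
    fix b :: 'e
    show "snd (curve_state \<phi> \<gamma> t) \<bullet> b = snd (curve_state \<phi> \<sigma> t) \<bullet> b"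
      using s coordinate_smooth[of b] coordinate_derivative_along_curve[OF assms(1,3), of b]
        coordinate_derivative_along_curve[OF assms(2,4), of b] by (simp add: same_state_def)
  qed
  then show "curve_state \<phi> \<gamma> t = curve_state \<phi> \<sigma> t"
    using s by (simp add: curve_state_def same_state_def)
next
  assume s: "curve_state \<phi> \<gamma> t = curve_state \<phi> \<sigma> t"
  then have "\<phi> (\<gamma> t) = \<phi> (\<sigma> t)" by (simp add: curve_state_def)
  then have "\<gamma> t = \<sigma> t" using coreD(3)[OF assms(3)] coreD(3)[OF assms(4)] by metis
  then show "same_state \<gamma> \<sigma> t"
    using derivative_along_curve[OF assms(1,3)] derivative_along_curve[OF assms(2,4)] s
    by (simp add: same_state_def)
qed

context manifold_connection
begin

text \<open>Agreement of states is locally constant in time. Distinct positions stay distinct nearby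
  by the Hausdorff property, distinct velocities by continuity of the states in a chart, and equal
  states stay equal by Gronwall.\<close>

lemma geodesic_unique:
  assumes \<gamma>: "geodesic_on A D UNIV \<gamma>" and \<sigma>: "geodesic_on A D UNIV \<sigma>" and s: "same_state \<gamma> \<sigma> s"
  shows "\<gamma> = \<sigma>"
proof
  note sc = geodesic_on_smooth_curve[OF \<gamma>] geodesic_on_smooth_curve[OF \<sigma>]
  have pre: "open {t. \<gamma> t \<in> W}" "open {t. \<sigma> t \<in> W}" if "open W" for W
    using smooth_curve_vimage_open[OF sc(1) open_UNIV that] smooth_curve_vimage_open[OF sc(2) open_UNIV that] by simp_all
  have nb: "\<exists>N. open N \<and> x \<in> N \<and> (\<forall>y\<in>N. same_state \<gamma> \<sigma> y \<longleftrightarrow> same_state \<gamma> \<sigma> x)" for x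
  proof (cases "\<gamma> x = \<sigma> x")
    case False
    then obtain W1 W2 where W: "open W1" "open W2" "\<gamma> x \<in> W1" "\<sigma> x \<in> W2" "W1 \<inter> W2 = {}"
      using hausdorff by metis
    let ?N = "{t. \<gamma> t \<in> W1} \<inter> {t. \<sigma> t \<in> W2}"
    have "open ?N" by (rule open_Int[OF pre(1)[OF W(1)] pre(2)[OF W(2)]])
    moreover have "\<gamma> y \<noteq> \<sigma> y" if "y \<in> ?N" for y using that W(5) by auto
    ultimately show ?thesis
      using W(3,4) False by (intro exI[of _ ?N]) (auto simp: same_state_def)
  next
    case True
    obtain U \<phi> r \<beta> where cb: "chart_ball_connection A U \<phi> (\<phi> (\<gamma> x)) r \<beta> D" and xU: "\<gamma> x \<in> U"
      by (rule exists_chart_ball[of "\<gamma> x"])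
    interpret cb: chart_ball_connection A U \<phi> "\<phi> (\<gamma> x)" r \<beta> D by (rule cb)
    let ?z = "curve_state \<phi> \<gamma>" and ?w = "curve_state \<phi> \<sigma>"
    have xc1: "\<gamma> x \<in> cb.core" using xU cb.r by (simp add: cb.core_def)
    have "\<sigma> x \<in> cb.core" unfolding True[symmetric] by (rule xc1)
    note xc = xc1 this
    have cont: "isCont ?z x" "isCont ?w x"
      by (rule cb.continuous_curve_state[OF \<gamma> xc(1)], rule cb.continuous_curve_state[OF \<sigma> xc(2)])
    let ?N0 = "{t. \<gamma> t \<in> cb.core} \<inter> {t. \<sigma> t \<in> cb.core}"
    have N0: "open ?N0" "x \<in> ?N0" using pre[OF cb.open_core] xc by auto
    have iff: "same_state \<gamma> \<sigma> y \<longleftrightarrow> ?z y = ?w y" if "y \<in> ?N0" for y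
      by (rule cb.same_state_iff[OF sc]) (use that in auto)
    show ?thesis
    proof (cases "?z x = ?w x")
      case False
      have "((\<lambda>y. dist (?z y) (?w y)) \<longlongrightarrow> dist (?z x) (?w x)) (nhds x)"
        by (intro tendsto_dist) (use cont in \<open>simp_all add: continuous_at_imp_continuous_at_within tendsto_at_iff_tendsto_nhds isCont_def\<close>)
      then have "\<forall>\<^sub>F y in nhds x. dist (?z y) (?w y) > 0"
        by (rule order_tendstoD(1)) (use False in simp)
      then have "\<forall>\<^sub>F y in nhds x. y \<in> ?N0 \<and> ?z y \<noteq> ?w y"
        by (intro eventually_conj eventually_nhds_in_open[OF N0]) (auto elim!: eventually_mono)
      then obtain N where N: "open N" "x \<in> N" "\<forall>y\<in>N. y \<in> ?N0 \<and> ?z y \<noteq> ?w y"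
        unfolding eventually_nhds by (elim exE conjE)
      have "\<not> same_state \<gamma> \<sigma> y" if "y \<in> N" for y
        using iff[of y] N(3)[rule_format, OF that] by simp
      then show ?thesis using N(1,2) by (intro exI[of _ N] conjI ballI) simp_all
    next
      case True
      have z0: "?z x \<in> ball (\<phi> (\<gamma> x)) r \<times> UNIV" using cb.r by (simp add: curve_state_def)
      have W: "open (ball (\<phi> (\<gamma> x)) r \<times> (UNIV :: 'e set))" by (intro open_Times open_ball open_UNIV)
      obtain \<rho> where \<rho>: "\<rho> > 0" "cball (?z x) \<rho> \<subseteq> ball (\<phi> (\<gamma> x)) r \<times> UNIV"
        using W z0 by (meson open_contains_cball)
      obtain L where L: "L \<ge> 0" "\<And>a b. a \<in> cball (?z x) \<rho> \<Longrightarrow> b \<in> cball (?z x) \<rho> \<Longrightarrow>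
          norm (cb.spray a - cb.spray b) \<le> L * norm (a - b)"
        by (rule smooth_on_imp_lipschitz_on_cball[OF cb.smooth_on_spray W \<rho>(2)], rule that)
      have "(?z \<longlongrightarrow> ?z x) (nhds x)" "(?w \<longlongrightarrow> ?w x) (nhds x)"
        using cont by (simp_all add: isCont_def tendsto_at_iff_tendsto_nhds)
      then have "\<forall>\<^sub>F y in nhds x. ?z y \<in> ball (?z x) \<rho>" "\<forall>\<^sub>F y in nhds x. ?w y \<in> ball (?w x) \<rho>"
        using \<rho>(1) by (auto intro!: topological_tendstoD[OF _ open_ball] simp del: mem_ball simp: centre_in_ball)
      note this(1) this(2)[folded True]
      then have "\<forall>\<^sub>F y in nhds x. y \<in> ?N0 \<and> ?z y \<in> ball (?z x) \<rho> \<and> ?w y \<in> ball (?z x) \<rho>"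
        by (intro eventually_conj eventually_nhds_in_open[OF N0])
      then obtain d where d: "d > 0" "\<forall>y. dist y x < d \<longrightarrow> y \<in> ?N0 \<and> ?z y \<in> ball (?z x) \<rho> \<and> ?w y \<in> ball (?z x) \<rho>"
        unfolding eventually_nhds_metric by blast
      let ?J = "ball x d"
      have J: "y \<in> ?N0" "?z y \<in> cball (?z x) \<rho>" "?w y \<in> cball (?z x) \<rho>" if "y \<in> ?J" for y
        using d(2) that ball_subset_cball[of "?z x" \<rho>] by (auto simp: dist_commute)
      have "?z y = ?w y" if "y \<in> ?J" for y
      proof -
        have "norm (?z y - ?w y) \<le> exp (L * \<bar>y - x\<bar>) * norm (?z x - ?w x)"
        proof (rule gronwall[where K = "cball (?z x) \<rho>" and F = cb.spray and J = ?J])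
          show "norm (cb.spray a - cb.spray b) \<le> L * norm (a - b)"
            if "a \<in> cball (?z x) \<rho>" "b \<in> cball (?z x) \<rho>" for a b by (rule L(2)[OF that])
          show "?z t \<in> cball (?z x) \<rho> \<and> (?z has_vector_derivative cb.spray (?z t)) (at t)" if "t \<in> ?J" for t
            using J[OF that] cb.geodesic_imp_ode[OF \<gamma> open_UNIV UNIV_I] by simp
          show "?w t \<in> cball (?z x) \<rho> \<and> (?w has_vector_derivative cb.spray (?w t)) (at t)" if "t \<in> ?J" for t
            using J[OF that] cb.geodesic_imp_ode[OF \<sigma> open_UNIV UNIV_I] by simp
        qed (use that d(1) in \<open>simp_all add: is_interval_ball_real\<close>)
        then show ?thesis using True by simp
      qed
      then have ss: "same_state \<gamma> \<sigma> y" if "y \<in> ?J" for y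
        using iff[OF J(1)[OF that]] that by blast
      have xJ: "x \<in> ?J" using d(1) by simp
      then show ?thesis using ss by (intro exI[of _ ?J] conjI ballI) (auto simp del: mem_ball)
    qed
  qed
  show "\<gamma> t = \<sigma> t" for t
    using clopen_of_local[where Q = "same_state \<gamma> \<sigma>", OF nb connected_UNIV s, of t] by (simp add: same_state_def)
qed

end

lemma (in chart_ball_connection) curve_state_affine:
  assumes \<gamma>: "smooth_curve_on A UNIV \<gamma>" and t: "\<gamma> (a * t + b) \<in> U"
  shows "curve_state \<phi> (\<lambda>t. \<gamma> (a * t + b)) t =
    (\<phi> (\<gamma> (a * t + b)), a *\<^sub>R snd (curve_state \<phi> \<gamma> (a * t + b)))"
proof -
  let ?l = "\<lambda>t :: real. a * t + b"
  have dl: "(?l has_vector_derivative a) (at t)" by (auto intro!: derivative_eq_intros)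
  have "((\<phi> \<circ> \<gamma>) has_vector_derivative vector_derivative (\<phi> \<circ> \<gamma>) (at (?l t))) (at (?l t))"
    by (rule smooth_on_vector_derivative(2)[OF smooth_curve_chart[OF \<gamma> U] smooth_curve_vimage_open[OF \<gamma> open_UNIV chart_open[OF U]]])
      (use t in simp)
  from vector_derivative_at[OF vector_diff_chain_at[OF dl this]] show ?thesis
    by (simp add: curve_state_def o_def)
qed

section \<open>Local flow of a complete connection\<close>

locale complete_chart_ball = chart_ball_connection A U \<phi> c r \<beta> D
  for A :: "('m::t2_space, 'e::euclidean_space) chart set" and U \<phi> c r \<beta> D +
  assumes complete: "geodesically_complete A D"
begin

text \<open>Solutions of the system live on an open time interval of radius \<delta>; completeness
  extends each to a geodesic on the whole line. By uniqueness every geodesic whose state lies in the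
  smaller ball follows such a solution, so it stays in the chart for a time \<delta> independent of
  the geodesic.\<close>

lemma local_flow:
  assumes z0: "fst z0 \<in> ball c r"
  obtains \<delta> \<rho> L where "\<delta> > 0" "\<rho> > 0" "L \<ge> 0" "cball z0 (2 * \<rho>) \<subseteq> ball c r \<times> UNIV"
    "\<And>x y. x \<in> cball z0 (2 * \<rho>) \<Longrightarrow> y \<in> cball z0 (2 * \<rho>) \<Longrightarrow> norm (spray x - spray y) \<le> L * norm (x - y)"
    "\<And>z. z \<in> cball z0 \<rho> \<Longrightarrow> \<exists>\<gamma>. geodesic_on A D UNIV \<gamma> \<and> \<gamma> 0 \<in> core \<and> curve_state \<phi> \<gamma> 0 = z"
    "\<And>\<gamma> s t. geodesic_on A D UNIV \<gamma> \<Longrightarrow> \<gamma> s \<in> core \<Longrightarrow> curve_state \<phi> \<gamma> s \<in> cball z0 \<rho> \<Longrightarrow> \<bar>t - s\<bar> < \<delta> \<Longrightarrow>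
       \<gamma> t \<in> core \<and> curve_state \<phi> \<gamma> t \<in> cball z0 (2 * \<rho>)"
proof -
  have W: "open (ball c r \<times> (UNIV :: 'e set))" by (intro open_Times open_ball open_UNIV)
  have zW: "z0 \<in> ball c r \<times> UNIV" using z0 by (simp add: mem_Times_iff)
  obtain \<delta> \<rho> L where \<delta>: "\<delta> > 0" "\<rho> > 0" "L \<ge> 0" "cball z0 (2 * \<rho>) \<subseteq> ball c r \<times> UNIV"
    "\<And>x y. x \<in> cball z0 (2 * \<rho>) \<Longrightarrow> y \<in> cball z0 (2 * \<rho>) \<Longrightarrow> norm (spray x - spray y) \<le> L * norm (x - y)"
    and ex: "\<And>z. z \<in> cball z0 \<rho> \<Longrightarrow> \<exists>u. u 0 = z \<and>
       (\<forall>t\<in>{-\<delta><..<\<delta>}. u t \<in> cball z0 (2 * \<rho>) \<and> (u has_vector_derivative spray (u t)) (at t))"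
    by (rule ode_local_existence[OF smooth_on_spray W zW], rule that)
  have E: "\<exists>\<gamma>. geodesic_on A D UNIV \<gamma> \<and> curve_state \<phi> \<gamma> 0 = z \<and>
      (\<forall>t\<in>{-\<delta><..<\<delta>}. \<gamma> t \<in> core \<and> curve_state \<phi> \<gamma> t \<in> cball z0 (2 * \<rho>))"
    if z: "z \<in> cball z0 \<rho>" for z
  proof -
    let ?J = "{-\<delta><..<\<delta>}"
    obtain u where u: "u 0 = z" "\<forall>t\<in>?J. u t \<in> cball z0 (2 * \<rho>) \<and> (u has_vector_derivative spray (u t)) (at t)"
      using ex[OF z] by (elim exE conjE)
    have fu: "fst (u t) \<in> ball c r" if "t \<in> ?J" for t
    proof -
      have "u t \<in> ball c r \<times> UNIV" using u(2) that \<delta>(4) by blast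
      then show ?thesis by (simp only: mem_Times_iff)
    qed
    have du: "(u has_vector_derivative spray (u t)) (at t)" if "t \<in> ?J" for t
      using u(2)[rule_format, OF that] by (rule conjunct2)
    let ?\<sigma> = "\<lambda>t. \<pi> (fst (u t))"
    have \<sigma>: "geodesic_on A D ?J ?\<sigma>" by (rule ode_imp_geodesic(1)[OF open_greaterThanLessThan fu du])
    have "interior ?J \<noteq> {}" using \<delta>(1) by (simp add: interior_open)
    then have "is_interval ?J \<and> interior ?J \<noteq> {} \<and> geodesic_on A D ?J ?\<sigma>"
      by (intro conjI is_interval_oo \<sigma>)
    from complete[unfolded geodesically_complete_def, rule_format, OF this]
    obtain \<gamma> where \<gamma>: "geodesic_on A D UNIV \<gamma>" "\<forall>t\<in>?J. \<gamma> t = ?\<sigma> t"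
      by (elim exE conjE)
    have st: "curve_state \<phi> \<gamma> t = u t" if t: "t \<in> ?J" for t
    proof -
      have "vector_derivative (\<phi> \<circ> \<gamma>) (at t) = vector_derivative (\<phi> \<circ> ?\<sigma>) (at t)"
        by (rule vector_derivative_cong_open[OF open_greaterThanLessThan t]) (use \<gamma>(2) in simp)
      then have "curve_state \<phi> \<gamma> t = curve_state \<phi> ?\<sigma> t"
        using \<gamma>(2) t by (simp add: curve_state_def)
      also have "\<dots> = u t" by (rule ode_imp_geodesic(2)[OF open_greaterThanLessThan fu du t])
      finally show ?thesis .
    qed
    have "\<gamma> t \<in> core \<and> curve_state \<phi> \<gamma> t \<in> cball z0 (2 * \<rho>)" if "t \<in> ?J" for t
      using st[OF that] u(2) \<gamma>(2) core_image[OF fu[OF that]] that by simp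
    moreover have "curve_state \<phi> \<gamma> 0 = z" using st[of 0] \<delta>(1) u(1) by simp
    ultimately show ?thesis using \<gamma>(1) by blast
  qed
  show ?thesis
  proof (rule that[OF \<delta>(1-4)])
    show "norm (spray x - spray y) \<le> L * norm (x - y)" if "x \<in> cball z0 (2 * \<rho>)" "y \<in> cball z0 (2 * \<rho>)" for x y
      by (rule \<delta>(5)[OF that])
    show "\<exists>\<gamma>. geodesic_on A D UNIV \<gamma> \<and> \<gamma> 0 \<in> core \<and> curve_state \<phi> \<gamma> 0 = z" if "z \<in> cball z0 \<rho>" for z
      using E[OF that] \<delta>(1) by force
    fix \<gamma> s t assume \<gamma>: "geodesic_on A D UNIV \<gamma>" "\<gamma> s \<in> core" "curve_state \<phi> \<gamma> s \<in> cball z0 \<rho>" and t: "\<bar>t - s\<bar> < \<delta>"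
    obtain \<sigma> where \<sigma>: "geodesic_on A D UNIV \<sigma>" "curve_state \<phi> \<sigma> 0 = curve_state \<phi> \<gamma> s"
      "\<forall>t\<in>{-\<delta><..<\<delta>}. \<sigma> t \<in> core \<and> curve_state \<phi> \<sigma> t \<in> cball z0 (2 * \<rho>)"
      using E[OF \<gamma>(3)] by (elim exE conjE)
    \<comment> \<open>Time is shifted so that the comparison takes place at 0; the factor 1 matches
      the form of \<open>geodesic_affine\<close>.\<close>
    let ?\<gamma> = "\<lambda>t. \<gamma> (1 * t + s)"
    have sh: "geodesic_on A D UNIV ?\<gamma>" by (rule geodesic_affine[OF \<gamma>(1)])
    have csh: "curve_state \<phi> ?\<gamma> t = curve_state \<phi> \<gamma> (t + s)" if "\<gamma> (t + s) \<in> U" for t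
      using curve_state_affine[OF geodesic_on_smooth_curve[OF \<gamma>(1)], of 1 t s] that by (simp add: curve_state_def)
    have "curve_state \<phi> ?\<gamma> 0 = curve_state \<phi> \<sigma> 0" using csh[of 0] \<gamma>(2) coreD(1) \<sigma>(2) by simp
    then have "same_state ?\<gamma> \<sigma> 0"
      using same_state_iff[OF geodesic_on_smooth_curve[OF sh] geodesic_on_smooth_curve[OF \<sigma>(1)], of 0] \<gamma>(2) \<sigma>(3) \<delta>(1) by simp
    then have eq: "?\<gamma> = \<sigma>" by (rule geodesic_unique[OF sh \<sigma>(1)])
    have "\<gamma> t = \<sigma> (t - s)" using fun_cong[OF eq, of "t - s"] by simp
    moreover have "\<sigma> (t - s) \<in> core \<and> curve_state \<phi> \<sigma> (t - s) \<in> cball z0 (2 * \<rho>)"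
      by (rule bspec[OF \<sigma>(3)]) (use t in \<open>simp add: abs_less_iff\<close>)
    moreover have "curve_state \<phi> \<gamma> t = curve_state \<phi> \<sigma> (t - s)" if "\<gamma> t \<in> core"
      using csh[of "t - s"] that coreD(1) eq by simp
    ultimately show "\<gamma> t \<in> core \<and> curve_state \<phi> \<gamma> t \<in> cball z0 (2 * \<rho>)" by simp
  qed
qed

end

locale complete_connection = manifold_connection A D
  for A :: "('m::t2_space, 'e::euclidean_space) chart set" and D +
  assumes complete: "geodesically_complete A D"
begin

text \<open>Convergence is locally constant in time. The limit geodesic may leave every single
  chart, so the estimate is local and \<open>clopen_of_local\<close> covers the whole line.\<close>

lemma states_converge_propagates:
  assumes G: "\<And>w. geodesic_on A D UNIV (G w)" and \<gamma>: "geodesic_on A D UNIV \<gamma>"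
    and conv: "states_converge A \<F> G \<gamma> s"
  shows "states_converge A \<F> G \<gamma> t"
proof -
  note scG = geodesic_on_smooth_curve[OF G] and sc = geodesic_on_smooth_curve[OF \<gamma>]
  have nb: "\<exists>N. open N \<and> x \<in> N \<and> (\<forall>y\<in>N. states_converge A \<F> G \<gamma> y \<longleftrightarrow> states_converge A \<F> G \<gamma> x)" for x
  proof -
    obtain U \<phi> r \<beta> where cb: "chart_ball_connection A U \<phi> (\<phi> (\<gamma> x)) r \<beta> D" and xU: "\<gamma> x \<in> U"
      by (rule exists_chart_ball[of "\<gamma> x"])
    interpret cb: complete_chart_ball A U \<phi> "\<phi> (\<gamma> x)" r \<beta> D
      using cb complete by (simp add: complete_chart_ball_def complete_chart_ball_axioms_def)
    let ?st = "curve_state \<phi>"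
    let ?z0 = "?st \<gamma> x"
    have xc: "\<gamma> x \<in> cb.core" using xU cb.r by (simp add: cb.core_def)
    have z0: "fst ?z0 \<in> ball (\<phi> (\<gamma> x)) r" using cb.r by (simp add: curve_state_def)
    obtain \<delta> \<rho> L where \<delta>: "\<delta> > 0" "\<rho> > 0" "L \<ge> 0" "cball ?z0 (2 * \<rho>) \<subseteq> ball (\<phi> (\<gamma> x)) r \<times> UNIV"
      "\<And>x y. x \<in> cball ?z0 (2 * \<rho>) \<Longrightarrow> y \<in> cball ?z0 (2 * \<rho>) \<Longrightarrow> norm (cb.spray x - cb.spray y) \<le> L * norm (x - y)"
      "\<And>z. z \<in> cball ?z0 \<rho> \<Longrightarrow> \<exists>\<gamma>. geodesic_on A D UNIV \<gamma> \<and> \<gamma> 0 \<in> cb.core \<and> ?st \<gamma> 0 = z"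
      and flow: "\<And>\<gamma> s t. geodesic_on A D UNIV \<gamma> \<Longrightarrow> \<gamma> s \<in> cb.core \<Longrightarrow> ?st \<gamma> s \<in> cball ?z0 \<rho> \<Longrightarrow> \<bar>t - s\<bar> < \<delta> \<Longrightarrow>
        \<gamma> t \<in> cb.core \<and> ?st \<gamma> t \<in> cball ?z0 (2 * \<rho>)"
      by (rule cb.local_flow[OF z0], rule that)
    have "(?st \<gamma> \<longlongrightarrow> ?z0) (nhds x)"
      using cb.continuous_curve_state[OF \<gamma> xc] by (simp add: isCont_def tendsto_at_iff_tendsto_nhds)
    then have "\<forall>\<^sub>F y in nhds x. ?st \<gamma> y \<in> ball ?z0 \<rho>"
      by (rule topological_tendstoD[OF _ open_ball]) (use \<delta>(2) in simp)
    moreover have "\<forall>\<^sub>F y in nhds x. \<gamma> y \<in> cb.core"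
      using eventually_nhds_in_open[OF smooth_curve_vimage_open[OF sc open_UNIV cb.open_core], of x] xc by simp
    ultimately have "\<forall>\<^sub>F y in nhds x. \<gamma> y \<in> cb.core \<and> ?st \<gamma> y \<in> ball ?z0 \<rho>"
      by (rule eventually_conj[rotated])
    then obtain d where d: "d > 0" "\<forall>y. dist y x < d \<longrightarrow> \<gamma> y \<in> cb.core \<and> ?st \<gamma> y \<in> ball ?z0 \<rho>"
      unfolding eventually_nhds_metric by blast
    \<comment> \<open>Any two times within \<open>e\<close> of \<open>x\<close> differ by less than
      \<delta>, and at both the limit curve is well inside the chart. The roles of the two times can
      thus be exchanged, which gives both directions of the equivalence.\<close>
    define e where "e = min d (\<delta> / 2)"
    have e: "e > 0" "e \<le> d" "2 * e \<le> \<delta>" using d \<delta>(1) by (auto simp: e_def)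
    have step: "states_converge A \<F> G \<gamma> t" if s: "s \<in> ball x e" and t: "t \<in> ball x e" and cs: "states_converge A \<F> G \<gamma> s" for s t
    proof -
      have sd: "dist s x < d" and td: "dist t x < d" using s t e by (auto simp: dist_commute)
      have sc1: "\<gamma> s \<in> cb.core" "?st \<gamma> s \<in> ball ?z0 \<rho>" and tc: "\<gamma> t \<in> cb.core" using d(2) sd td by auto
      have st: "\<bar>t - s\<bar> < \<delta>" using s t e by (auto simp: dist_real_def)
      have ev: "\<forall>\<^sub>F w in \<F>. G w s \<in> cb.core" and lim: "((\<lambda>w. ?st (G w) s) \<longlongrightarrow> ?st \<gamma> s) \<F>"
        by (rule cb.states_converge_imp_chart[OF scG sc sc1(1) cs])+
      have "\<forall>\<^sub>F w in \<F>. ?st (G w) s \<in> ball ?z0 \<rho>"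
        by (rule topological_tendstoD[OF lim open_ball sc1(2)])
      with ev have ev2: "\<forall>\<^sub>F w in \<F>. G w s \<in> cb.core \<and> ?st (G w) s \<in> ball ?z0 \<rho>"
        by (rule eventually_conj)
      \<comment> \<open>During time \<delta> from \<open>s\<close> both states remain in the ball on
        which the spray is Lipschitz, so Gronwall applies with a constant independent of
        \<open>w\<close>.\<close>
      have close: "G w t \<in> cb.core \<and> norm (?st (G w) t - ?st \<gamma> t) \<le> exp (L * \<bar>t - s\<bar>) * norm (?st (G w) s - ?st \<gamma> s)"
        if w: "G w s \<in> cb.core \<and> ?st (G w) s \<in> ball ?z0 \<rho>" for w
      proof
        have wb: "?st (G w) s \<in> cball ?z0 \<rho>" and gb: "?st \<gamma> s \<in> cball ?z0 \<rho>"
          using w sc1 ball_subset_cball by blast+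
        have fw: "G w y \<in> cb.core \<and> ?st (G w) y \<in> cball ?z0 (2 * \<rho>)" if "y \<in> ball s \<delta>" for y
          by (rule flow[OF G conjunct1[OF w] wb]) (use that in \<open>simp add: dist_real_def abs_minus_commute\<close>)
        have fg: "\<gamma> y \<in> cb.core \<and> ?st \<gamma> y \<in> cball ?z0 (2 * \<rho>)" if "y \<in> ball s \<delta>" for y
          by (rule flow[OF \<gamma> sc1(1) gb]) (use that in \<open>simp add: dist_real_def abs_minus_commute\<close>)
        have tb: "t \<in> ball s \<delta>" "s \<in> ball s \<delta>" using st \<delta>(1) by (simp_all add: dist_real_def abs_minus_commute)
        show "G w t \<in> cb.core" using fw[OF tb(1)] by simp
        show "norm (?st (G w) t - ?st \<gamma> t) \<le> exp (L * \<bar>t - s\<bar>) * norm (?st (G w) s - ?st \<gamma> s)"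
        proof (rule gronwall[where K = "cball ?z0 (2 * \<rho>)" and F = cb.spray and J = "ball s \<delta>"])
          show "norm (cb.spray a - cb.spray b) \<le> L * norm (a - b)"
            if "a \<in> cball ?z0 (2 * \<rho>)" "b \<in> cball ?z0 (2 * \<rho>)" for a b by (rule \<delta>(5)[OF that])
          show "?st (G w) y \<in> cball ?z0 (2 * \<rho>) \<and> (?st (G w) has_vector_derivative cb.spray (?st (G w) y)) (at y)" if "y \<in> ball s \<delta>" for y
            using fw[OF that] cb.geodesic_imp_ode[OF G open_UNIV UNIV_I] by simp
          show "?st \<gamma> y \<in> cball ?z0 (2 * \<rho>) \<and> (?st \<gamma> has_vector_derivative cb.spray (?st \<gamma> y)) (at y)" if "y \<in> ball s \<delta>" for y
            using fg[OF that] cb.geodesic_imp_ode[OF \<gamma> open_UNIV UNIV_I] by simp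
        qed (use tb in \<open>simp_all add: is_interval_ball_real\<close>)
      qed
      have evt: "\<forall>\<^sub>F w in \<F>. G w t \<in> cb.core"
        by (rule eventually_mono[OF ev2], rule conjunct1[OF close])
      have "((\<lambda>w. exp (L * \<bar>t - s\<bar>) * norm (?st (G w) s - ?st \<gamma> s)) \<longlongrightarrow> exp (L * \<bar>t - s\<bar>) * norm (?st \<gamma> s - ?st \<gamma> s)) \<F>"
        by (intro tendsto_intros lim)
      then have "((\<lambda>w. exp (L * \<bar>t - s\<bar>) * norm (?st (G w) s - ?st \<gamma> s)) \<longlongrightarrow> 0) \<F>" by simp
      from Lim_null_comparison[OF eventually_mono[OF ev2 conjunct2[OF close]] this]
      have "((\<lambda>w. ?st (G w) t) \<longlongrightarrow> ?st \<gamma> t) \<F>" by (rule LIM_zero_cancel)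
      then show ?thesis by (rule cb.states_converge_from_chart[OF scG sc tc evt])
    qed
    have xe: "x \<in> ball x e" using e(1) by simp
    have "\<forall>y\<in>ball x e. states_converge A \<F> G \<gamma> y \<longleftrightarrow> states_converge A \<F> G \<gamma> x"
    proof
      fix y assume y: "y \<in> ball x e"
      show "states_converge A \<F> G \<gamma> y \<longleftrightarrow> states_converge A \<F> G \<gamma> x"
        by (rule iffI[OF step[OF y xe] step[OF xe y]])
    qed
    with xe open_ball show ?thesis by (intro exI[of _ "ball x e"] conjI)
  qed
  show ?thesis by (rule clopen_of_local[where Q = "states_converge A \<F> G \<gamma>", OF nb connected_UNIV conv])
qed

end

subsection \<open>The exponential map\<close>

context complete_chart_ball
begin

lemma c_in_ball: "c \<in> ball c r"
  using r by simp

lemma exp_curve_exists: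
  "\<exists>\<gamma>. geodesic_on A D UNIV \<gamma> \<and> \<gamma> 0 \<in> core \<and> curve_state \<phi> \<gamma> 0 = (c, v)"
proof -
  have z0: "fst (c, v) \<in> ball c r" using c_in_ball by simp
  obtain \<delta> \<rho> L where "\<rho> > 0" and ex: "\<And>z. z \<in> cball (c, v) \<rho> \<Longrightarrow>
      \<exists>\<gamma>. geodesic_on A D UNIV \<gamma> \<and> \<gamma> 0 \<in> core \<and> curve_state \<phi> \<gamma> 0 = z"
    by (rule local_flow[OF z0], rule that)
  then show ?thesis using ex[of "(c, v)"] by simp
qed

definition exp_curve :: "'e \<Rightarrow> real \<Rightarrow> 'm" where
  "exp_curve v = (SOME \<gamma>. geodesic_on A D UNIV \<gamma> \<and> \<gamma> 0 \<in> core \<and> curve_state \<phi> \<gamma> 0 = (c, v))"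

definition gexp :: "'e \<Rightarrow> 'm" where
  "gexp v = exp_curve v 1"

lemma exp_curve: "geodesic_on A D UNIV (exp_curve v)" "exp_curve v 0 \<in> core" "curve_state \<phi> (exp_curve v) 0 = (c, v)"
  using someI_ex[OF exp_curve_exists[of v]] unfolding exp_curve_def by blast+

lemma exp_curve_smooth: "smooth_curve_on A UNIV (exp_curve v)"
  by (rule geodesic_on_smooth_curve[OF exp_curve(1)])

lemma exp_curve_unique:
  assumes \<sigma>: "geodesic_on A D UNIV \<sigma>" "\<sigma> 0 \<in> core" "curve_state \<phi> \<sigma> 0 = (c, v)"
  shows "\<sigma> = exp_curve v"
  by (rule geodesic_unique[OF \<sigma>(1) exp_curve(1), of _ 0],
      rule iffD2[OF same_state_iff[OF geodesic_on_smooth_curve[OF \<sigma>(1)] exp_curve_smooth \<sigma>(2) exp_curve(2)]])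
    (simp only: \<sigma>(3) exp_curve(3))

lemma exp_curve_0: "exp_curve v 0 = \<pi> c"
proof -
  have "\<phi> (exp_curve v 0) = c" using exp_curve(3)[of v] by (simp add: curve_state_def)
  then show ?thesis using coreD(3)[OF exp_curve(2)[of v]] by simp
qed

lemma exp_curve_scale: "exp_curve (\<tau> *\<^sub>R v) t = exp_curve v (\<tau> * t)"
proof -
  let ?\<sigma> = "\<lambda>t. exp_curve v (\<tau> * t + 0)"
  have "curve_state \<phi> ?\<sigma> 0 = (c, \<tau> *\<^sub>R v)"
    using curve_state_affine[OF exp_curve_smooth, of v \<tau> 0 0] coreD(1)[OF exp_curve(2)[of v]] exp_curve(3)[of v]
    by (simp add: curve_state_def)
  then have "?\<sigma> = exp_curve (\<tau> *\<^sub>R v)"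
    by (intro exp_curve_unique geodesic_affine exp_curve(1)) (simp_all add: exp_curve(2))
  from fun_cong[OF this, of t] show ?thesis by simp
qed

lemma gexp_scale: "gexp (t *\<^sub>R v) = exp_curve v t"
  by (simp add: gexp_def exp_curve_scale)

lemma gexp_0: "gexp 0 = \<pi> c"
  using gexp_scale[of 0 0] exp_curve_0 by simp

text \<open>At time 0 the states \<open>(c, v)\<close> depend continuously on \<open>v\<close>; this
  convergence is propagated to time 1 and read in a chart around the end point.\<close>

lemma gexp_continuous: "continuous_on UNIV gexp"
proof -
  interpret cc: complete_connection A D by unfold_locales (rule complete)
  have "isCont gexp v" for v
  proof -
    have "states_converge A (nhds v) exp_curve (exp_curve v) 0"
      by (rule states_converge_from_chart[OF exp_curve_smooth exp_curve_smooth exp_curve(2)])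
        (auto simp: exp_curve(2,3) intro!: always_eventually tendsto_intros filterlim_ident)
    then have conv: "states_converge A (nhds v) exp_curve (exp_curve v) 1"
      by (rule cc.states_converge_propagates[OF exp_curve(1) exp_curve(1)])
    obtain U' \<phi>' r' \<beta>' where cb: "chart_ball_connection A U' \<phi>' (\<phi>' (gexp v)) r' \<beta>' D" and vU: "gexp v \<in> U'"
      by (rule exists_chart_ball[of "gexp v"])
    interpret cb: chart_ball_connection A U' \<phi>' "\<phi>' (gexp v)" r' \<beta>' D by (rule cb)
    have "gexp v \<in> cb.core" using vU cb.r by (simp add: cb.core_def)
    then have vc: "exp_curve v 1 \<in> cb.core" by (simp only: gexp_def)
    note C = cb.states_converge_imp_chart[OF exp_curve_smooth exp_curve_smooth vc conv]
    have "((\<lambda>w. \<phi>' (gexp w)) \<longlongrightarrow> \<phi>' (gexp v)) (nhds v)"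
      using tendsto_fst[OF C(2)] by (simp add: curve_state_def gexp_def)
    moreover have "isCont (inv_into U' \<phi>') (\<phi>' (gexp v))"
      using chart_inv_continuous[OF cb.U] cb.openU vU by (simp add: continuous_on_eq_continuous_at)
    ultimately have "((\<lambda>w. inv_into U' \<phi>' (\<phi>' (gexp w))) \<longlongrightarrow> inv_into U' \<phi>' (\<phi>' (gexp v))) (nhds v)"
      by (rule isCont_tendsto_compose[rotated])
    then have "((\<lambda>w. inv_into U' \<phi>' (\<phi>' (gexp w))) \<longlongrightarrow> gexp v) (nhds v)"
      using chart_inv[OF cb.U vU] by simp
    then have "(gexp \<longlongrightarrow> gexp v) (nhds v)"
    proof (rule Lim_transform_eventually)
      show "\<forall>\<^sub>F w in nhds v. inv_into U' \<phi>' (\<phi>' (gexp w)) = gexp w"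
        by (rule eventually_mono[OF C(1)]) (simp add: cb.coreD(3) gexp_def)
    qed
    then show ?thesis by (simp add: isCont_def tendsto_at_iff_tendsto_nhds)
  qed
  then show ?thesis by (simp add: continuous_on_eq_continuous_at)
qed

text \<open>Rescaling replaces a slow geodesic up to time 1 by one of initial speed \<rho> up to a
  short time \<tau>, so that all of them start in a fixed ball of states on which the spray is
  bounded.\<close>

lemma gexp_derivative_0:
  obtains \<epsilon> where "\<epsilon> > 0"
    "\<And>v. norm v < \<epsilon> \<Longrightarrow> gexp v \<in> U \<and> norm (\<phi> (gexp v) - c - v) \<le> norm v / 2"
proof -
  have z0: "fst (c, 0 :: 'e) \<in> ball c r" using c_in_ball by simp
  let ?y = "(c, 0 :: 'e)"
  obtain \<delta> \<rho> L where \<delta>: "\<delta> > 0" "\<rho> > 0" "cball ?y (2 * \<rho>) \<subseteq> ball c r \<times> UNIV"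
    and flow: "\<And>\<gamma> s t. geodesic_on A D UNIV \<gamma> \<Longrightarrow> \<gamma> s \<in> core \<Longrightarrow> curve_state \<phi> \<gamma> s \<in> cball ?y \<rho> \<Longrightarrow> \<bar>t - s\<bar> < \<delta> \<Longrightarrow>
       \<gamma> t \<in> core \<and> curve_state \<phi> \<gamma> t \<in> cball ?y (2 * \<rho>)"
    by (rule local_flow[OF z0], rule that)
  let ?K = "cball ?y (2 * \<rho>)"
  have "compact (spray ` ?K)"
    by (rule compact_continuous_image[OF continuous_on_subset[OF smooth_on_imp_continuous_on[OF smooth_on_spray] \<delta>(3)] compact_cball])
  then obtain M where M: "M > 0" "\<And>z. z \<in> ?K \<Longrightarrow> norm (spray z) \<le> M"
    using compact_imp_bounded[of "spray ` ?K"] unfolding bounded_pos by auto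
  \<comment> \<open>With \<open>M\<close> bounding the spray, the velocity changes by at most
    M\<tau> and the position deviates from uniform motion by at most M\<tau>^2. For \<tau> below
    \<rho> / (2M) this is at most \<tau>\<rho> / 2, half the norm of the original vector.\<close>
  define d where "d = min \<delta> (\<rho> / (2 * M))"
  have d: "d > 0" "d \<le> \<delta>" "d \<le> \<rho> / (2 * M)" using \<delta> M by (auto simp: d_def)
  have short: "exp_curve u \<tau> \<in> U \<and> norm (\<phi> (exp_curve u \<tau>) - c - \<tau> *\<^sub>R u) \<le> \<tau> * \<rho> / 2"
    if u: "norm u = \<rho>" and \<tau>: "0 \<le> \<tau>" "\<tau> < d" for u \<tau>
  proof -
    let ?z = "curve_state \<phi> (exp_curve u)"
    have in_K: "exp_curve u t \<in> core \<and> ?z t \<in> ?K" if "t \<in> {0..\<tau>}" for t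
    proof (rule flow[OF exp_curve(1) exp_curve(2)])
      show "?z 0 \<in> cball ?y \<rho>" using u \<delta>(2) by (simp add: exp_curve(3) dist_norm norm_Pair)
      show "\<bar>t - 0\<bar> < \<delta>" using that \<tau> d by auto
    qed
    have dz: "(?z has_vector_derivative spray (?z t)) (at t within {0..\<tau>})" if "t \<in> {0..\<tau>}" for t
      by (rule has_vector_derivative_at_within[OF geodesic_imp_ode[OF exp_curve(1) open_UNIV UNIV_I]]) (use in_K[OF that] in simp)
    have d2: "norm (snd (?z t) - u) \<le> M * \<tau>" if t: "t \<in> {0..\<tau>}" for t
    proof -
      have "norm (?z t - ?z 0) \<le> M * norm (t - 0)"
      proof (rule differentiable_bound[OF convex_real_interval(5)])
        show "(?z has_derivative (\<lambda>h. h *\<^sub>R spray (?z x))) (at x within {0..\<tau>})" if "x \<in> {0..\<tau>}" for x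
          using dz[OF that] by (simp add: has_vector_derivative_def)
        show "onorm (\<lambda>h. h *\<^sub>R spray (?z x)) \<le> M" if "x \<in> {0..\<tau>}" for x
          by (rule onorm_le) (use M(2)[of "?z x"] in_K[OF that] in \<open>simp add: mult.commute[of M] mult_left_mono\<close>)
      qed (use t in auto)
      also have "\<dots> \<le> M * \<tau>" using t M(1) by auto
      finally have "norm (?z t - (c, u)) \<le> M * \<tau>" by (simp add: exp_curve(3))
      moreover have "norm (snd (?z t) - u) \<le> norm (?z t - (c, u))"
      proof -
        have "norm (snd w) \<le> norm w" for w :: "'e \<times> 'e" by (cases w) (simp add: norm_snd_le)
        from this[of "?z t - (c, u)"] show ?thesis by (simp only: snd_diff snd_conv)
      qed
      ultimately show ?thesis by linarith
    qed
    let ?g = "\<lambda>t. fst (?z t) - t *\<^sub>R u"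
    have "norm (?g \<tau> - ?g 0) \<le> (M * \<tau>) * norm (\<tau> - 0)"
    proof (rule differentiable_bound[OF convex_real_interval(5)])
      show "(?g has_derivative (\<lambda>h. h *\<^sub>R (snd (?z x) - u))) (at x within {0..\<tau>})" if "x \<in> {0..\<tau>}" for x
      proof -
        have "((\<lambda>t. fst (?z t)) has_vector_derivative snd (?z x)) (at x within {0..\<tau>})"
          using bounded_linear.has_vector_derivative[OF bounded_linear_fst dz[OF that]] by (simp add: spray_def)
        moreover have "((\<lambda>t. t *\<^sub>R u) has_vector_derivative u) (at x within {0..\<tau>})"
          by (auto intro!: derivative_eq_intros)
        ultimately show ?thesis
          unfolding has_vector_derivative_def[symmetric] by (rule has_vector_derivative_diff)
      qed
      show "onorm (\<lambda>h. h *\<^sub>R (snd (?z x) - u)) \<le> M * \<tau>" if "x \<in> {0..\<tau>}" for x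
        by (rule onorm_le) (use d2[OF that] in \<open>simp add: mult.commute[of "M * \<tau>"] mult_left_mono\<close>)
    qed (use \<tau> in auto)
    also have "(M * \<tau>) * norm (\<tau> - 0) \<le> \<tau> * \<rho> / 2"
    proof -
      have "M * \<tau> \<le> M * (\<rho> / (2 * M))" using \<tau>(2) d(3) M(1) by (intro mult_left_mono) auto
      then have "M * \<tau> \<le> \<rho> / 2" using M(1) by simp
      then have "\<tau> * (M * \<tau>) \<le> \<tau> * (\<rho> / 2)" using \<tau>(1) by (rule mult_left_mono)
      then show ?thesis using \<tau>(1) by (simp add: mult_ac)
    qed
    finally have "norm (\<phi> (exp_curve u \<tau>) - \<tau> *\<^sub>R u - \<phi> (exp_curve u 0)) \<le> \<tau> * \<rho> / 2"
      by (simp add: curve_state_def)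
    moreover have "\<phi> (exp_curve u 0) = c" using exp_curve(3)[of u] by (simp add: curve_state_def)
    ultimately show ?thesis
      using in_K[of \<tau>] \<tau>(1) coreD(1) by (simp add: algebra_simps)
  qed
  show ?thesis
  proof (rule that[of "\<rho> * d"])
    show "\<rho> * d > 0" using \<delta> d by simp
    fix v :: 'e assume v: "norm v < \<rho> * d"
    show "gexp v \<in> U \<and> norm (\<phi> (gexp v) - c - v) \<le> norm v / 2"
    proof (cases "v = 0")
      case True
      then show ?thesis using core_chart[OF c_in_ball] by (simp add: gexp_0)
    next
      case False
      define \<tau> where "\<tau> = norm v / \<rho>"
      define u where "u = (\<rho> / norm v) *\<^sub>R v"
      have u: "norm u = \<rho>" "v = \<tau> *\<^sub>R u" using False \<delta>(2) by (simp_all add: u_def \<tau>_def)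
      have \<tau>: "0 \<le> \<tau>" "\<tau> < d" using v \<delta>(2) by (simp_all add: \<tau>_def field_simps)
      have "\<tau> * \<rho> / 2 = norm v / 2" using \<delta>(2) by (simp add: \<tau>_def)
      then show ?thesis using short[OF u(1) \<tau>] gexp_scale[of \<tau> u] u(2) by simp
    qed
  qed
qed

end

subsection \<open>Convex functions along geodesics\<close>

context complete_connection
begin

lemma critical_derivative:
  assumes "p \<in> critical_points A f" "(U, \<phi>) \<in> A" "p \<in> U"
  shows "frechet_derivative (\<lambda>x. f (inv_into U \<phi> x)) (at (\<phi> p)) = (\<lambda>_. 0)"
proof -
  have "((f \<circ> inv_into U \<phi>) has_derivative (\<lambda>_. 0)) (at (\<phi> p) within \<phi> ` U)"
    using assms by (auto simp: critical_points_def)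
  then have "((\<lambda>x. f (inv_into U \<phi> x)) has_derivative (\<lambda>_. 0)) (at (\<phi> p))"
    using at_within_open[OF imageI[OF assms(3)] chart_image_open[OF assms(2)]] by (simp add: o_def)
  then show ?thesis by (rule frechet_derivative_at[symmetric])
qed

lemma geodesic_convex:
  assumes "g_convex A D f" "geodesic_on A D UNIV \<gamma>" "t \<in> {0..1}"
  shows "f (\<gamma> t) \<le> (1 - t) * f (\<gamma> 0) + t * f (\<gamma> 1)"
proof -
  have "convex_on {0..1} (f \<circ> \<gamma>)"
    using assms(1) geodesic_restrict_unit_interval[OF assms(2)] by (simp add: g_convex_def)
  from convex_onD[OF this, of t 0 1] assms(3) show ?thesis by simp
qed

text \<open>By convexity the forward difference quotients of \<open>f\<close> along the geodesic are
  bounded above by the difference of its values at times 1 and 0; by criticality they tend to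
  0.\<close>

lemma critical_start_le:
  assumes f: "f \<in> smooth_functions A" "g_convex A D f" and \<gamma>: "geodesic_on A D UNIV \<gamma>"
    and crit: "\<gamma> 0 \<in> critical_points A f"
  shows "f (\<gamma> 0) \<le> f (\<gamma> 1)"
proof -
  let ?k = "\<lambda>t. f (\<gamma> t)"
  obtain U \<phi> where U: "(U, \<phi>) \<in> A" "\<gamma> 0 \<in> U" using chart_cover by blast
  have "(?k has_vector_derivative 0) (at 0)"
    using velocity_in_chart(1)[OF geodesic_on_smooth_curve[OF \<gamma>] open_UNIV U(1) UNIV_I U(2) f(1)]
    unfolding critical_derivative[OF crit U] by (simp add: o_def)
  then have "(?k has_real_derivative 0) (at 0)"
    by (simp add: has_real_derivative_iff_has_vector_derivative)
  then have "((\<lambda>h. (?k h - ?k 0) / h) \<longlongrightarrow> 0) (at 0)"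
    by (simp add: DERIV_def)
  then have lim: "((\<lambda>h. (?k h - ?k 0) / h) \<longlongrightarrow> 0) (at_right 0)"
    by (rule tendsto_mono[OF at_le, rotated]) simp
  have "(?k h - ?k 0) / h \<le> ?k 1 - ?k 0" if "0 < h" "h < 1" for h
  proof -
    have "?k h \<le> (1 - h) * ?k 0 + h * ?k 1"
      by (rule geodesic_convex[OF f(2) \<gamma>]) (use that in auto)
    then have "?k h - ?k 0 \<le> (?k 1 - ?k 0) * h" by (simp add: algebra_simps)
    then show ?thesis using that(1) by (simp add: pos_divide_le_eq)
  qed
  then have "\<forall>\<^sub>F h in at_right 0. (?k h - ?k 0) / h \<le> ?k 1 - ?k 0"
    unfolding eventually_at_right[OF zero_less_one] by (intro exI[of _ 1]) simp
  then have "0 \<le> ?k 1 - ?k 0"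
    by (rule tendsto_upperbound[OF lim]) simp
  then show ?thesis by simp
qed

lemma local_min_critical:
  assumes f: "f \<in> smooth_functions A" and N: "open N" "z \<in> N" "\<And>q. q \<in> N \<Longrightarrow> f z \<le> f q"
  shows "z \<in> critical_points A f"
  unfolding critical_points_def
proof (intro CollectI ballI, clarify)
  fix V \<psi> assume V: "(V, \<psi>) \<in> A" and z: "z \<in> V"
  let ?g = "\<lambda>x. f (inv_into V \<psi> x)"
  have d: "(?g has_derivative frechet_derivative ?g (at (\<psi> z))) (at (\<psi> z))"
    by (rule smooth_on_has_derivative[OF smooth_in_chart[OF f V] chart_image_open[OF V]]) (use z in auto)
  have o: "open (\<psi> ` (V \<inter> N))"
    by (rule chart_image_open_subset[OF V]) (use chart_open[OF V] N(1) in auto)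
  have "\<forall>y\<in>\<psi> ` (V \<inter> N). ?g (\<psi> z) \<le> ?g y" using N(3) V z by auto
  then have "frechet_derivative ?g (at (\<psi> z)) = (\<lambda>v. 0)"
    using differential_zero_maxmin[OF _ o d] z N(2) by blast
  then show "(f \<circ> inv_into V \<psi> has_derivative (\<lambda>_. 0)) (at (\<psi> z) within \<psi> ` V)"
    using d by (simp add: o_def has_derivative_at_withinI)
qed

lemma critical_point_unique:
  assumes conn: "connected (UNIV :: 'm set)" and f: "f \<in> smooth_functions A" "g_convex A D f"
    and disc: "discrete (critical_points A f)"
    and p: "p \<in> critical_points A f" and q: "q \<in> critical_points A f"
  shows "p = q"
proof (rule ccontr)
  assume "p \<noteq> q"
  obtain U \<phi> r \<beta> where cb: "chart_ball_connection A U \<phi> (\<phi> p) r \<beta> D" and pU: "p \<in> U"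
    by (rule exists_chart_ball[of p])
  interpret cb: complete_chart_ball A U \<phi> "\<phi> p" r \<beta> D
    using cb complete by (simp add: complete_chart_ball_def complete_chart_ball_axioms_def)
  let ?e = cb.gexp and ?c = "\<phi> p"
  have pp: "inv_into U \<phi> ?c = p" using cb.U pU by simp
  have e0: "?e 0 = p" using cb.gexp_0 pp by simp
  have curve0: "cb.exp_curve v 0 = p" for v using cb.exp_curve_0 pp by simp
  have min: "f p \<le> f (?e v)" for v
    using critical_start_le[OF f cb.exp_curve(1)[of v]] curve0 p by (simp add: cb.gexp_def)
  have conv: "f (?e (t *\<^sub>R v)) \<le> (1 - t) * f p + t * f (?e v)" if "t \<in> {0..1}" for t v
    using geodesic_convex[OF f(2) cb.exp_curve(1)[of v] that] curve0
    by (simp only: cb.gexp_scale) (simp add: cb.gexp_def)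
  have ce: "continuous_on UNIV ?e" by (rule cb.gexp_continuous)
  have cfe: "continuous_on UNIV (\<lambda>v. f (?e v))"
    by (rule continuous_on_compose2[OF smooth_functions_continuous[OF f(1)] ce]) simp
  obtain \<epsilon> where \<epsilon>: "\<epsilon> > 0" "\<And>v. norm v < \<epsilon> \<Longrightarrow> ?e v \<in> U \<and> norm (\<phi> (?e v) - ?c - v) \<le> norm v / 2"
    by (rule cb.gexp_derivative_0, rule that)
  define N where "N = {z \<in> U. \<phi> z \<in> ball ?c (\<epsilon> / 4)}"
  have N: "open N" "p \<in> N"
    unfolding N_def by (rule chart_vimage_open[OF cb.U open_ball]) (use pU \<epsilon>(1) in simp)
  have local_min: "f p \<le> f z" if z: "z \<in> N" for z
  proof -
    let ?F = "\<lambda>v. \<phi> (?e v) - ?c"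
    have vU: "?e v \<in> U" "norm (?F v - v) \<le> norm v / 2" if "v \<in> cball 0 (\<epsilon> / 2)" for v
      using \<epsilon>(2)[of v] that \<epsilon>(1) by auto
    \<comment> \<open>Brouwer in place of the inverse function theorem. On the ball of radius
      \<epsilon> / 2 the map deviates from the identity by at most \<epsilon> / 4, hence it covers
      the ball of radius \<epsilon> / 4.\<close>
    have "\<exists>v\<in>cball 0 (\<epsilon> / 2). ?F v = \<phi> z - ?c"
    proof (rule brouwer_surjective_cball[of _ _ _ _ "cball 0 (\<epsilon> / 4)"])
      show "continuous_on (cball 0 (\<epsilon> / 2)) ?F"
        by (intro continuous_intros continuous_on_compose2[OF chart_continuous[OF cb.U] continuous_on_subset[OF ce]])
          (use vU in auto)
      show "\<phi> z - ?c \<in> cball 0 (\<epsilon> / 4)" using z by (simp add: N_def dist_norm norm_minus_commute)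
      fix x y :: 'e assume x: "x \<in> cball 0 (\<epsilon> / 4)" and y: "y \<in> cball 0 (\<epsilon> / 2)"
      have "norm (x + (y - ?F y)) \<le> norm x + norm (?F y - y)"
        using norm_triangle_ineq[of x "y - ?F y"] by (simp add: norm_minus_commute)
      also have "\<dots> \<le> \<epsilon> / 4 + (\<epsilon> / 2) / 2" using x y vU(2)[OF y] by auto
      finally show "x + (y - ?F y) \<in> cball 0 (\<epsilon> / 2)" by simp
    qed (use \<epsilon>(1) in simp)
    then obtain v where v: "v \<in> cball 0 (\<epsilon> / 2)" "\<phi> (?e v) = \<phi> z" by auto
    then have "?e v = z" using vU(1)[OF v(1)] z cb.U by (metis (no_types, lifting) N_def chart_inv mem_Collect_eq)
    then show ?thesis using min[of v] by simp
  qed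
  have strict: "f p < f (?e v)" if v: "v \<noteq> 0" for v
  proof (rule ccontr)
    assume "\<not> f p < f (?e v)"
    then have fv: "f (?e v) = f p" using min[of v] by simp
    \<comment> \<open>If equality held at \<open>v\<close>, convexity and minimality would make
      \<open>f\<close> constant on the geodesic from \<open>p\<close>. Its points near
      \<open>p\<close> would then be local minima, hence critical, hence equal to \<open>p\<close>
      by discreteness.\<close>
    have flat: "f (?e (t *\<^sub>R v)) = f p" if "t \<in> {0..1}" for t
      using conv[OF that, of v] min[of "t *\<^sub>R v"] fv by (simp add: algebra_simps)
    obtain T where T: "open T" "T \<inter> critical_points A f = {p}"
      using discreteD[OF disc p] unfolding isolated_in_def by auto
    have oNT: "open (N \<inter> T)" "p \<in> N \<inter> T" using N T by auto
    have "((\<lambda>t. t *\<^sub>R v) \<longlongrightarrow> 0 *\<^sub>R v) (at_right (0 :: real))"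
      by (rule tendsto_scaleR[OF tendsto_ident_at tendsto_const])
    from isCont_tendsto_compose[OF _ this, of ?e]
    have "((\<lambda>t. ?e (t *\<^sub>R v)) \<longlongrightarrow> ?e (0 *\<^sub>R v)) (at_right (0 :: real))"
      using ce by (simp add: continuous_on_eq_continuous_at)
    then have "\<forall>\<^sub>F t in at_right (0 :: real). ?e (t *\<^sub>R v) \<in> N \<inter> T"
      by (rule topological_tendstoD[OF _ oNT(1)]) (use oNT(2) e0 in simp)
    moreover have "\<forall>\<^sub>F t in at_right (0 :: real). t < min 1 (\<epsilon> / norm v)"
      by (rule order_tendstoD[OF tendsto_ident_at]) (use \<epsilon>(1) v in simp)
    moreover have "\<forall>\<^sub>F t in at_right (0 :: real). t > 0"
      by (rule eventually_at_right_less)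
    ultimately have "\<forall>\<^sub>F t in at_right (0 :: real). ?e (t *\<^sub>R v) \<in> N \<inter> T \<and> t < min 1 (\<epsilon> / norm v) \<and> t > 0"
      by (intro eventually_conj)
    then obtain t where t: "?e (t *\<^sub>R v) \<in> N \<inter> T" "t < min 1 (\<epsilon> / norm v)" "t > 0"
      using eventually_happens'[of "at_right (0 :: real)"] by auto
    have "?e (t *\<^sub>R v) \<in> critical_points A f"
      by (rule local_min_critical[OF f(1) oNT(1) t(1)]) (use flat[of t] t local_min in auto)
    then have ep: "?e (t *\<^sub>R v) = p" using t(1) T(2) by auto
    \<comment> \<open>At a vector sent to \<open>p\<close> the estimate at 0 bounds its norm by half
      its norm.\<close>
    have "norm (t *\<^sub>R v) < \<epsilon>" using t v by (simp add: pos_less_divide_eq)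
    from conjunct2[OF \<epsilon>(2)[OF this]] show False using ep t(3) v by simp
  qed
  have e_iff: "?e v = p \<longleftrightarrow> v = 0" for v using strict[of v] e0 by (cases "v = 0") auto
  have proper: "bounded (?e -` K)" if K: "compact K" for K
  proof -
    have "compact (f ` K)"
      by (rule compact_continuous_image[OF continuous_on_subset[OF smooth_functions_continuous[OF f(1)]] K]) simp
    then have "bounded (f ` K)" by (rule compact_imp_bounded)
    then obtain b where b0: "\<forall>y\<in>f ` K. norm y \<le> b" unfolding bounded_iff by (elim exE)
    have b: "f z \<le> b" if "z \<in> K" for z
      using bspec[OF b0 imageI[OF that]] by simp
    have "sphere (0 :: 'e) 1 \<noteq> {}" by simp
    from continuous_attains_inf[OF compact_sphere this continuous_on_subset[OF cfe subset_UNIV]]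
    obtain u where u: "u \<in> sphere (0 :: 'e) 1" "\<forall>w\<in>sphere 0 1. f (?e u) \<le> f (?e w)"
      by (elim bexE)
    \<comment> \<open>The least growth over unit directions, positive by \<open>strict\<close> and
      compactness. Convexity on the ray through \<open>v\<close>, at parameter 1 / |v|, turns it
      into the lower bound \<open>f p\<close> + m |v| for |v| > 1, so a bound for \<open>f\<close>
      on \<open>K\<close> bounds |v|.\<close>
    define m where "m = f (?e u) - f p"
    have m: "m > 0" using strict[of u] u(1) by (cases "u = 0") (auto simp: m_def)
    have "norm v \<le> max 1 ((b - f p) / m)" if "?e v \<in> K" for v
    proof (cases "norm v \<le> 1")
      case False
      let ?w = "(1 / norm v) *\<^sub>R v"
      have "v \<noteq> 0" using False by (cases "v = 0") auto
      then have "?w \<in> sphere 0 1" by simp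
      with u(2) have "f (?e u) \<le> f (?e ?w)" by (rule bspec)
      then have "f p + m \<le> f (?e ?w)" by (simp add: m_def)
      also have "\<dots> \<le> (1 - 1 / norm v) * f p + 1 / norm v * f (?e v)"
        by (rule conv) (use False in \<open>auto simp: divide_simps\<close>)
      also have "\<dots> \<le> (1 - 1 / norm v) * f p + 1 / norm v * b"
        using b[OF that] by (intro add_left_mono mult_left_mono) auto
      finally have "m \<le> (b - f p) / norm v" by (simp add: algebra_simps diff_divide_distrib)
      then have "m * norm v \<le> b - f p"
        by (rule iffD1[OF pos_le_divide_eq, rotated]) (use False norm_ge_zero[of v] in linarith)
      then have "norm v * m \<le> b - f p" by (simp only: mult.commute)
      then have "norm v \<le> (b - f p) / m" using m by (simp add: pos_le_divide_eq)
      then show ?thesis by simp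
    qed simp
    then show ?thesis
      unfolding bounded_iff by (intro exI[of _ "max 1 ((b - f p) / m)"] ballI) (simp only: vimage_eq)
  qed
  have "surj ?e"
    by (rule proper_map_surj[OF conn ce proper e_iff cb.U pU \<epsilon>])
  then obtain v where v: "q = ?e v" by (metis surjD)
  have "v \<noteq> 0"
  proof
    assume "v = 0"
    then show False using v e0 \<open>p \<noteq> q\<close> by simp
  qed
  \<comment> \<open>The geodesic reversed, so that it starts at the critical point \<open>q\<close>
    and ends at \<open>p\<close>.\<close>
  let ?back = "\<lambda>t. cb.exp_curve v (-1 * t + 1)"
  have "f (?back 0) \<le> f (?back 1)"
    by (rule critical_start_le[OF f geodesic_affine[OF cb.exp_curve(1)]]) (use q v in \<open>simp add: cb.gexp_def\<close>)
  then have "f (?e v) \<le> f p" using curve0 by (simp add: cb.gexp_def)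
  then show False using strict[OF \<open>v \<noteq> 0\<close>] by simp
qed

end

text \<open>An injective chart into \<open>{0}\<close> has at most one point in its domain, so
  points are open; a connected space with open points is a single point.\<close>

lemma zero_dimensional_singleton:
  fixes A :: "('m::{t2_space, second_countable_topology}, 'e::euclidean_space) chart set"
  assumes conn: "connected (UNIV :: 'm set)"
    and chart: "\<And>U \<phi>. (U, \<phi>) \<in> A \<Longrightarrow> open U \<and> \<phi> ` U \<subseteq> {0} \<and> homeomorphism U (\<phi> ` U) \<phi> (inv_into U \<phi>)"
    and cover: "(\<Union>(U, \<phi>)\<in>A. U) = UNIV"
  shows "x = (y :: 'm)"
proof -
  have op: "open {x :: 'm}" for x
  proof -
    have "x \<in> (\<Union>(U, \<phi>)\<in>A. U)" unfolding cover by simp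
    then obtain U \<phi> where U: "(U, \<phi>) \<in> A" "x \<in> U" by auto
    have C: "open U" "\<phi> ` U \<subseteq> {0}" "homeomorphism U (\<phi> ` U) \<phi> (inv_into U \<phi>)"
      by (rule conjunct1[OF chart[OF U(1)]], rule conjunct1[OF conjunct2[OF chart[OF U(1)]]],
          rule conjunct2[OF conjunct2[OF chart[OF U(1)]]])
    have "U \<subseteq> {x}"
    proof
      fix u assume u: "u \<in> U"
      have "\<phi> u \<in> {0}" "\<phi> x \<in> {0}"
        by (rule subsetD[OF C(2) imageI[OF u]], rule subsetD[OF C(2) imageI[OF U(2)]])
      then have "inv_into U \<phi> (\<phi> u) = inv_into U \<phi> (\<phi> x)" by simp
      then have "u = x"
        unfolding homeomorphism_apply1[OF C(3) u] homeomorphism_apply1[OF C(3) U(2)] .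
      then show "u \<in> {x}" by simp
    qed
    moreover have "{x} \<subseteq> U" using U(2) by simp
    ultimately have "U = {x}" by (rule equalityI)
    then show ?thesis using C(1) by simp
  qed
  have "\<exists>N. open N \<and> z \<in> N \<and> (\<forall>w\<in>N. (w = y) \<longleftrightarrow> (z = y))" for z
    using op[of z] by (intro exI[of _ "{z}"]) simp
  from clopen_of_local[where Q = "\<lambda>z. z = y", OF this conn refl] show ?thesis .
qed

theorem proposition3p6:
  fixes A :: "('m::{t2_space, second_countable_topology}, 'e::euclidean_space) chart set"
    and f :: "'m \<Rightarrow> real"
  assumes "smooth_atlas A"
    and "connected (UNIV :: 'm set)"
    and "f \<in> smooth_functions A"
    and "\<exists>D. affine_connection A D \<and> torsion_free A D \<and> geodesically_complete A D \<and> g_convex A D f"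
    and "discrete (critical_points A f)"
  shows "finite (critical_points A f) \<and> card (critical_points A f) \<le> 1"
proof -
  from assms(1) obtain E where E: "E \<in> {UNIV, {0}}"
    and charts0: "\<forall>(U, \<phi>)\<in>A.
      open U \<and> openin (top_of_set E) (\<phi> ` U) \<and> homeomorphism U (\<phi> ` U) \<phi> (inv_into U \<phi>)"
    and cover: "(\<Union>(U, \<phi>)\<in>A. U) = UNIV"
    and trans0: "\<forall>(U, \<phi>)\<in>A. \<forall>(V, \<psi>)\<in>A. smooth_on (\<phi> ` (U \<inter> V)) (\<psi> \<circ> inv_into U \<phi>)"
    unfolding smooth_atlas_def by (elim conjE bexE)
  have charts: "open U" "openin (top_of_set E) (\<phi> ` U)" "homeomorphism U (\<phi> ` U) \<phi> (inv_into U \<phi>)"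
    if "(U, \<phi>) \<in> A" for U \<phi>
    using bspec[OF charts0 that] by simp_all
  have trans: "smooth_on (\<phi> ` (U \<inter> V)) (\<psi> \<circ> inv_into U \<phi>)"
    if "(U, \<phi>) \<in> A" "(V, \<psi>) \<in> A" for U \<phi> V \<psi>
    using bspec[OF bspec[OF trans0 that(1), unfolded case_prod_conv] that(2)] by simp
  have unique: "p = q" if "p \<in> critical_points A f" "q \<in> critical_points A f" for p q
  proof (cases "E = {0}")
    \<comment> \<open>In dimension zero the connected manifold is one point, so any two critical
      points coincide.\<close>
    case True
    have "open U \<and> \<phi> ` U \<subseteq> {0} \<and> homeomorphism U (\<phi> ` U) \<phi> (inv_into U \<phi>)"
      if "(U, \<phi>) \<in> A" for U \<phi>
      using charts[OF that] openin_imp_subset[OF charts(2)[OF that]] unfolding True by (intro conjI)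
    from zero_dimensional_singleton[OF assms(2) this cover] show ?thesis .
  next
    case False
    then have "E = UNIV" using E by auto
    from assms(4) obtain D where D: "affine_connection A D" "geodesically_complete A D" "g_convex A D f"
      by auto
    interpret complete_connection A D
    proof unfold_locales
      show "open U" "homeomorphism U (\<phi> ` U) \<phi> (inv_into U \<phi>)" if "(U, \<phi>) \<in> A" for U \<phi>
        by (rule charts[OF that])+
      show "open (\<phi> ` U)" if "(U, \<phi>) \<in> A" for U \<phi>
        using charts(2)[OF that] unfolding \<open>E = UNIV\<close> by simp
      show "\<exists>U \<phi>. (U, \<phi>) \<in> A \<and> p \<in> U" for p
      proof -
        have "p \<in> (\<Union>(U, \<phi>)\<in>A. U)" unfolding cover by simp
        then show ?thesis by auto
      qed
    qed (fact trans D)+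
    show ?thesis by (rule critical_point_unique[OF assms(2,3) D(3) assms(5) that])
  qed
  \<comment> \<open>An infinite set has \<open>card\<close> 0, so finiteness has to be established
    along with the bound.\<close>
  show ?thesis
  proof (cases "critical_points A f = {}")
    case False
    then obtain p where p: "p \<in> critical_points A f" by auto
    have "critical_points A f = {p}"
    proof (rule equalityI)
      show "critical_points A f \<subseteq> {p}"
        by (rule subsetI, rule singleton_iff[THEN iffD2], rule unique[OF _ p])
      show "{p} \<subseteq> critical_points A f" using p by simp
    qed
    then show ?thesis by simp
  qed simp
qed

end
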